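(* Let $n$ and $d$ be positive integers such that $n \equiv 1 \bmod d$. Then, in the Hopf algebra $\mathcal{P}$ of bounded posets, the antipode of the $d$-indivisible noncrossing partition poset $\mathrm{NC}^{d}_{n}$ is given by $$S(\mathrm{NC}^{d}_{n}) = \sum_{T} (-1)^{|T|} \cdot \prod_{E \in T} \mathrm{NC}^{d}_{|E|},$$ where $T$ ranges over all noncrossing hypertrees on the set $[n]$ such that each edge $E$ of $T$ satisfies $|E| \equiv 1 \bmod d$, and $|T|$ denotes the number of edges of $T$.
   Context: Noncrossing partitions: a partition of $[n]=\{1,\dots,n\}$ is noncrossing if there are no $i<j<k<\ell$ with $i,k$ in one block and $j,\ell$ in a different block. $\mathrm{NC}_n$ is the set of noncrossing partitions of $[n]$ ordered by refinement. Kreweras dual: place the symbols $1,1',2,2',\dots,n,n'$ on a circle in this cyclic order; the Kreweras dual $\pi'$ of $\pi\in\mathrm{NC}_n$ is the coarsest partition of $\{1',\dots,n'\}$ such that the blocks of $\pi$ together with the blocks of $\pi'$ form a noncrossing partition of the $2n$ points in this cyclic order. A noncrossing partition $\pi\in\mathrm{NC}_n$ is $d$-indivisible if every block of $\pi$ and every block of $\pi'$ has cardinality congruent to $1$ modulo $d$; $\mathrm{NC}^d_n$ is the subposet of $\mathrm{NC}_n$ of $d$-indivisible noncrossing partitions (ordered by refinement). The Hopf algebra $\mathcal{P}$ is the linear span of isomorphism classes of finite posets with a minimum $\hat 0$ and maximum $\hat 1$, with product given by Cartesian product of posets and coproduct $\Delta(P)=\sum_{\hat0\le x\le\hat1}[\hat0,x]\otimes[x,\hat1]$;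 $S$ denotes its antipode (equivalently $S(P)=\sum_{k\ge0}\sum_{\hat0=x_0<x_1<\cdots<x_k=\hat1}(-1)^k[x_0,x_1]\cdots[x_{k-1},x_k]$). A hypergraph on vertex set $V$ is a collection of subsets (edges) of $V$, each of cardinality at least $2$; it is connected if any two vertices are joined by a sequence of edges with consecutive edges intersecting; a connected hypergraph is a hypertree if $\sum_E(|E|-1)=|V|-1$. A hypergraph on $[n]$ is noncrossing if no two distinct edges $E,F$ admit $i<j<k<\ell$ with $i,k\in E$ and $j,\ell\in F$. *)

theory Defs
  imports
    Complex_Main
    "HOL-Library.Poly_Mapping"
    "HOL-Library.Disjoint_Sets"
    "HOL-Library.Countable_Set"
    "HOL-Number_Theory.Cong"
begin

section \<open>Finite bounded posets up to isomorphism\<close>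

text \<open>A poset is represented by its (reflexive) order relation; the carrier is its \<^const>\<open>Field\<close>.\<close>

definition bounded_poset :: "'a rel \<Rightarrow> bool" where
  "bounded_poset r \<longleftrightarrow> finite (Field r) \<and> Partial_order r \<and>
     (\<exists>b\<in>Field r. \<forall>a\<in>Field r. (b, a) \<in> r) \<and> (\<exists>t\<in>Field r. \<forall>a\<in>Field r. (a, t) \<in> r)"

definition poset_iso :: "'a rel \<Rightarrow> 'b rel \<Rightarrow> bool" where
  "poset_iso r s \<longleftrightarrow> (\<exists>f. bij_betw f (Field r) (Field s) \<and>
     (\<forall>x\<in>Field r. \<forall>y\<in>Field r. (x, y) \<in> r \<longleftrightarrow> (f x, f y) \<in> s))"

definition poset_bot :: "'a rel \<Rightarrow> 'a" where
  "poset_bot r = (THE b. b \<in> Field r \<and> (\<forall>a\<in>Field r. (b, a) \<in> r))"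

definition poset_top :: "'a rel \<Rightarrow> 'a" where
  "poset_top r = (THE t. t \<in> Field r \<and> (\<forall>a\<in>Field r. (a, t) \<in> r))"

definition interval :: "'a rel \<Rightarrow> 'a \<Rightarrow> 'a \<Rightarrow> 'a rel" where
  "interval r x y = {(a, b) \<in> r. (x, a) \<in> r \<and> (b, y) \<in> r}"

definition prod_poset :: "'a rel \<Rightarrow> 'b rel \<Rightarrow> ('a \<times> 'b) rel" where
  "prod_poset r s = {((a, c), (b, d)) | a b c d. (a, b) \<in> r \<and> (c, d) \<in> s}"

lemma poset_iso_refl: "poset_iso r r"
  unfolding poset_iso_def by (rule exI[of _ id]) auto

lemma poset_iso_sym:
  assumes "poset_iso r s" shows "poset_iso s r"
proof -
  obtain f where f: "bij_betw f (Field r) (Field s)"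
    and o: "\<forall>x\<in>Field r. \<forall>y\<in>Field r. (x, y) \<in> r \<longleftrightarrow> (f x, f y) \<in> s"
    using assms unfolding poset_iso_def by blast
  let ?g = "inv_into (Field r) f"
  have g: "bij_betw ?g (Field s) (Field r)" by (rule bij_betw_inv_into[OF f])
  have "(x, y) \<in> s \<longleftrightarrow> (?g x, ?g y) \<in> r" if "x \<in> Field s" "y \<in> Field s" for x y
    using o that bij_betwE[OF g] bij_betw_inv_into_right[OF f] by simp
  then show ?thesis unfolding poset_iso_def using g by blast
qed

lemma poset_iso_trans:
  assumes "poset_iso r s" "poset_iso s t" shows "poset_iso r t"
proof -
  obtain f where f: "bij_betw f (Field r) (Field s)"
    and o: "\<forall>x\<in>Field r. \<forall>y\<in>Field r. (x, y) \<in> r \<longleftrightarrow> (f x, f y) \<in> s"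
    using assms(1) unfolding poset_iso_def by blast
  obtain g where g: "bij_betw g (Field s) (Field t)"
    and p: "\<forall>x\<in>Field s. \<forall>y\<in>Field s. (x, y) \<in> s \<longleftrightarrow> (g x, g y) \<in> t"
    using assms(2) unfolding poset_iso_def by blast
  have "bij_betw (g \<circ> f) (Field r) (Field t)" by (rule bij_betw_trans[OF f g])
  moreover have "(x, y) \<in> r \<longleftrightarrow> ((g \<circ> f) x, (g \<circ> f) y) \<in> t" if "x \<in> Field r" "y \<in> Field r" for x y
    using o p that f by (auto dest: bij_betwE)
  ultimately show ?thesis unfolding poset_iso_def by blast
qed

definition bposet_eq :: "nat rel \<Rightarrow> nat rel \<Rightarrow> bool" where
  "bposet_eq r s \<longleftrightarrow> bounded_poset r \<and> bounded_poset s \<and> poset_iso r s"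

lemma Partial_order_iff:
  "Partial_order r \<longleftrightarrow> (\<forall>x\<in>Field r. (x, x) \<in> r) \<and>
     (\<forall>x\<in>Field r. \<forall>y\<in>Field r. \<forall>z\<in>Field r. (x, y) \<in> r \<longrightarrow> (y, z) \<in> r \<longrightarrow> (x, z) \<in> r) \<and>
     (\<forall>x\<in>Field r. \<forall>y\<in>Field r. (x, y) \<in> r \<longrightarrow> (y, x) \<in> r \<longrightarrow> x = y)" (is "?L \<longleftrightarrow> ?R")
proof
  assume ?L
  then show ?R unfolding order_on_defs refl_on_def by (blast dest: transD antisymD)
next
  assume R: ?R
  have "trans r" by (rule transI) (use R in \<open>meson FieldI1 FieldI2\<close>)
  moreover have "antisym r" by (rule antisymI) (use R in \<open>meson FieldI1 FieldI2\<close>)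
  moreover have "r \<subseteq> Field r \<times> Field r" by (auto simp: Field_def)
  ultimately show ?L using R unfolding order_on_defs refl_on_def by simp
qed

lemma bounded_poset_single: "bounded_poset {(a, a)}"
proof -
  have "Field {(a, a)} = {a}" by (simp add: Field_def)
  then show ?thesis unfolding bounded_poset_def Partial_order_iff by simp
qed

text \<open>Every finite poset is isomorphic to one on natural numbers, so the isomorphism classes of
  finite bounded posets form the following type.\<close>

quotient_type bposet = "nat rel" / partial: bposet_eq
proof (rule part_equivpI)
  show "\<exists>r. bposet_eq r r"
    unfolding bposet_eq_def
    by (rule exI[of _ "{(0, 0)}"]) (simp add: bounded_poset_single poset_iso_refl)
  show "symp bposet_eq"
    by (auto simp: symp_def bposet_eq_def intro: poset_iso_sym)
  show "transp bposet_eq"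
    by (auto simp: transp_def bposet_eq_def intro: poset_iso_trans)
qed

text \<open>The class of a finite bounded poset on an arbitrary type, obtained by transporting it to
  an initial segment of the natural numbers (meaningless for other relations).\<close>

definition iso_class :: "'a rel \<Rightarrow> bposet" where
  "iso_class r = (let f = to_nat_on (Field r) in abs_bposet (map_prod f f ` r))"

lemma Field_map_prod: "Field (map_prod f f ` r) = f ` Field r"
  unfolding Field_def by force

lemma poset_iso_map_prod:
  assumes "inj_on f (Field r)" shows "poset_iso r (map_prod f f ` r)"
proof -
  have "(x, y) \<in> r" if "x \<in> Field r" "y \<in> Field r" "(f x, f y) \<in> map_prod f f ` r" for x y
  proof -
    from that(3) obtain a b where ab: "(a, b) \<in> r" "f x = f a" "f y = f b" by auto
    moreover have "a \<in> Field r" "b \<in> Field r" using ab(1) by (auto simp: Field_def)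
    ultimately show ?thesis using assms that by (metis inj_onD)
  qed
  then show ?thesis unfolding poset_iso_def Field_map_prod
    using assms by (intro exI[of _ f] conjI ballI iffI) (force intro: inj_on_imp_bij_betw)+
qed

lemma bounded_poset_iso:
  assumes "poset_iso r s" "bounded_poset r" shows "bounded_poset s"
proof -
  obtain f where f: "bij_betw f (Field r) (Field s)"
    and o: "\<And>x y. x \<in> Field r \<Longrightarrow> y \<in> Field r \<Longrightarrow> (x, y) \<in> r \<longleftrightarrow> (f x, f y) \<in> s"
    using assms(1) unfolding poset_iso_def by blast
  have F: "Field s = f ` Field r" and i: "inj_on f (Field r)"
    using f by (auto simp: bij_betw_def)
  have P: "Partial_order r" and fin: "finite (Field r)"
    and b: "\<exists>b\<in>Field r. \<forall>a\<in>Field r. (b, a) \<in> r" and t: "\<exists>t\<in>Field r. \<forall>a\<in>Field r. (a, t) \<in> r"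
    using assms(2) unfolding bounded_poset_def by blast+
  have r: "(a, a) \<in> r" if "a \<in> Field r" for a
    using P that unfolding Partial_order_iff by blast
  have tr: "(a, c) \<in> r" if "(a, b) \<in> r" "(b, c) \<in> r" for a b c
    using P that by (auto simp: order_on_defs dest: transD)
  have an: "a = b" if "(a, b) \<in> r" "(b, a) \<in> r" for a b
    using P that by (auto simp: order_on_defs dest: antisymD)
  have "(x, x) \<in> s" if "x \<in> Field s" for x
    using that r o unfolding F by auto
  moreover have "(x, z) \<in> s"
    if prm: "x \<in> Field s" "y \<in> Field s" "z \<in> Field s" "(x, y) \<in> s" "(y, z) \<in> s" for x y z
  proof -
    obtain a b c where w: "a \<in> Field r" "b \<in> Field r" "c \<in> Field r" "x = f a" "y = f b" "z = f c"
      using prm(1-3) unfolding F by blast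
    then have "(a, b) \<in> r" "(b, c) \<in> r" using prm(4,5) o by auto
    then have "(a, c) \<in> r" by (rule tr)
    then show ?thesis using o w by auto
  qed
  moreover have "x = y"
    if prm: "x \<in> Field s" "y \<in> Field s" "(x, y) \<in> s" "(y, x) \<in> s" for x y
  proof -
    obtain a b where w: "a \<in> Field r" "b \<in> Field r" "x = f a" "y = f b"
      using prm(1-2) unfolding F by blast
    then have "(a, b) \<in> r" "(b, a) \<in> r" using prm(3,4) o by auto
    then have "a = b" by (rule an)
    then show ?thesis using w by simp
  qed
  ultimately have "Partial_order s" unfolding Partial_order_iff by blast
  moreover have "finite (Field s)" unfolding F using fin by blast
  moreover have "\<exists>b\<in>Field s. \<forall>a\<in>Field s. (b, a) \<in> s"
  proof -
    obtain c where c: "c \<in> Field r" "\<forall>a\<in>Field r. (c, a) \<in> r" using b by blast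
    show ?thesis unfolding F by (rule bexI[of _ "f c"]) (use c o in auto)
  qed
  moreover have "\<exists>t\<in>Field s. \<forall>a\<in>Field s. (a, t) \<in> s"
  proof -
    obtain c where c: "c \<in> Field r" "\<forall>a\<in>Field r. (a, c) \<in> r" using t by blast
    show ?thesis unfolding F by (rule bexI[of _ "f c"]) (use c o in auto)
  qed
  ultimately show ?thesis unfolding bounded_poset_def by blast
qed

lemma bposet_transport:
  assumes "bounded_poset r"
  defines "s \<equiv> map_prod (to_nat_on (Field r)) (to_nat_on (Field r)) ` r"
  shows "poset_iso r s" "bounded_poset s" "iso_class r = abs_bposet s"
proof -
  have "countable (Field r)"
    using assms(1) by (simp add: bounded_poset_def countable_finite)
  then show 1: "poset_iso r s"
    unfolding s_def by (intro poset_iso_map_prod inj_on_to_nat_on)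
  show "bounded_poset s" by (rule bounded_poset_iso[OF 1 assms(1)])
  show "iso_class r = abs_bposet s" by (simp add: iso_class_def s_def Let_def)
qed

lemma abs_bposet_eq_iff:
  assumes "bounded_poset r" "bounded_poset s"
  shows "abs_bposet r = abs_bposet s \<longleftrightarrow> poset_iso r s"
  using Quotient3_rel[OF Quotient3_bposet, of r s] assms poset_iso_refl
  by (auto simp: bposet_eq_def)

lemma iso_class_eq_iff:
  assumes "bounded_poset r" "bounded_poset s"
  shows "iso_class r = iso_class s \<longleftrightarrow> poset_iso r s"
proof -
  define r' where "r' = map_prod (to_nat_on (Field r)) (to_nat_on (Field r)) ` r"
  define s' where "s' = map_prod (to_nat_on (Field s)) (to_nat_on (Field s)) ` s"
  have r': "poset_iso r r'" "bounded_poset r'" "iso_class r = abs_bposet r'"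
    unfolding r'_def by (rule bposet_transport[OF assms(1)])+
  have s': "poset_iso s s'" "bounded_poset s'" "iso_class s = abs_bposet s'"
    unfolding s'_def by (rule bposet_transport[OF assms(2)])+
  have "poset_iso r' s' \<longleftrightarrow> poset_iso r s"
    using poset_iso_trans[OF r'(1) poset_iso_trans[OF _ poset_iso_sym[OF s'(1)]]]
      poset_iso_trans[OF poset_iso_sym[OF r'(1)] poset_iso_trans[OF _ s'(1)]] by (rule iffI)
  then show ?thesis by (simp add: r' s' abs_bposet_eq_iff)
qed

lemma bounded_poset_rep: "bounded_poset (rep_bposet P)"
  using Quotient3_rep_reflp[OF Quotient3_bposet, of P] by (simp add: bposet_eq_def)

lemma iso_class_rep: "iso_class (rep_bposet P) = P"
proof -
  define s where "s = map_prod (to_nat_on (Field (rep_bposet P))) (to_nat_on (Field (rep_bposet P))) ` rep_bposet P"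
  have s: "poset_iso (rep_bposet P) s" "bounded_poset s" "iso_class (rep_bposet P) = abs_bposet s"
    unfolding s_def by (rule bposet_transport[OF bounded_poset_rep])+
  have "abs_bposet (rep_bposet P) = abs_bposet s"
    by (simp add: abs_bposet_eq_iff bounded_poset_rep s(1,2))
  then have "iso_class (rep_bposet P) = abs_bposet (rep_bposet P)" by (simp add: s(3))
  then show ?thesis by (simp add: Quotient3_abs_rep[OF Quotient3_bposet])
qed

lemma poset_iso_rep: "bounded_poset r \<Longrightarrow> poset_iso (rep_bposet (iso_class r)) r"
  by (simp add: iso_class_eq_iff[OF bounded_poset_rep, symmetric] iso_class_rep)

lemma Field_interval:
  assumes "Partial_order r" "(x, y) \<in> r"
  shows "Field (interval r x y) = {z. (x, z) \<in> r \<and> (z, y) \<in> r}"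
proof -
  have F: "a \<in> Field r \<and> b \<in> Field r" if "(a, b) \<in> r" for a b
    using that by (auto simp: Field_def)
  have tr: "(a, c) \<in> r" if "(a, b) \<in> r" "(b, c) \<in> r" for a b c
    using assms(1) that by (auto simp: order_on_defs dest: transD)
  have re: "(z, z) \<in> r" if "(x, z) \<in> r" for z
    using assms(1) F[OF that] by (auto simp: Partial_order_iff)
  show ?thesis
  proof (intro set_eqI iffI)
    fix z assume "z \<in> Field (interval r x y)"
    then show "z \<in> {z. (x, z) \<in> r \<and> (z, y) \<in> r}"
      unfolding Field_def interval_def using tr by blast
  next
    fix z assume "z \<in> {z. (x, z) \<in> r \<and> (z, y) \<in> r}"
    then have "(z, z) \<in> interval r x y" using re by (auto simp: interval_def)
    then show "z \<in> Field (interval r x y)" by (rule FieldI1)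
  qed
qed

lemma bounded_poset_interval:
  assumes "bounded_poset r" "(x, y) \<in> r"
  shows "bounded_poset (interval r x y)"
proof -
  have P: "Partial_order r" and fin: "finite (Field r)"
    using assms(1) by (auto simp: bounded_poset_def)
  have F: "a \<in> Field r \<and> b \<in> Field r" if "(a, b) \<in> r" for a b
    using that by (auto simp: Field_def)
  note I = Field_interval[OF P assms(2)]
  have re: "(a, a) \<in> r" if "a \<in> Field r" for a
    using P that by (auto simp: Partial_order_iff)
  have xy: "(x, x) \<in> r" "(y, y) \<in> r" using F[OF assms(2)] re by auto
  have tr: "trans r" and an: "antisym r" using P by (simp_all add: order_on_defs)
  have "Partial_order (interval r x y)"
    unfolding order_on_defs
  proof (intro conjI)
    show "interval r x y \<subseteq> Field (interval r x y) \<times> Field (interval r x y)"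
      by (auto simp: Field_def)
    show "Refl (interval r x y)"
      unfolding refl_on_def I using F re by (auto simp: interval_def)
    show "trans (interval r x y)"
      by (rule transI) (use tr in \<open>auto simp: interval_def dest: transD\<close>)
    show "antisym (interval r x y)"
      by (rule antisymI) (use an in \<open>auto simp: interval_def dest: antisymD\<close>)
  qed
  moreover have "finite (Field (interval r x y))"
    unfolding I by (rule finite_subset[OF _ fin]) (use F in blast)
  moreover have "\<exists>b\<in>Field (interval r x y). \<forall>a\<in>Field (interval r x y). (b, a) \<in> interval r x y"
    unfolding I by (rule bexI[of _ x]) (use xy assms(2) in \<open>auto simp: interval_def\<close>)
  moreover have "\<exists>t\<in>Field (interval r x y). \<forall>a\<in>Field (interval r x y). (a, t) \<in> interval r x y"
    unfolding I by (rule bexI[of _ y]) (use xy assms(2) in \<open>auto simp: interval_def\<close>)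
  ultimately show ?thesis unfolding bounded_poset_def by blast
qed

lemma poset_bot_eqI:
  assumes "Partial_order r" "b \<in> Field r" "\<And>a. a \<in> Field r \<Longrightarrow> (b, a) \<in> r"
  shows "poset_bot r = b"
  unfolding poset_bot_def
  by (rule the_equality) (use assms in \<open>auto simp: order_on_defs dest: antisymD\<close>)

lemma poset_top_eqI:
  assumes "Partial_order r" "t \<in> Field r" "\<And>a. a \<in> Field r \<Longrightarrow> (a, t) \<in> r"
  shows "poset_top r = t"
  unfolding poset_top_def
  by (rule the_equality) (use assms in \<open>auto simp: order_on_defs dest: antisymD\<close>)

lemma bounded_poset_bot:
  assumes "bounded_poset r"
  shows "poset_bot r \<in> Field r" "a \<in> Field r \<Longrightarrow> (poset_bot r, a) \<in> r"
proof -
  obtain b where b: "Partial_order r" "b \<in> Field r" "\<And>a. a \<in> Field r \<Longrightarrow> (b, a) \<in> r"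
    using assms unfolding bounded_poset_def by auto
  then show "poset_bot r \<in> Field r" "a \<in> Field r \<Longrightarrow> (poset_bot r, a) \<in> r"
    using poset_bot_eqI[OF b] by simp_all
qed

lemma bounded_poset_top:
  assumes "bounded_poset r"
  shows "poset_top r \<in> Field r" "a \<in> Field r \<Longrightarrow> (a, poset_top r) \<in> r"
proof -
  obtain t where t: "Partial_order r" "t \<in> Field r" "\<And>a. a \<in> Field r \<Longrightarrow> (a, t) \<in> r"
    using assms unfolding bounded_poset_def by auto
  then show "poset_top r \<in> Field r" "a \<in> Field r \<Longrightarrow> (a, poset_top r) \<in> r"
    using poset_top_eqI[OF t] by simp_all
qed

lemma mem_prod_poset [simp]: "((a, c), (b, d)) \<in> prod_poset r s \<longleftrightarrow> (a, b) \<in> r \<and> (c, d) \<in> s"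
  by (auto simp: prod_poset_def)

lemma Field_prod_poset:
  assumes "Partial_order r" "Partial_order s"
  shows "Field (prod_poset r s) = Field r \<times> Field s"
proof (rule set_eqI)
  fix z :: "'a \<times> 'b"
  obtain x y where z: "z = (x, y)" by force
  have R: "(a, a) \<in> r" if "a \<in> Field r" for a
    using assms(1) that by (simp add: order_on_defs refl_on_def)
  have S: "(a, a) \<in> s" if "a \<in> Field s" for a
    using assms(2) that by (simp add: order_on_defs refl_on_def)
  show "z \<in> Field (prod_poset r s) \<longleftrightarrow> z \<in> Field r \<times> Field s"
  proof
    assume "z \<in> Field (prod_poset r s)"
    then show "z \<in> Field r \<times> Field s" by (auto simp: Field_def prod_poset_def)
  next
    assume "z \<in> Field r \<times> Field s"
    then have "(z, z) \<in> prod_poset r s" using R S by (simp add: z)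
    then show "z \<in> Field (prod_poset r s)" by (rule FieldI1)
  qed
qed

lemma bounded_poset_prod:
  assumes "bounded_poset r" "bounded_poset s" shows "bounded_poset (prod_poset r s)"
proof -
  have P: "Partial_order r" "Partial_order s" using assms by (auto simp: bounded_poset_def)
  have tr: "trans r" "trans s" and an: "antisym r" "antisym s" and re: "Refl r" "Refl s"
    using P by (simp_all add: order_on_defs)
  have "Partial_order (prod_poset r s)"
    unfolding order_on_defs
  proof (intro conjI)
    show "prod_poset r s \<subseteq> Field (prod_poset r s) \<times> Field (prod_poset r s)"
      by (auto simp: Field_def)
    show "Refl (prod_poset r s)"
      unfolding refl_on_def Field_prod_poset[OF P] using re by (auto simp: refl_on_def)
    show "trans (prod_poset r s)"
      by (rule transI) (use tr in \<open>auto simp: prod_poset_def dest: transD\<close>)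
    show "antisym (prod_poset r s)"
      by (rule antisymI) (use an in \<open>auto simp: prod_poset_def dest: antisymD\<close>)
  qed
  moreover have "finite (Field (prod_poset r s))"
    using assms by (simp add: Field_prod_poset[OF P] bounded_poset_def)
  moreover have "\<exists>b\<in>Field (prod_poset r s). \<forall>a\<in>Field (prod_poset r s). (b, a) \<in> prod_poset r s"
    unfolding Field_prod_poset[OF P] by (rule bexI[of _ "(poset_bot r, poset_bot s)"])
      (auto simp: bounded_poset_bot[OF assms(1)] bounded_poset_bot[OF assms(2)])
  moreover have "\<exists>t\<in>Field (prod_poset r s). \<forall>a\<in>Field (prod_poset r s). (a, t) \<in> prod_poset r s"
    unfolding Field_prod_poset[OF P] by (rule bexI[of _ "(poset_top r, poset_top s)"])
      (auto simp: bounded_poset_top[OF assms(1)] bounded_poset_top[OF assms(2)])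
  ultimately show ?thesis unfolding bounded_poset_def by (intro conjI)
qed

lemma poset_iso_prod:
  assumes "bounded_poset r" "bounded_poset s" "poset_iso r r'" "poset_iso s s'"
  shows "poset_iso (prod_poset r s) (prod_poset r' s')"
proof -
  have P: "Partial_order r" "Partial_order s" using assms by (auto simp: bounded_poset_def)
  have P': "Partial_order r'" "Partial_order s'"
    using bounded_poset_iso[OF assms(3,1)] bounded_poset_iso[OF assms(4,2)]
    by (simp_all add: bounded_poset_def)
  obtain f where f: "bij_betw f (Field r) (Field r')"
    and o: "\<forall>x\<in>Field r. \<forall>y\<in>Field r. (x, y) \<in> r \<longleftrightarrow> (f x, f y) \<in> r'"
    using assms(3) unfolding poset_iso_def by blast
  obtain g where g: "bij_betw g (Field s) (Field s')"
    and p: "\<forall>x\<in>Field s. \<forall>y\<in>Field s. (x, y) \<in> s \<longleftrightarrow> (g x, g y) \<in> s'"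
    using assms(4) unfolding poset_iso_def by blast
  have "bij_betw (map_prod f g) (Field r \<times> Field s) (Field r' \<times> Field s')"
    using f g by (rule bij_betw_map_prod)
  then show ?thesis unfolding poset_iso_def Field_prod_poset[OF P] Field_prod_poset[OF P']
    using o p by (intro exI[of _ "map_prod f g"]) auto
qed

text \<open>The monoid of isomorphism classes under Cartesian product is written additively, with the
  one-point poset as \<open>0\<close>: this is the convention under which the product of \<^typ>\<open>bposet \<Rightarrow>\<^sub>0 'k\<close>
  is the one of the monoid algebra.\<close>

instantiation bposet :: comm_monoid_add
begin

definition zero_bposet :: bposet where
  "0 = iso_class {((), ())}"

definition plus_bposet :: "bposet \<Rightarrow> bposet \<Rightarrow> bposet" where
  "P + Q = iso_class (prod_poset (rep_bposet P) (rep_bposet Q))"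

lemma plus_iso_class:
  assumes "bounded_poset r" "bounded_poset s"
  shows "iso_class r + iso_class s = iso_class (prod_poset r s)"
  unfolding plus_bposet_def
  by (subst iso_class_eq_iff) 
    (auto intro!: bounded_poset_prod poset_iso_prod bounded_poset_rep poset_iso_rep assms)

instance
proof
  fix P Q R :: bposet
  let ?p = "rep_bposet P" and ?q = "rep_bposet Q" and ?r = "rep_bposet R"
  have p: "Partial_order ?p" "Partial_order ?q" "Partial_order ?r"
    using bounded_poset_rep by (auto simp: bounded_poset_def)
  note b = bounded_poset_rep bounded_poset_prod bounded_poset_single
  have PO: "Partial_order (prod_poset ?p ?q)" "Partial_order (prod_poset ?q ?r)"
    "Partial_order {((), ())}"
    using b(2)[OF b(1)[of P] b(1)[of Q]] b(2)[OF b(1)[of Q] b(1)[of R]] b(3)[of "()"]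
    unfolding bounded_poset_def by blast+
  have "poset_iso (prod_poset (prod_poset ?p ?q) ?r) (prod_poset ?p (prod_poset ?q ?r))"
    unfolding poset_iso_def Field_prod_poset[OF PO(1) p(3)] Field_prod_poset[OF p(1) PO(2)]
      Field_prod_poset[OF p(1,2)] Field_prod_poset[OF p(2,3)]
    by (rule exI[of _ "\<lambda>((x, y), z). (x, (y, z))"]) (auto simp: bij_betw_def inj_on_def image_def)
  then have "iso_class ?p + iso_class ?q + iso_class ?r = iso_class ?p + (iso_class ?q + iso_class ?r)"
    by (simp add: plus_iso_class iso_class_eq_iff b)
  then show "P + Q + R = P + (Q + R)" by (simp add: iso_class_rep)
  have "poset_iso (prod_poset ?p ?q) (prod_poset ?q ?p)"
    unfolding poset_iso_def Field_prod_poset[OF p(1,2)] Field_prod_poset[OF p(2,1)]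
    by (rule exI[of _ prod.swap]) (auto simp: bij_betw_def)
  then have "iso_class ?p + iso_class ?q = iso_class ?q + iso_class ?p"
    by (simp add: plus_iso_class iso_class_eq_iff b)
  then show "P + Q = Q + P" by (simp add: iso_class_rep)
  have "poset_iso (prod_poset {((), ())} ?p) ?p"
    unfolding poset_iso_def Field_prod_poset[OF PO(3) p(1)]
    by (rule exI[of _ snd]) (auto simp: bij_betw_def inj_on_def Field_def image_def)
  then have "iso_class {((), ())} + iso_class ?p = iso_class ?p"
    by (simp add: plus_iso_class iso_class_eq_iff b)
  then show "0 + P = P" by (simp add: iso_class_rep zero_bposet_def)
qed

end

section \<open>The Hopf algebra of bounded posets\<close>

text \<open>The Hopf algebra over a field \<open>'k\<close> is the monoid algebra \<^typ>\<open>bposet \<Rightarrow>\<^sub>0 'k\<close>; its tensor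
  square is the free module \<^typ>\<open>(bposet \<times> bposet) \<Rightarrow>\<^sub>0 'k\<close>, where the basis element
  \<open>(P, Q)\<close> stands for the tensor product of \<open>P\<close> and \<open>Q\<close>.\<close>

definition scale :: "'k::comm_ring_1 \<Rightarrow> ('a \<Rightarrow>\<^sub>0 'k) \<Rightarrow> ('a \<Rightarrow>\<^sub>0 'k)" where
  "scale c = Poly_Mapping.map ((*) c)"

definition basis :: "'a \<Rightarrow> ('a \<Rightarrow>\<^sub>0 'k::comm_ring_1)" where
  "basis a = Poly_Mapping.single a 1"

definition lin_ext :: "('a \<Rightarrow> ('b \<Rightarrow>\<^sub>0 'k)) \<Rightarrow> ('a \<Rightarrow>\<^sub>0 'k::comm_ring_1) \<Rightarrow> ('b \<Rightarrow>\<^sub>0 'k)" where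
  "lin_ext f h = (\<Sum>a\<in>Poly_Mapping.keys h. scale (Poly_Mapping.lookup h a) (f a))"

definition coproduct_poset :: "'a rel \<Rightarrow> (bposet \<times> bposet \<Rightarrow>\<^sub>0 'k::comm_ring_1)" where
  "coproduct_poset r = (\<Sum>x\<in>Field r.
     basis (iso_class (interval r (poset_bot r) x), iso_class (interval r x (poset_top r))))"

definition coproduct :: "(bposet \<Rightarrow>\<^sub>0 'k::comm_ring_1) \<Rightarrow> (bposet \<times> bposet \<Rightarrow>\<^sub>0 'k)" where
  "coproduct = lin_ext (\<lambda>P. coproduct_poset (rep_bposet P))"

lemma coproduct_poset_iso:
  assumes "bounded_poset r" "poset_iso r s"
  shows "coproduct_poset r = coproduct_poset s"
proof -
  have s: "bounded_poset s" by (rule bounded_poset_iso[OF assms(2,1)])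
  have P: "Partial_order r" "Partial_order s" using assms s by (auto simp: bounded_poset_def)
  obtain f where f: "bij_betw f (Field r) (Field s)"
    and o: "\<And>x y. x \<in> Field r \<Longrightarrow> y \<in> Field r \<Longrightarrow> (x, y) \<in> r \<longleftrightarrow> (f x, f y) \<in> s"
    using assms(2) unfolding poset_iso_def by blast
  have im: "Field s = f ` Field r" and inj: "inj_on f (Field r)"
    using f by (auto simp: bij_betw_def)
  have F: "a \<in> Field r \<and> b \<in> Field r" if "(a, b) \<in> r" for a b
    using that by (auto simp: Field_def)
  have F': "a \<in> Field s \<and> b \<in> Field s" if "(a, b) \<in> s" for a b
    using that by (auto simp: Field_def)
  have bot: "poset_bot s = f (poset_bot r)"
    by (rule poset_bot_eqI[OF P(2)])
      (use bounded_poset_bot[OF assms(1)] o in \<open>auto simp: im\<close>)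
  have top: "poset_top s = f (poset_top r)"
    by (rule poset_top_eqI[OF P(2)])
      (use bounded_poset_top[OF assms(1)] o in \<open>auto simp: im\<close>)
  have iv: "iso_class (interval r x y) = iso_class (interval s (f x) (f y))" if xy: "(x, y) \<in> r" for x y
  proof -
    have xy': "(f x, f y) \<in> s" using xy F[OF xy] o by blast
    have I: "Field (interval s (f x) (f y)) = f ` Field (interval r x y)"
      unfolding Field_interval[OF P(1) xy] Field_interval[OF P(2) xy']
    proof (intro set_eqI iffI)
      fix z assume z: "z \<in> {z. (f x, z) \<in> s \<and> (z, f y) \<in> s}"
      then obtain w where "w \<in> Field r" "z = f w" using F' im by blast
      then show "z \<in> f ` {z. (x, z) \<in> r \<and> (z, y) \<in> r}" using z o F[OF xy] by blast
    next
      fix z assume "z \<in> f ` {z. (x, z) \<in> r \<and> (z, y) \<in> r}"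
      then show "z \<in> {z. (f x, z) \<in> s \<and> (z, f y) \<in> s}" using o F by blast
    qed
    have sub: "Field (interval r x y) \<subseteq> Field r"
      unfolding Field_interval[OF P(1) xy] using F by blast
    have "bij_betw f (Field (interval r x y)) (Field (interval s (f x) (f y)))"
      unfolding I using inj sub by (auto simp: bij_betw_def intro: inj_on_subset)
    moreover have "(a, b) \<in> interval r x y \<longleftrightarrow> (f a, f b) \<in> interval s (f x) (f y)"
      if "a \<in> Field (interval r x y)" "b \<in> Field (interval r x y)" for a b
      using that sub o F[OF xy] unfolding interval_def by blast
    ultimately have "poset_iso (interval r x y) (interval s (f x) (f y))"
      unfolding poset_iso_def by blast
    then show ?thesis
      using iso_class_eq_iff[OF bounded_poset_interval[OF assms(1) xy]
          bounded_poset_interval[OF s xy']] by simp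
  qed
  show ?thesis
    unfolding coproduct_poset_def bot top im sum.reindex[OF inj] o_def
    by (rule sum.cong) (auto simp: iv bounded_poset_bot[OF assms(1)] bounded_poset_top[OF assms(1)])
qed

lemma lookup_scale: "Poly_Mapping.lookup (scale c h) a = c * Poly_Mapping.lookup h a"
  by (simp add: scale_def Poly_Mapping.map.rep_eq when_def)

lemma vector_space_scale: "vector_space (scale :: 'k::field \<Rightarrow> ('a \<Rightarrow>\<^sub>0 'k) \<Rightarrow> ('a \<Rightarrow>\<^sub>0 'k))"
  by unfold_locales
    (auto intro!: poly_mapping_eqI simp: lookup_scale lookup_add algebra_simps)

lemma lin_ext_basis: "lin_ext f (basis a) = f a"
  by (auto simp: lin_ext_def basis_def lookup_scale intro!: poly_mapping_eqI)

lemma coproduct_basis: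
  assumes "bounded_poset r"
  shows "coproduct (basis (iso_class r)) = coproduct_poset r"
  unfolding coproduct_def lin_ext_basis
  by (rule coproduct_poset_iso[OF bounded_poset_rep poset_iso_rep[OF assms]])

definition counit :: "(bposet \<Rightarrow>\<^sub>0 'k::comm_ring_1) \<Rightarrow> 'k" where
  "counit h = Poly_Mapping.lookup h 0"

text \<open>Convolution \<open>m \<circ> (f \<otimes> g) \<circ> \<Delta>\<close>, for linear \<open>f\<close> and \<open>g\<close>.\<close>

definition convolution ::
  "((bposet \<Rightarrow>\<^sub>0 'k::comm_ring_1) \<Rightarrow> (bposet \<Rightarrow>\<^sub>0 'k)) \<Rightarrow> ((bposet \<Rightarrow>\<^sub>0 'k) \<Rightarrow> (bposet \<Rightarrow>\<^sub>0 'k)) \<Rightarrow>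
   (bposet \<Rightarrow>\<^sub>0 'k) \<Rightarrow> (bposet \<Rightarrow>\<^sub>0 'k)" where
  "convolution f g h = lin_ext (\<lambda>(P, Q). f (basis P) * g (basis Q)) (coproduct h)"

definition is_antipode :: "((bposet \<Rightarrow>\<^sub>0 'k::field) \<Rightarrow> (bposet \<Rightarrow>\<^sub>0 'k)) \<Rightarrow> bool" where
  "is_antipode S \<longleftrightarrow> Vector_Spaces.linear scale scale S \<and>
     (\<forall>h. convolution S id h = scale (counit h) 1) \<and>
     (\<forall>h. convolution id S h = scale (counit h) 1)"

text \<open>An inverse of the identity for convolution is unique, by associativity.\<close>

definition antipode :: "(bposet \<Rightarrow>\<^sub>0 'k::field) \<Rightarrow> (bposet \<Rightarrow>\<^sub>0 'k)" where
  "antipode = (THE S. is_antipode S)"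

section \<open>Indivisible noncrossing partitions\<close>

definition noncrossing :: "nat set set \<Rightarrow> bool" where
  "noncrossing \<A> \<longleftrightarrow> \<not> (\<exists>E\<in>\<A>. \<exists>F\<in>\<A>. E \<noteq> F \<and>
     (\<exists>i j k l. i < j \<and> j < k \<and> k < l \<and> i \<in> E \<and> k \<in> E \<and> j \<in> F \<and> l \<in> F))"

definition NCP :: "nat set \<Rightarrow> nat set set set" where
  "NCP A = {\<pi>. partition_on A \<pi> \<and> noncrossing \<pi>}"

text \<open>The symbols \<open>1, 1', 2, 2', \<dots>, n, n'\<close> are encoded in this order as \<open>2, 3, 4, 5, \<dots>, 2n, 2n+1\<close>,
  and the dual is regarded as a partition of \<open>{1..n}\<close> by dropping the primes.\<close>

definition kreweras_candidate :: "nat \<Rightarrow> nat set set \<Rightarrow> nat set set \<Rightarrow> bool" where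
  "kreweras_candidate n \<pi> \<sigma> \<longleftrightarrow> partition_on {1..n} \<sigma> \<and>
     (\<lambda>B. (\<lambda>i. 2 * i) ` B) ` \<pi> \<union> (\<lambda>B. (\<lambda>i. 2 * i + 1) ` B) ` \<sigma> \<in> NCP {2..2 * n + 1}"

definition kreweras :: "nat \<Rightarrow> nat set set \<Rightarrow> nat set set" where
  "kreweras n \<pi> = (THE \<sigma>. kreweras_candidate n \<pi> \<sigma> \<and>
     (\<forall>\<tau>. kreweras_candidate n \<pi> \<tau> \<longrightarrow> refines {1..n} \<tau> \<sigma>))"

definition NCd :: "nat \<Rightarrow> nat \<Rightarrow> nat set set set" where
  "NCd d n = {\<pi> \<in> NCP {1..n}. (\<forall>B\<in>\<pi>. [card B = 1] (mod d)) \<and>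
     (\<forall>B\<in>kreweras n \<pi>. [card B = 1] (mod d))}"

definition NCd_order :: "nat \<Rightarrow> nat \<Rightarrow> nat set set rel" where
  "NCd_order d n = {(\<pi>, \<rho>). \<pi> \<in> NCd d n \<and> \<rho> \<in> NCd d n \<and> refines {1..n} \<pi> \<rho>}"

text \<open>For \<open>n > 0\<close> and \<open>n \<equiv> 1 (mod d)\<close> this poset is bounded, by the partition into singletons and
  the one-block partition, which are each other's duals.\<close>

definition NCd_elem :: "nat \<Rightarrow> nat \<Rightarrow> (bposet \<Rightarrow>\<^sub>0 'k::comm_ring_1)" where
  "NCd_elem d n = basis (iso_class (NCd_order d n))"

section \<open>Hypertrees\<close>

definition hypergraph :: "'a set \<Rightarrow> 'a set set \<Rightarrow> bool" where
  "hypergraph V T \<longleftrightarrow> (\<forall>E\<in>T. E \<subseteq> V \<and> card E \<ge> 2)"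

text \<open>Only distinct vertices have to be joined, so that the edgeless hypergraph on one vertex is
  connected (and a hypertree).\<close>

definition hyper_connected :: "'a set \<Rightarrow> 'a set set \<Rightarrow> bool" where
  "hyper_connected V T \<longleftrightarrow> (\<forall>u\<in>V. \<forall>v\<in>V. u \<noteq> v \<longrightarrow>
     (\<exists>Es. Es \<noteq> [] \<and> set Es \<subseteq> T \<and> u \<in> hd Es \<and> v \<in> last Es \<and>
        successively (\<lambda>E F. E \<inter> F \<noteq> {}) Es))"

definition hypertree :: "'a set \<Rightarrow> 'a set set \<Rightarrow> bool" where
  "hypertree V T \<longleftrightarrow> hypergraph V T \<and> hyper_connected V T \<and>
     (\<Sum>E\<in>T. int (card E) - 1) = int (card V) - 1"

definition noncrossing_hypertrees :: "nat \<Rightarrow> nat set set set" where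
  "noncrossing_hypertrees n = {T. hypertree {1..n} T \<and> noncrossing T}"

end

theory Submission
  imports Defs
begin

text \<open>
  The blocks with at least two elements of a noncrossing partition form a family \<open>M\<close>. A block \<open>E\<close> cuts the
  underlying cyclically ordered set \<open>V\<close> into arcs, one for each \<open>v \<in> E\<close>, and a partition is \<open>d\<close>-indivisible
  if and only if all arcs of its blocks have size 1 modulo \<open>d\<close>. The lower interval of \<open>M\<close> is the product of the
  posets attached to the blocks. If \<open>E \<in> M\<close>, the upper interval of \<open>M\<close> in \<open>V\<close> is the product of the upper
  intervals, over the arcs of \<open>E\<close>, of the blocks of \<open>M\<close> that lie in that arc.

  The signed sum over those noncrossing hypertrees on \<open>V\<close> that have all elements of \<open>M\<close> among their minimal
  edges factors over the arcs of \<open>E\<close> in the same way. By induction on the size of \<open>V\<close>, it is therefore the antipode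
  of the upper interval of \<open>M\<close> if \<open>M \<noteq> \<emptyset>\<close>. For \<open>M = \<emptyset>\<close> it satisfies the recursion
  \<open>id * S = \<epsilon>\<close> of the antipode, because for every hypertree \<open>T\<close> with an edge the alternating sum over
  the subsets \<open>M\<close> of its nonempty set of minimal edges vanishes.
\<close>

section \<open>Convolution algebra: existence, uniqueness and multiplicativity of the
  antipode\<close>

section \<open>Linear extension\<close>

text \<open>The recursion for the antipode calls for its value at every upper interval. Splitting at
  a single block is the step that has a counterpart for hypertrees, and it leaves the other blocks
  inside the arcs. Hence the claim is made for all pairs of a finite set \<open>V\<close> of
  naturals and a family \<open>M\<close> on it, and the theorem is the case \<open>M = {}\<close>.
  An arc that wraps around is not an interval of integers, so \<open>V\<close> stays arbitrary and
  is relabeled only at the end. The obstacle is that the dual in the definition of indivisibility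
  depends on all blocks at once, while both factorizations need a condition on single blocks. All
  planar arguments go through one relation, \<open>within_arc B F\<close>: for disjoint sets it is
  noncrossing, and for edges with a common vertex it says that \<open>B\<close> comes first there.
  Minimal edges appear because hypertrees chosen freely on the arcs of \<open>E\<close>, together
  with \<open>E\<close>, are exactly the hypertrees in which \<open>E\<close> is minimal.\<close>

lemma scale_simps [simp]:
  "scale 0 h = 0" "scale c 0 = 0" "scale 1 h = h" "scale c (scale e h) = scale (c * e) h"
  by (auto intro!: poly_mapping_eqI simp: lookup_scale mult.assoc)

lemma scale_add: "scale c (g + h) = scale c g + scale c h" "scale (c + e) g = scale c g + scale e g"
  by (auto intro!: poly_mapping_eqI simp: lookup_scale lookup_add algebra_simps)

lemma scale_sum: "scale c (sum f A) = (\<Sum>a\<in>A. scale c (f a))"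
  by (induction A rule: infinite_finite_induct) (auto simp: scale_add)

text \<open>Keys can cancel in a sum, so identities for \<open>lin_ext\<close> are checked over a
  common finite set that contains all keys involved.\<close>

lemma lin_ext_superset:
  assumes "finite A" "Poly_Mapping.keys h \<subseteq> A"
  shows "lin_ext f h = (\<Sum>a\<in>A. scale (Poly_Mapping.lookup h a) (f a))"
  unfolding lin_ext_def
  by (rule sum.mono_neutral_left) (auto simp: assms in_keys_iff)

lemma lin_ext_add: "lin_ext f (g + h) = lin_ext f g + lin_ext f h"
proof -
  let ?A = "Poly_Mapping.keys g \<union> Poly_Mapping.keys h \<union> Poly_Mapping.keys (g + h)"
  show ?thesis
    by (subst (1 2 3) lin_ext_superset[of ?A])
      (auto simp: lookup_add scale_add sum.distrib)
qed

lemma lin_ext_zero [simp]: "lin_ext f 0 = 0"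
  by (simp add: lin_ext_def)

lemma lin_ext_scale: "lin_ext f (scale c h) = scale c (lin_ext f h)"
proof -
  let ?A = "Poly_Mapping.keys h \<union> Poly_Mapping.keys (scale c h)"
  show ?thesis
    by (subst (1 2) lin_ext_superset[of ?A]) (auto simp: lookup_scale scale_sum)
qed

lemma lin_ext_sum: "lin_ext f (sum g A) = (\<Sum>a\<in>A. lin_ext f (g a))"
  by (induction A rule: infinite_finite_induct) (auto simp: lin_ext_add)

lemma lin_ext_lin_ext: "lin_ext f (lin_ext g h) = lin_ext (\<lambda>a. lin_ext f (g a)) h"
  by (simp add: lin_ext_def[of g] lin_ext_def[of "\<lambda>a. lin_ext f (g a)"] lin_ext_sum lin_ext_scale)

lemma lin_ext_unique:
  assumes "\<And>g h. F (g + h) = F g + F h" "\<And>c h. F (scale c h) = scale c (F h)"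
  shows "F h = lin_ext (\<lambda>a. F (basis a)) h"
proof (induction h rule: update_induct)
  case const
  then show ?case using assms(2)[of 0 0] by simp
next
  case (update f a b)
  have "Poly_Mapping.update a b f = f + scale b (basis a)"
    using update(1) by (auto intro!: poly_mapping_eqI
        simp: lookup_add lookup_scale basis_def lookup_single lookup_update in_keys_iff)
  then show ?case by (simp add: assms lin_ext_add lin_ext_scale lin_ext_basis update)
qed

lemma linear_lin_ext: "Vector_Spaces.linear scale scale (lin_ext f :: ('a \<Rightarrow>\<^sub>0 'k::field) \<Rightarrow> _)"
  by (simp add: Vector_Spaces.linear_iff vector_space_scale lin_ext_add lin_ext_scale)

lemma convolution_lin_ext: "convolution f g h = lin_ext (\<lambda>P. convolution f g (basis P)) h"
  by (simp add: convolution_def coproduct_def lin_ext_lin_ext lin_ext_basis)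

lemma counit_lin_ext: "scale (counit h) 1 = lin_ext (\<lambda>P. scale (counit (basis P)) 1) h"
  by (rule lin_ext_unique) (auto simp: counit_def lookup_add lookup_scale scale_add)

lemma convolution_iso_class:
  fixes r :: "'a rel" and f g :: "(bposet \<Rightarrow>\<^sub>0 'k::comm_ring_1) \<Rightarrow> _"
  assumes "bounded_poset r"
  shows "convolution f g (basis (iso_class r)) = (\<Sum>x\<in>Field r.
    f (basis (iso_class (interval r (poset_bot r) x))) * g (basis (iso_class (interval r x (poset_top r)))))"
  by (simp add: convolution_def coproduct_basis[OF assms] coproduct_poset_def lin_ext_sum lin_ext_basis)

section \<open>The antipode\<close>

lemma basis_zero: "basis 0 = (1 :: bposet \<Rightarrow>\<^sub>0 'k::comm_ring_1)"
  by (simp add: basis_def)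

lemma basis_plus: "basis (P + Q) = (basis P * basis Q :: bposet \<Rightarrow>\<^sub>0 'k::comm_ring_1)"
  by (simp add: basis_def mult_single)

lemma basis_sum: "basis (sum P A) = (\<Prod>a\<in>A. basis (P a) :: bposet \<Rightarrow>\<^sub>0 'k::comm_ring_1)"
  by (induction A rule: infinite_finite_induct) (auto simp: basis_zero basis_plus)

lemma counit_basis: "scale (counit (basis P)) 1 = (if P = 0 then 1 else 0)"
  by (simp add: counit_def basis_def lookup_single)

lemma bounded_poset_top_eqI:
  assumes "bounded_poset r" "t \<in> Field r" "\<And>a. a \<in> Field r \<Longrightarrow> (a, t) \<in> r"
  shows "poset_top r = t"
  by (rule poset_top_eqI) (use assms in \<open>auto simp: bounded_poset_def\<close>)

lemma bounded_poset_bot_eqI: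
  assumes "bounded_poset r" "t \<in> Field r" "\<And>a. a \<in> Field r \<Longrightarrow> (t, a) \<in> r"
  shows "poset_bot r = t"
  by (rule poset_bot_eqI) (use assms in \<open>auto simp: bounded_poset_def\<close>)

lemma bounded_poset_refl: "bounded_poset r \<Longrightarrow> x \<in> Field r \<Longrightarrow> (x, x) \<in> r"
  by (auto simp: bounded_poset_def Partial_order_iff)

lemma bounded_poset_trans: "bounded_poset r \<Longrightarrow> (x, y) \<in> r \<Longrightarrow> (y, z) \<in> r \<Longrightarrow> (x, z) \<in> r"
  by (auto simp: bounded_poset_def order_on_defs dest: transD)

lemma bounded_poset_antisym: "bounded_poset r \<Longrightarrow> (x, y) \<in> r \<Longrightarrow> (y, x) \<in> r \<Longrightarrow> x = y"
  by (auto simp: bounded_poset_def order_on_defs dest: antisymD)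

lemma card_Field_iso: "poset_iso r s \<Longrightarrow> card (Field r) = card (Field s)"
  by (auto simp: poset_iso_def dest: bij_betw_same_card)

lemma iso_class_eq_zero_iff:
  assumes "bounded_poset r"
  shows "iso_class r = 0 \<longleftrightarrow> poset_bot r = poset_top r"
proof -
  have "iso_class r = 0 \<longleftrightarrow> poset_iso r {((), ())}"
    unfolding zero_bposet_def by (rule iso_class_eq_iff[OF assms bounded_poset_single])
  also have "\<dots> \<longleftrightarrow> poset_bot r = poset_top r"
  proof
    assume "poset_iso r {((), ())}"
    then have "card (Field r) = 1" using card_Field_iso by (force simp: Field_def)
    then show "poset_bot r = poset_top r"
      using bounded_poset_bot(1)[OF assms] bounded_poset_top(1)[OF assms] by (metis card_1_singletonE singletonD)
  next
    assume eq: "poset_bot r = poset_top r"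
    have "a = poset_bot r" if "a \<in> Field r" for a
      using bounded_poset_antisym[OF assms] bounded_poset_bot[OF assms] bounded_poset_top[OF assms] eq that by metis
    then have F: "Field r = {poset_bot r}" using bounded_poset_bot(1)[OF assms] by blast
    then show "poset_iso r {((), ())}"
      unfolding poset_iso_def
      using bounded_poset_refl[OF assms, of "poset_bot r"] by (auto simp: bij_betw_def inj_on_def Field_def)
  qed
  finally show ?thesis .
qed

lemma Field_intervals:
  assumes "bounded_poset r" "x \<in> Field r"
  shows "Field (interval r (poset_bot r) x) = {z \<in> Field r. (z, x) \<in> r}"
    "Field (interval r x (poset_top r)) = {z \<in> Field r. (x, z) \<in> r}"
proof -
  have P: "Partial_order r" using assms by (simp add: bounded_poset_def)
  have F: "a \<in> Field r \<and> b \<in> Field r" if "(a, b) \<in> r" for a b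
    using that by (auto simp: Field_def)
  show "Field (interval r (poset_bot r) x) = {z \<in> Field r. (z, x) \<in> r}"
    unfolding Field_interval[OF P bounded_poset_bot(2)[OF assms]]
    using bounded_poset_bot(2)[OF assms(1)] F by blast
  show "Field (interval r x (poset_top r)) = {z \<in> Field r. (x, z) \<in> r}"
    unfolding Field_interval[OF P bounded_poset_top(2)[OF assms]]
    using bounded_poset_top(2)[OF assms(1)] F by blast
qed

lemma interval_bot_top:
  assumes "bounded_poset r"
  shows "interval r (poset_bot r) (poset_top r) = r"
  using bounded_poset_bot(2)[OF assms] bounded_poset_top(2)[OF assms]
  by (auto simp: interval_def dest: FieldI1 FieldI2)

lemma poset_bot_top_interval:
  assumes "bounded_poset r" "(x, y) \<in> r"
  shows "poset_bot (interval r x y) = x" "poset_top (interval r x y) = y"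
proof -
  have P: "Partial_order r" using assms by (simp add: bounded_poset_def)
  have xy: "(x, x) \<in> r" "(y, y) \<in> r"
    using assms(2) bounded_poset_refl[OF assms(1)] by (auto intro: FieldI1 FieldI2)
  show "poset_bot (interval r x y) = x"
    by (rule bounded_poset_bot_eqI[OF bounded_poset_interval[OF assms]])
      (use xy assms(2) in \<open>unfold Field_interval[OF P assms(2)], auto simp: interval_def\<close>)
  show "poset_top (interval r x y) = y"
    by (rule bounded_poset_top_eqI[OF bounded_poset_interval[OF assms]])
      (use xy assms(2) in \<open>unfold Field_interval[OF P assms(2)], auto simp: interval_def\<close>)
qed

lemma interval_interval:
  assumes "bounded_poset r" "(x, a) \<in> r" "(b, y) \<in> r"
  shows "interval (interval r x y) a b = interval r a b"
  using assms by (auto simp: interval_def intro: bounded_poset_trans)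

lemma interval_point:
  assumes "bounded_poset r" "x \<in> Field r"
  shows "iso_class (interval r x x) = 0"
proof -
  have "(x, x) \<in> r" by (rule bounded_poset_refl[OF assms])
  then show ?thesis
    by (simp add: iso_class_eq_zero_iff bounded_poset_interval poset_bot_top_interval assms)
qed

text \<open>The measure for recursions on isomorphism classes: a proper interval that starts at the
  bottom or ends at the top has fewer elements.\<close>

definition bposet_size :: "bposet \<Rightarrow> nat" where
  "bposet_size P = card (Field (rep_bposet P))"

lemma bposet_size_iso_class: "bounded_poset r \<Longrightarrow> bposet_size (iso_class r) = card (Field r)"
  unfolding bposet_size_def by (rule card_Field_iso[OF poset_iso_rep])

lemma bposet_size_less:
  assumes "bounded_poset r" "x \<in> Field r"
  shows "x \<noteq> poset_bot r \<Longrightarrow> bposet_size (iso_class (interval r x (poset_top r))) < bposet_size (iso_class r)"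
    "x \<noteq> poset_top r \<Longrightarrow> bposet_size (iso_class (interval r (poset_bot r) x)) < bposet_size (iso_class r)"
proof -
  have fin: "finite (Field r)" using assms by (simp add: bounded_poset_def)
  note b = bounded_poset_interval[OF assms(1) bounded_poset_bot(2)[OF assms]]
    bounded_poset_interval[OF assms(1) bounded_poset_top(2)[OF assms]]
  show "bposet_size (iso_class (interval r x (poset_top r))) < bposet_size (iso_class r)" if "x \<noteq> poset_bot r"
    unfolding bposet_size_iso_class[OF assms(1)] bposet_size_iso_class[OF b(2)] Field_intervals[OF assms]
    using bounded_poset_bot[OF assms(1)] bounded_poset_antisym[OF assms(1)] assms that
    by (intro psubset_card_mono fin) blast
  show "bposet_size (iso_class (interval r (poset_bot r) x)) < bposet_size (iso_class r)" if "x \<noteq> poset_top r"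
    unfolding bposet_size_iso_class[OF assms(1)] bposet_size_iso_class[OF b(1)] Field_intervals[OF assms]
    using bounded_poset_top[OF assms(1)] bounded_poset_antisym[OF assms(1)] assms that
    by (intro psubset_card_mono fin) blast
qed

text \<open>Convolution inverses of the identity, from the left and from the right; by associativity, here in the
  incidence algebra of a single poset, they agree.\<close>

function right_inv :: "bposet \<Rightarrow> (bposet \<Rightarrow>\<^sub>0 'k::comm_ring_1)" where
  "right_inv P = (let r = rep_bposet P in if P = 0 then 1 else
     - (\<Sum>x\<in>Field r - {poset_bot r}.
          basis (iso_class (interval r (poset_bot r) x)) * right_inv (iso_class (interval r x (poset_top r)))))"
  by pat_completeness auto
termination
proof (relation "measure bposet_size", goal_cases)
  case (2 P r x)
  then show ?case using bposet_size_less(1)[OF bounded_poset_rep[of P], of x] by (simp add: iso_class_rep)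
qed auto

function left_inv :: "bposet \<Rightarrow> (bposet \<Rightarrow>\<^sub>0 'k::comm_ring_1)" where
  "left_inv P = (let r = rep_bposet P in if P = 0 then 1 else
     - (\<Sum>x\<in>Field r - {poset_top r}.
          left_inv (iso_class (interval r (poset_bot r) x)) * basis (iso_class (interval r x (poset_top r)))))"
  by pat_completeness auto
termination
proof (relation "measure bposet_size", goal_cases)
  case (2 P r x)
  then show ?case using bposet_size_less(2)[OF bounded_poset_rep[of P], of x] by (simp add: iso_class_rep)
qed auto

declare right_inv.simps [simp del] left_inv.simps [simp del]

lemma right_inv_zero [simp]: "right_inv 0 = 1"
  by (subst right_inv.simps) simp

lemma left_inv_zero [simp]: "left_inv 0 = 1"
  by (subst left_inv.simps) simp

text \<open>The recursions of \<open>right_inv\<close> and \<open>left_inv\<close> run over the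
  chosen representative of a class. As the coproduct is invariant under isomorphism, the sums may be
  taken over any bounded poset of that class.\<close>

lemma sum_iso_invariant:
  assumes "bounded_poset r"
  defines "s \<equiv> rep_bposet (iso_class r)"
  shows "(\<Sum>x\<in>Field r. f (iso_class (interval r (poset_bot r) x)) * g (iso_class (interval r x (poset_top r)))) =
    (\<Sum>x\<in>Field s. f (iso_class (interval s (poset_bot s) x)) * g (iso_class (interval s x (poset_top s))) ::
      bposet \<Rightarrow>\<^sub>0 'k::comm_ring_1)" (is "?L = ?R")
proof -
  let ?f = "\<lambda>(P, Q). f P * g Q"
  have "lin_ext ?f (coproduct_poset r) = lin_ext ?f (coproduct_poset s)"
    unfolding s_def by (rule arg_cong[OF coproduct_poset_iso[OF assms(1) poset_iso_sym[OF poset_iso_rep[OF assms(1)]]]])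
  then show ?thesis by (simp add: coproduct_poset_def lin_ext_sum lin_ext_basis)
qed

text \<open>The summand at the bottom is \<open>right_inv\<close> of the whole poset, because the
  interval from the bottom to itself has class \<open>0\<close> and gives the unit; the recursion
  was defined so that it cancels the other summands.\<close>

lemma right_inv_rec:
  fixes r :: "'a rel"
  assumes "bounded_poset r"
  shows "(\<Sum>x\<in>Field r. basis (iso_class (interval r (poset_bot r) x)) *
      right_inv (iso_class (interval r x (poset_top r)))) = (if poset_bot r = poset_top r then 1 else (0 :: bposet \<Rightarrow>\<^sub>0 'k::comm_ring_1))"
proof -
  define s where "s = rep_bposet (iso_class r)"
  have s: "bounded_poset s" "iso_class s = iso_class r"
    unfolding s_def by (simp_all add: bounded_poset_rep iso_class_rep)
  have fin: "finite (Field s)" using s by (simp add: bounded_poset_def)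
  let ?f = "\<lambda>x. basis (iso_class (interval s (poset_bot s) x)) * right_inv (iso_class (interval s x (poset_top s))) :: bposet \<Rightarrow>\<^sub>0 'k"
  have "(\<Sum>x\<in>Field s. ?f x) = ?f (poset_bot s) + sum ?f (Field s - {poset_bot s})"
    by (rule sum.remove[OF fin bounded_poset_bot(1)[OF s(1)]])
  also have "?f (poset_bot s) = right_inv (iso_class r)"
    by (simp add: interval_bot_top s interval_point bounded_poset_bot basis_zero)
  also have "right_inv (iso_class r) + sum ?f (Field s - {poset_bot s}) = (if iso_class r = 0 then 1 else 0)"
  proof (cases "iso_class r = 0")
    case True
    then have "poset_bot s = poset_top s" using s iso_class_eq_zero_iff by metis
    then have "Field s \<subseteq> {poset_bot s}"
      using bounded_poset_antisym[OF s(1)] bounded_poset_bot[OF s(1)] bounded_poset_top[OF s(1)] by (metis singletonI subsetI)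
    then have e: "Field s - {poset_bot s} = {}" by blast
    show ?thesis unfolding e using True by simp
  next
    case False
    then show ?thesis by (subst right_inv.simps) (simp add: s_def Let_def)
  qed
  finally show ?thesis
    by (simp add: sum_iso_invariant[OF assms] s_def[symmetric] iso_class_eq_zero_iff[OF assms])
qed

lemma left_inv_rec:
  fixes r :: "'a rel"
  assumes "bounded_poset r"
  shows "(\<Sum>x\<in>Field r. left_inv (iso_class (interval r (poset_bot r) x)) *
      basis (iso_class (interval r x (poset_top r)))) = (if poset_bot r = poset_top r then 1 else (0 :: bposet \<Rightarrow>\<^sub>0 'k::comm_ring_1))"
proof -
  define s where "s = rep_bposet (iso_class r)"
  have s: "bounded_poset s" "iso_class s = iso_class r"
    unfolding s_def by (simp_all add: bounded_poset_rep iso_class_rep)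
  have fin: "finite (Field s)" using s by (simp add: bounded_poset_def)
  let ?f = "\<lambda>x. left_inv (iso_class (interval s (poset_bot s) x)) * basis (iso_class (interval s x (poset_top s))) :: bposet \<Rightarrow>\<^sub>0 'k"
  have "(\<Sum>x\<in>Field s. ?f x) = ?f (poset_top s) + sum ?f (Field s - {poset_top s})"
    by (rule sum.remove[OF fin bounded_poset_top(1)[OF s(1)]])
  also have "?f (poset_top s) = left_inv (iso_class r)"
    by (simp add: interval_bot_top s interval_point bounded_poset_top basis_zero)
  also have "left_inv (iso_class r) + sum ?f (Field s - {poset_top s}) = (if iso_class r = 0 then 1 else 0)"
  proof (cases "iso_class r = 0")
    case True
    then have "poset_bot s = poset_top s" using s iso_class_eq_zero_iff by metis
    then have "Field s \<subseteq> {poset_top s}"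
      using bounded_poset_antisym[OF s(1)] bounded_poset_bot[OF s(1)] bounded_poset_top[OF s(1)] by (metis singletonI subsetI)
    then have e: "Field s - {poset_top s} = {}" by blast
    show ?thesis unfolding e using True by simp
  next
    case False
    then show ?thesis by (subst left_inv.simps) (simp add: s_def Let_def)
  qed
  finally show ?thesis
    by (simp add: sum_iso_invariant[OF assms] s_def[symmetric] iso_class_eq_zero_iff[OF assms])
qed

lemma left_inv_eq_right_inv: "left_inv P = (right_inv P :: bposet \<Rightarrow>\<^sub>0 'k::comm_ring_1)"
proof -
  define r where "r = rep_bposet P"
  define b t where "b = poset_bot r" and "t = poset_top r"
  have r: "bounded_poset r" "iso_class r = P"
    unfolding r_def by (simp_all add: bounded_poset_rep iso_class_rep)
  have fin: "finite (Field r)" using r by (simp add: bounded_poset_def)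
  let ?c = "\<lambda>x y. iso_class (interval r x y)"
  \<comment> \<open>The term of the triple convolution for the chain bottom, \<open>x\<close>,
    \<open>y\<close>, top. Summing over \<open>x\<close> first leaves only \<open>y = b\<close>,
    summing over \<open>y\<close> first leaves only \<open>x = t\<close>.\<close>
  let ?f = "\<lambda>x y. if (x, y) \<in> r then left_inv (?c b x) * basis (?c x y) * right_inv (?c y t) else (0 :: bposet \<Rightarrow>\<^sub>0 'k)"
  have bt: "b \<in> Field r" "t \<in> Field r" "\<And>x. x \<in> Field r \<Longrightarrow> (b, x) \<in> r" "\<And>x. x \<in> Field r \<Longrightarrow> (x, t) \<in> r"
    using bounded_poset_bot[OF r(1)] bounded_poset_top[OF r(1)] by (auto simp: b_def t_def)
  have 1: "(\<Sum>x\<in>Field r. ?f x y) = (if y = b then right_inv P else 0)" if y: "y \<in> Field r" for y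
  proof -
    have bye: "(b, y) \<in> r" by (rule bt(3)[OF y])
    note I = poset_bot_top_interval[OF r(1) bye]
    have F: "Field (interval r b y) = {x \<in> Field r. (x, y) \<in> r}"
      unfolding b_def by (rule Field_intervals[OF r(1) y])
    have "(\<Sum>x\<in>Field r. ?f x y) = (\<Sum>x\<in>Field (interval r b y). left_inv (?c b x) * basis (?c x y)) * right_inv (?c y t)"
      unfolding F sum_distrib_right by (rule sum.mono_neutral_cong_right) (auto simp: fin)
    also have "(\<Sum>x\<in>Field (interval r b y). left_inv (?c b x) * basis (?c x y) :: bposet \<Rightarrow>\<^sub>0 'k) =
       (\<Sum>x\<in>Field (interval r b y). left_inv (iso_class (interval (interval r b y) (poset_bot (interval r b y)) x)) *
         basis (iso_class (interval (interval r b y) x (poset_top (interval r b y)))))"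
      by (rule sum.cong) (auto simp: I F interval_interval r bounded_poset_refl bt y)
    also have "\<dots> = (if b = y then 1 else 0)"
      using left_inv_rec[OF bounded_poset_interval[OF r(1) bye], where 'k = 'k] by (simp only: I)
    finally show ?thesis by (auto simp: b_def t_def interval_bot_top r)
  qed
  have 2: "(\<Sum>y\<in>Field r. ?f x y) = (if x = t then left_inv P else 0)" if x: "x \<in> Field r" for x
  proof -
    have xt: "(x, t) \<in> r" by (rule bt(4)[OF x])
    note I = poset_bot_top_interval[OF r(1) xt]
    have F: "Field (interval r x t) = {y \<in> Field r. (x, y) \<in> r}"
      unfolding t_def by (rule Field_intervals[OF r(1) x])
    have "(\<Sum>y\<in>Field r. ?f x y) = left_inv (?c b x) * (\<Sum>y\<in>Field (interval r x t). basis (?c x y) * right_inv (?c y t))"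
      unfolding F sum_distrib_left by (rule sum.mono_neutral_cong_right) (auto simp: fin mult.assoc)
    also have "(\<Sum>y\<in>Field (interval r x t). basis (?c x y) * right_inv (?c y t) :: bposet \<Rightarrow>\<^sub>0 'k) =
       (\<Sum>y\<in>Field (interval r x t). basis (iso_class (interval (interval r x t) (poset_bot (interval r x t)) y)) *
         right_inv (iso_class (interval (interval r x t) y (poset_top (interval r x t)))))"
      by (rule sum.cong) (auto simp: I F interval_interval r bounded_poset_refl bt x)
    also have "\<dots> = (if x = t then 1 else 0)"
      using right_inv_rec[OF bounded_poset_interval[OF r(1) xt], where 'k = 'k] by (simp only: I)
    finally show ?thesis by (auto simp: b_def t_def interval_bot_top r)
  qed
  have "left_inv P = (\<Sum>x\<in>Field r. \<Sum>y\<in>Field r. ?f x y)"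
    using fin bt by (simp add: 2)
  also have "\<dots> = (\<Sum>y\<in>Field r. \<Sum>x\<in>Field r. ?f x y)" by (rule sum.swap)
  also have "\<dots> = right_inv P" using fin bt by (simp add: 1)
  finally show ?thesis .
qed

lemma is_antipode_right_inv: "is_antipode (lin_ext right_inv :: _ \<Rightarrow> (bposet \<Rightarrow>\<^sub>0 'k::field))"
proof -
  have "convolution id (lin_ext right_inv) h = scale (counit h) 1" for h :: "bposet \<Rightarrow>\<^sub>0 'k"
  proof -
    have "convolution id (lin_ext right_inv) (basis P) = (scale (counit (basis P)) 1 :: bposet \<Rightarrow>\<^sub>0 'k)" for P
    proof -
      define r where "r = rep_bposet P"
      have r: "bounded_poset r" "iso_class r = P"
        unfolding r_def by (simp_all add: bounded_poset_rep iso_class_rep)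
      show ?thesis
        unfolding r(2)[symmetric] convolution_iso_class[OF r(1)] counit_basis iso_class_eq_zero_iff[OF r(1)]
          lin_ext_basis id_apply by (rule right_inv_rec[OF r(1)])
    qed
    then show ?thesis by (subst convolution_lin_ext, subst counit_lin_ext) simp
  qed
  moreover have "convolution (lin_ext right_inv) id h = scale (counit h) 1" for h :: "bposet \<Rightarrow>\<^sub>0 'k"
  proof -
    have "convolution (lin_ext right_inv) id (basis P) = (scale (counit (basis P)) 1 :: bposet \<Rightarrow>\<^sub>0 'k)" for P
    proof -
      define r where "r = rep_bposet P"
      have r: "bounded_poset r" "iso_class r = P"
        unfolding r_def by (simp_all add: bounded_poset_rep iso_class_rep)
      show ?thesis
        unfolding r(2)[symmetric] convolution_iso_class[OF r(1)] counit_basis iso_class_eq_zero_iff[OF r(1)]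
          lin_ext_basis id_apply left_inv_eq_right_inv[symmetric] by (rule left_inv_rec[OF r(1)])
    qed
    then show ?thesis by (subst convolution_lin_ext, subst counit_lin_ext) simp
  qed
  ultimately show ?thesis by (simp add: is_antipode_def linear_lin_ext)
qed

lemma is_antipode_rec:
  fixes r :: "'a rel" and S :: "(bposet \<Rightarrow>\<^sub>0 'k::field) \<Rightarrow> _"
  assumes "is_antipode S" "bounded_poset r"
  shows "(\<Sum>x\<in>Field r. basis (iso_class (interval r (poset_bot r) x)) *
      S (basis (iso_class (interval r x (poset_top r))))) = (if poset_bot r = poset_top r then 1 else 0)"
proof -
  have "convolution id S (basis (iso_class r)) = scale (counit (basis (iso_class r))) 1"
    using assms by (simp add: is_antipode_def)
  then show ?thesis
    by (simp add: convolution_iso_class[OF assms(2)] counit_basis iso_class_eq_zero_iff[OF assms(2)])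
qed

text \<open>The identity for \<open>id * S\<close> expresses the value at a poset by values at
  proper upper intervals, so it fixes \<open>S\<close> on the basis; linearity does the
  rest.\<close>

lemma is_antipode_unique:
  fixes S S' :: "(bposet \<Rightarrow>\<^sub>0 'k::field) \<Rightarrow> (bposet \<Rightarrow>\<^sub>0 'k)"
  assumes "is_antipode S" "is_antipode S'"
  shows "S = S'"
proof -
  have eq: "S (basis P) = S' (basis P)" for P
  proof (induction P rule: measure_induct_rule[of bposet_size])
    case (less P)
    define r where "r = rep_bposet P"
    have r: "bounded_poset r" "iso_class r = P"
      unfolding r_def by (simp_all add: bounded_poset_rep iso_class_rep)
    have fin: "finite (Field r)" using r by (simp add: bounded_poset_def)
    let ?f = "\<lambda>S x. basis (iso_class (interval r (poset_bot r) x)) * S (basis (iso_class (interval r x (poset_top r)))) :: bposet \<Rightarrow>\<^sub>0 'k"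
    have split: "sum (?f S) (Field r) = S (basis P) + sum (?f S) (Field r - {poset_bot r})" for S
      using sum.remove[OF fin bounded_poset_bot(1)[OF r(1)], of "?f S"]
      by (simp add: interval_bot_top r interval_point bounded_poset_bot basis_zero)
    have "sum (?f S) (Field r - {poset_bot r}) = sum (?f S') (Field r - {poset_bot r})"
    proof (rule sum.cong[OF refl])
      fix x assume "x \<in> Field r - {poset_bot r}"
      then have "bposet_size (iso_class (interval r x (poset_top r))) < bposet_size P"
        using bposet_size_less(1)[OF r(1), of x] r(2) by simp
      then show "?f S x = ?f S' x" using less.IH by simp
    qed
    moreover have "sum (?f S) (Field r) = sum (?f S') (Field r)"
      by (simp only: is_antipode_rec[OF assms(1) r(1)] is_antipode_rec[OF assms(2) r(1)])
    ultimately show ?case unfolding split by simp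
  qed
  show ?thesis
  proof
    fix h
    have "S h = lin_ext (\<lambda>P. S (basis P)) h" "S' h = lin_ext (\<lambda>P. S' (basis P)) h"
      by (rule lin_ext_unique; use assms in \<open>simp add: is_antipode_def Vector_Spaces.linear_iff\<close>)+
    then show "S h = S' h" by (simp add: eq)
  qed
qed

lemma is_antipode_antipode: "is_antipode (antipode :: (bposet \<Rightarrow>\<^sub>0 'k::field) \<Rightarrow> _)"
  unfolding antipode_def
  by (rule theI[of is_antipode, OF is_antipode_right_inv]) (rule is_antipode_unique[OF _ is_antipode_right_inv])

lemmas antipode_rec = is_antipode_rec[OF is_antipode_antipode]

lemma antipode_one: "antipode 1 = (1 :: bposet \<Rightarrow>\<^sub>0 'k::field)"
proof -
  have "antipode = (lin_ext right_inv :: _ \<Rightarrow> (bposet \<Rightarrow>\<^sub>0 'k))"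
    by (rule is_antipode_unique[OF is_antipode_antipode is_antipode_right_inv])
  then have "antipode (basis 0) = (lin_ext right_inv (basis 0) :: bposet \<Rightarrow>\<^sub>0 'k)" by (rule fun_cong)
  also have "\<dots> = right_inv 0" by (rule lin_ext_basis)
  finally show ?thesis by (simp add: basis_zero)
qed

lemma interval_prod_poset:
  "interval (prod_poset r s) (a, c) (b, e) = prod_poset (interval r a b) (interval s c e)"
  by (auto simp: interval_def prod_poset_def)

lemma poset_bot_top_prod:
  assumes "bounded_poset r" "bounded_poset s"
  shows "poset_bot (prod_poset r s) = (poset_bot r, poset_bot s)"
    "poset_top (prod_poset r s) = (poset_top r, poset_top s)"
proof -
  have P: "Partial_order r" "Partial_order s" using assms by (auto simp: bounded_poset_def)
  note b = bounded_poset_bot[OF assms(1)] bounded_poset_top[OF assms(1)] bounded_poset_bot[OF assms(2)] bounded_poset_top[OF assms(2)]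
  show "poset_bot (prod_poset r s) = (poset_bot r, poset_bot s)"
    by (rule bounded_poset_bot_eqI[OF bounded_poset_prod[OF assms]]) (auto simp: Field_prod_poset[OF P] b)
  show "poset_top (prod_poset r s) = (poset_top r, poset_top s)"
    by (rule bounded_poset_top_eqI[OF bounded_poset_prod[OF assms]]) (auto simp: Field_prod_poset[OF P] b)
qed

text \<open>Intervals of a product are products, so the recursion of the product poset and the
  product of the two recursions run over the same pairs and have the same total. By induction all
  summands agree except those at the bottom pair, which must then agree as well.\<close>

lemma antipode_mult:
  "antipode (basis (P + Q)) = antipode (basis P) * (antipode (basis Q) :: bposet \<Rightarrow>\<^sub>0 'k::field)"
proof (induction "bposet_size P + bposet_size Q" arbitrary: P Q rule: less_induct)
  case less
  define r s where "r = rep_bposet P" and "s = rep_bposet Q"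
  have r: "bounded_poset r" "iso_class r = P" and s: "bounded_poset s" "iso_class s = Q"
    unfolding r_def s_def by (simp_all add: bounded_poset_rep iso_class_rep)
  have P: "Partial_order r" "Partial_order s" using r s by (auto simp: bounded_poset_def)
  have fin: "finite (Field r \<times> Field s)" using r s by (simp add: bounded_poset_def)
  note rs = bounded_poset_prod[OF r(1) s(1)]
  let ?S = "\<lambda>P. antipode (basis P) :: bposet \<Rightarrow>\<^sub>0 'k"
  let ?u = "\<lambda>x. iso_class (interval r (poset_bot r) x)" and ?v = "\<lambda>x. iso_class (interval r x (poset_top r))"
  let ?u' = "\<lambda>x. iso_class (interval s (poset_bot s) x)" and ?v' = "\<lambda>x. iso_class (interval s x (poset_top s))"
  let ?b = "(poset_bot r, poset_bot s)"
  let ?X = "Field r \<times> Field s"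
  let ?f = "\<lambda>(x, y). basis (?u x) * basis (?u' y) * ?S (?v x + ?v' y)"
  let ?g = "\<lambda>(x, y). (basis (?u x) * ?S (?v x)) * (basis (?u' y) * ?S (?v' y))"
  note bi = bounded_poset_interval[OF r(1) bounded_poset_bot(2)[OF r(1)]] bounded_poset_interval[OF r(1) bounded_poset_top(2)[OF r(1)]]
     bounded_poset_interval[OF s(1) bounded_poset_bot(2)[OF s(1)]] bounded_poset_interval[OF s(1) bounded_poset_top(2)[OF s(1)]]
  have rearrange: "a * b * (c * e) = (a * c) * (b * e)" for a b c e :: "bposet \<Rightarrow>\<^sub>0 'k"
    by (simp add: mult_ac)
  have b: "?b \<in> ?X" using bounded_poset_bot(1) r s by auto
  have "(\<Sum>z\<in>?X. ?f z) = (\<Sum>z\<in>?X. basis (iso_class (interval (prod_poset r s) ?b z)) *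
      ?S (iso_class (interval (prod_poset r s) z (poset_top r, poset_top s))))"
    by (rule sum.cong) (auto simp: interval_prod_poset plus_iso_class[symmetric] bi basis_plus)
  also have "\<dots> = (if poset_bot r = poset_top r \<and> poset_bot s = poset_top s then 1 else 0)"
    using antipode_rec[OF rs, where 'k = 'k]
    by (simp add: Field_prod_poset[OF P] poset_bot_top_prod[OF r(1) s(1)])
  also have "\<dots> = (\<Sum>x\<in>Field r. basis (?u x) * ?S (?v x)) * (\<Sum>y\<in>Field s. basis (?u' y) * ?S (?v' y))"
    by (simp add: antipode_rec[OF r(1)] antipode_rec[OF s(1)])
  also have "\<dots> = (\<Sum>z\<in>?X. ?g z)" by (simp add: sum_product sum.cartesian_product split_def)
  finally have "sum ?f ?X = sum ?g ?X" .
  moreover have "sum ?f (?X - {?b}) = sum ?g (?X - {?b})"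
  proof (rule sum.cong[OF refl])
    fix z assume z: "z \<in> ?X - {?b}"
    obtain x y where xy: "z = (x, y)" by force
    have m: "x \<in> Field r" "y \<in> Field s" using z xy by auto
    have "bposet_size (?v x) < bposet_size P" if "x \<noteq> poset_bot r"
      using bposet_size_less(1)[OF r(1) m(1)] that r(2) by simp
    moreover have "bposet_size (?v' y) < bposet_size Q" if "y \<noteq> poset_bot s"
      using bposet_size_less(1)[OF s(1) m(2)] that s(2) by simp
    moreover have "?v x = P" if "x = poset_bot r" unfolding that interval_bot_top[OF r(1)] by (rule r(2))
    moreover have "?v' y = Q" if "y = poset_bot s" unfolding that interval_bot_top[OF s(1)] by (rule s(2))
    \<comment> \<open>Away from the bottom pair one of the two upper intervals is strictly smaller,
      and the other is not larger.\<close>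
    ultimately have "bposet_size (?v x) + bposet_size (?v' y) < bposet_size P + bposet_size Q"
      using z xy by (cases "x = poset_bot r"; cases "y = poset_bot s") auto
    from less.hyps[OF this] have e: "?S (?v x + ?v' y) = ?S (?v x) * ?S (?v' y)" .
    show "?f z = ?g z" unfolding xy prod.case e by (rule rearrange)
  qed
  ultimately have "?f ?b = ?g ?b"
    unfolding sum.remove[OF fin b, of ?f] sum.remove[OF fin b, of ?g] by (simp only: add_right_cancel)
  then show ?case
    by (simp add: interval_point bounded_poset_bot r s interval_bot_top basis_zero)
qed

lemma antipode_sum: "antipode (basis (sum P A)) = (\<Prod>a\<in>A. antipode (basis (P a)) :: bposet \<Rightarrow>\<^sub>0 'k::field)"
  by (induction A rule: infinite_finite_induct) (auto simp: basis_zero antipode_one antipode_mult)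

section \<open>Subsets of a circle: arcs, crossings and the order of edges at a vertex\<close>

section \<open>Cyclic predecessors and arcs\<close>

text \<open>The last element of \<open>B\<close> met when the circle is run through up to
  \<open>x\<close>; if none lies below, the search wraps around to \<open>Max B\<close>. Admitting
  \<open>x\<close> itself matches the dual symbols, since \<open>x'\<close> comes right after
  \<open>x\<close>.\<close>

definition cyclic_pred :: "nat set \<Rightarrow> nat \<Rightarrow> nat" where
  "cyclic_pred B x = (if \<exists>b\<in>B. b \<le> x then Max {b \<in> B. b \<le> x} else Max B)"

text \<open>\<open>cyclic_between v b x\<close> says that \<open>b\<close> lies in the cyclic interval from \<open>v\<close> (excluded) to \<open>x\<close> (included).\<close>

definition cyclic_between :: "nat \<Rightarrow> nat \<Rightarrow> nat \<Rightarrow> bool" where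
  "cyclic_between v b x \<longleftrightarrow> v < b \<and> b \<le> x \<or> x < v \<and> (v < b \<or> b \<le> x)"

text \<open>A description without the case distinction at the wrap-around; it turns later claims
  about predecessors into linear arithmetic. As \<open>cyclic_between x b x\<close> is false for
  every \<open>b\<close>, elements of \<open>B\<close> are their own predecessors.\<close>

lemma cyclic_pred_iff:
  assumes "finite B" "B \<noteq> {}"
  shows "cyclic_pred B x = v \<longleftrightarrow> v \<in> B \<and> (\<forall>b\<in>B. \<not> cyclic_between v b x)"
proof -
  have 1: "cyclic_pred B x \<in> B \<and> (\<forall>b\<in>B. \<not> cyclic_between (cyclic_pred B x) b x)"
  proof (cases "\<exists>b\<in>B. b \<le> x")
    case True
    then have ne: "{b \<in> B. b \<le> x} \<noteq> {}" and fin: "finite {b \<in> B. b \<le> x}" using assms by auto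
    define m where "m = Max {b \<in> B. b \<le> x}"
    have m: "m \<in> B" "m \<le> x" using Max_in[OF fin ne] by (auto simp: m_def)
    have ge: "b \<le> m" if "b \<in> B" "b \<le> x" for b using Max_ge[OF fin] that by (auto simp: m_def)
    have "cyclic_pred B x = m" using True by (simp add: cyclic_pred_def m_def)
    moreover have "\<not> cyclic_between m b x" if "b \<in> B" for b
      using ge[OF that] m(2) unfolding cyclic_between_def by linarith
    ultimately show ?thesis using m(1) by simp
  next
    case False
    then have "cyclic_pred B x = Max B" by (auto simp: cyclic_pred_def)
    moreover have "\<not> cyclic_between (Max B) b x" if "b \<in> B" for b
      using Max_ge[OF assms(1) that] False that unfolding cyclic_between_def by auto
    ultimately show ?thesis using Max_in[OF assms] by simp
  qed
  have 2: "v = w" if "v \<in> B" "w \<in> B" "\<forall>b\<in>B. \<not> cyclic_between v b x" "\<forall>b\<in>B. \<not> cyclic_between w b x" for v w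
    using that(1,2) that(3)[rule_format, of w] that(4)[rule_format, of v]
    unfolding cyclic_between_def by linarith
  from 1 2 show ?thesis by blast
qed

lemma cyclic_pred_mem: "finite B \<Longrightarrow> B \<noteq> {} \<Longrightarrow> cyclic_pred B x \<in> B"
  using cyclic_pred_iff by blast

lemma cyclic_pred_not_between: "finite B \<Longrightarrow> b \<in> B \<Longrightarrow> \<not> cyclic_between (cyclic_pred B x) b x"
  using cyclic_pred_iff by blast

lemma cyclic_pred_self: "finite B \<Longrightarrow> x \<in> B \<Longrightarrow> cyclic_pred B x = x"
  by (subst cyclic_pred_iff) (auto simp: cyclic_between_def)

lemma cyclic_pred_singleton [simp]: "cyclic_pred {b} x = b"
  by (subst cyclic_pred_iff) (auto simp: cyclic_between_def)

text \<open>Going back from \<open>x\<close> to \<open>B\<close> and from there to the subset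
  \<open>A\<close> skips no element of \<open>A\<close>. Hence the arcs of a set refine those of its
  subsets.\<close>

lemma cyclic_pred_subset:
  assumes "finite B" "A \<subseteq> B" "A \<noteq> {}"
  shows "cyclic_pred A (cyclic_pred B x) = cyclic_pred A x"
proof -
  have fin: "finite A" using assms finite_subset by blast
  let ?p = "cyclic_pred B x"
  let ?q = "cyclic_pred A ?p"
  have q: "?q \<in> A" by (rule cyclic_pred_mem[OF fin assms(3)])
  have qB: "\<not> cyclic_between ?p ?q x" using cyclic_pred_not_between[OF assms(1), of ?q x] q assms by blast
  have "\<not> cyclic_between ?q a x" if "a \<in> A" for a
  proof -
    have 1: "\<not> cyclic_between ?p a x" using cyclic_pred_not_between[OF assms(1), of a x] that assms by blast
    have 2: "\<not> cyclic_between ?q a ?p" by (rule cyclic_pred_not_between[OF fin that])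
    show ?thesis using 1 2 qB unfolding cyclic_between_def by linarith
  qed
  then have "cyclic_pred A x = ?q" using q cyclic_pred_iff[OF fin assms(3)] by blast
  then show ?thesis by simp
qed

definition crosses :: "nat set \<Rightarrow> nat set \<Rightarrow> bool" where
  "crosses E F \<longleftrightarrow> (\<exists>i j k l. i < j \<and> j < k \<and> k < l \<and> i \<in> E \<and> k \<in> E \<and> j \<in> F \<and> l \<in> F)"

lemma noncrossing_iff: "noncrossing T \<longleftrightarrow> (\<forall>E\<in>T. \<forall>F\<in>T. E \<noteq> F \<longrightarrow> \<not> crosses E F)"
  unfolding noncrossing_def crosses_def[symmetric] by blast

lemma crosses_mono: "crosses A B \<Longrightarrow> A \<subseteq> A' \<Longrightarrow> B \<subseteq> B' \<Longrightarrow> crosses A' B'"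
  unfolding crosses_def by blast

text \<open>For disjoint nonempty finite sets this is the absence of crossings, hence symmetric. If
  \<open>B\<close> and \<open>F\<close> share a vertex \<open>v\<close>, it forces \<open>F\<close>
  into the arc that starts at \<open>v\<close>, and symmetry is lost: it then says that
  \<open>B\<close> comes before \<open>F\<close> at \<open>v\<close>.\<close>

definition within_arc :: "nat set \<Rightarrow> nat set \<Rightarrow> bool" where
  "within_arc B F \<longleftrightarrow> (\<forall>x\<in>F. \<forall>y\<in>F. cyclic_pred B x = cyclic_pred B y)"

lemma within_arcD: "within_arc B F \<Longrightarrow> x \<in> F \<Longrightarrow> y \<in> F \<Longrightarrow> cyclic_pred B x = cyclic_pred B y"
  unfolding within_arc_def by blast

lemma within_arc_not_crosses:
  assumes "finite B" "within_arc B F"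
  shows "\<not> crosses B F" "\<not> crosses F B"
proof -
  \<comment> \<open>Here \<open>j\<close> lies between \<open>i\<close> and \<open>k\<close>, while
    \<open>l\<close> lies outside. The predecessor of \<open>j\<close> is in \<open>[i, j]\<close>,
    and \<open>k\<close> comes between it and \<open>l\<close> on the circle.\<close>
  have no: "\<not> (cyclic_pred B j = cyclic_pred B l)"
    if "i < j" "j < k" "k \<le> l \<or> l < i" "i \<in> B" "k \<in> B" for i j k l
  proof
    assume eq: "cyclic_pred B j = cyclic_pred B l"
    let ?p = "cyclic_pred B j"
    have "\<not> cyclic_between ?p i j" "\<not> cyclic_between ?p k j" "\<not> cyclic_between ?p i l" "\<not> cyclic_between ?p k l"
      using cyclic_pred_not_between[OF assms(1) that(4)] cyclic_pred_not_between[OF assms(1) that(5)] eq by metis+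
    note nb = this[unfolded cyclic_between_def]
    have p: "i \<le> ?p" "?p \<le> j" using nb(1,2) that(1,2) by auto
    show False using nb(3,4) p that(1-3) by auto
  qed
  show "\<not> crosses B F"
  proof
    assume "crosses B F"
    then obtain i j k l where *: "i < j" "j < k" "k < l" "i \<in> B" "k \<in> B" "j \<in> F" "l \<in> F"
      unfolding crosses_def by blast
    then show False using no[of i j k l] within_arcD[OF assms(2), of j l] by simp
  qed
  show "\<not> crosses F B"
  proof
    assume "crosses F B"
    then obtain i j k l where *: "i < j" "j < k" "k < l" "i \<in> F" "k \<in> F" "j \<in> B" "l \<in> B"
      unfolding crosses_def by blast
    then show False using no[of j k l i] within_arcD[OF assms(2), of k i] by simp
  qed
qed

lemma disjoint_within_arc:
  assumes "finite B" "B \<noteq> {}" "B \<inter> F = {}" "\<not> crosses B F" "\<not> crosses F B"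
  shows "within_arc B F"
proof -
  have lt: "cyclic_pred B x = cyclic_pred B y" if "x \<in> F" "y \<in> F" "x < y" for x y
  proof (rule ccontr)
    assume ne: "cyclic_pred B x \<noteq> cyclic_pred B y"
    let ?p = "cyclic_pred B x"
    have p: "?p \<in> B" by (rule cyclic_pred_mem[OF assms(1,2)])
    obtain b where b: "b \<in> B" "cyclic_between ?p b y"
      using ne p cyclic_pred_iff[OF assms(1,2), of y ?p] by auto
    have nb: "\<not> cyclic_between ?p b x" by (rule cyclic_pred_not_between[OF assms(1) b(1)])
    have ineq: "b \<noteq> x" "b \<noteq> y" "?p \<noteq> x" "?p \<noteq> y" using assms(3) that b p by auto
    have p_b_y: "?p < b \<and> b \<le> y \<or> y < ?p \<and> (?p < b \<or> b \<le> y)" and p_b_x: "\<not> (?p < b \<and> b \<le> x)" "\<not> (x < ?p \<and> (?p < b \<or> b \<le> x))"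
      using b(2) nb unfolding cyclic_between_def by blast+
    show False
    \<comment> \<open>The cyclic order is \<open>?p\<close>, \<open>x\<close>, \<open>b\<close>,
      \<open>y\<close>. Where the linear order cuts it decides which of the two sets owns the
      smallest of the four.\<close>
    proof (cases "?p < x")
      case True
      then have "x < b" "b < y" using p_b_y p_b_x ineq that(3) by auto
      with True have "crosses B F" using p b that unfolding crosses_def by blast
      then show False using assms(4) by blast
    next
      case False
      then have "x < b" "b < y" "y < ?p" using p_b_y p_b_x ineq that(3) by auto
      then have "crosses F B" using p b that unfolding crosses_def by blast
      then show False using assms(5) by blast
    qed
  qed
  show ?thesis
    unfolding within_arc_def
  proof (intro ballI)
    fix x y assume "x \<in> F" "y \<in> F"
    then show "cyclic_pred B x = cyclic_pred B y"
      using lt[of x y] lt[of y x] by (metis linorder_neqE_nat)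
  qed
qed

lemma cyclic_pred_insert:
  assumes "finite E" "E \<noteq> {}"
  shows "cyclic_pred (insert y E) x = cyclic_pred E x \<or>
    cyclic_pred (insert y E) x = y \<and> cyclic_pred E y = cyclic_pred E x"
proof (cases "cyclic_pred (insert y E) x = y")
  case True
  then show ?thesis using cyclic_pred_subset[of "insert y E" E x] assms by auto
next
  case False
  let ?p = "cyclic_pred (insert y E) x"
  have "?p \<in> E" using cyclic_pred_mem[of "insert y E" x] assms False by auto
  then show ?thesis using cyclic_pred_subset[of "insert y E" E x] cyclic_pred_self[OF assms(1)] assms by auto
qed

text \<open>Seen from \<open>B\<close>, which sits in the arc of \<open>E\<close> at
  \<open>v\<close> without containing \<open>v\<close>, everything outside this arc looks like
  \<open>v\<close>. Indeed \<open>B\<close> still lies in one arc after \<open>x\<close> is added to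
  \<open>E\<close>, and for disjoint sets this relation can be reversed.\<close>

lemma cyclic_pred_outside:
  assumes "finite E" "v \<in> E" "finite B" "B \<noteq> {}" "v \<notin> B" "\<And>b. b \<in> B \<Longrightarrow> cyclic_pred E b = v"
    and "cyclic_pred E x \<noteq> v"
  shows "cyclic_pred B x = cyclic_pred B v"
proof -
  let ?E = "insert x E"
  have ne: "E \<noteq> {}" using assms by blast
  have c: "cyclic_pred ?E b = v" if "b \<in> B" for b
    using cyclic_pred_insert[OF assms(1) ne, of x b] assms(6)[OF that] assms(7) by auto
  have "x \<notin> B" using assms(6,7) by blast
  moreover have "e \<notin> B" if "e \<in> E" for e
    using assms(5) assms(6)[of e] cyclic_pred_self[OF assms(1) that] by auto
  ultimately have "?E \<inter> B = {}" by blast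
  moreover have "within_arc ?E B" unfolding within_arc_def by (simp add: c)
  ultimately have "within_arc B ?E"
    using within_arc_not_crosses[of ?E B] assms disjoint_within_arc[of B ?E] by auto
  then show ?thesis by (rule within_arcD) (simp_all add: assms(2))
qed

text \<open>Transitivity of the order of edges at \<open>v\<close>: if \<open>G\<close> comes after
  \<open>L\<close> there, then the arc of \<open>G\<close> at \<open>v\<close> is contained in that
  of \<open>L\<close>. The second vertex \<open>g\<close> is what bounds the arc of
  \<open>G\<close>.\<close>

lemma within_arc_trans:
  assumes "finite L" "finite G" "within_arc L G" "v \<in> L" "v \<in> G" "g \<in> G" "g \<noteq> v" "cyclic_pred G x = v"
  shows "cyclic_pred L x = v"
proof -
  have ne: "L \<noteq> {}" "G \<noteq> {}" using assms by auto
  have g: "cyclic_pred L g = v"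
    using within_arcD[OF assms(3,6,5)] cyclic_pred_self[OF assms(1,4)] by simp
  have gx: "\<not> cyclic_between v g x" using cyclic_pred_not_between[OF assms(2,6), of x] assms(8) by simp
  have "\<not> cyclic_between v b x" if "b \<in> L" for b
  proof -
    have "\<not> cyclic_between v b g" using cyclic_pred_not_between[OF assms(1) that, of g] g by simp
    then show ?thesis using gx assms(7) unfolding cyclic_between_def by linarith
  qed
  then show ?thesis using assms(4) cyclic_pred_iff[OF assms(1) ne(1)] by blast
qed

lemma cyclic_between_total: "x \<noteq> v \<Longrightarrow> y \<noteq> v \<Longrightarrow> cyclic_between v x y \<or> cyclic_between v y x"
  unfolding cyclic_between_def by linarith

text \<open>The four alternatives cut the cyclic order \<open>v\<close>, \<open>i\<close>,
  \<open>j\<close>, \<open>k\<close> at its four places; in this form four points that alternate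
  between two sets yield a crossing.\<close>

lemma cyclic_between_trans:
  assumes "cyclic_between v i j" "cyclic_between v j k" "i \<noteq> j" "j \<noteq> k" "k \<noteq> v"
  shows "i < j \<and> j < k \<and> k < v \<or> j < k \<and> k < v \<and> v < i \<or> k < v \<and> v < i \<and> i < j \<or> v < i \<and> i < j \<and> j < k"
  using assms unfolding cyclic_between_def by (cases "v < i"; cases "v < j"; cases "v < k") auto

lemma cyclic_between_rotate:
  "i < j \<and> j < k \<and> k < v \<or> j < k \<and> k < v \<and> v < i \<or> k < v \<and> v < i \<and> i < j \<or> v < i \<and> i < j \<and> j < k \<Longrightarrow>
   j < k \<and> k < v \<and> v < i \<or> k < v \<and> v < i \<and> i < j \<or> v < i \<and> i < j \<and> j < k \<or> i < j \<and> j < k \<and> k < (v :: nat)"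
  by blast

text \<open>If neither set came first at \<open>v\<close>, there would be \<open>e\<close> before
  \<open>f\<close> and \<open>f'\<close> before \<open>e'\<close> on the way from \<open>v\<close>.
  If \<open>f\<close> precedes \<open>e'\<close>, then \<open>e\<close>, \<open>f\<close>,
  \<open>e'\<close>, \<open>v\<close> alternate; otherwise \<open>f'\<close>, \<open>e'\<close>,
  \<open>f\<close>, \<open>v\<close> do. In both cases \<open>v\<close> counts for the set that is
  needed, as it belongs to both.\<close>

lemma within_arc_common_vertex:
  assumes "finite E" "finite F" "E \<inter> F = {v}" "\<not> crosses E F" "\<not> crosses F E"
  shows "within_arc E F \<or> within_arc F E"
proof (rule ccontr)
  assume "\<not> ?thesis"
  then have n: "\<not> within_arc E F" "\<not> within_arc F E" by auto
  have v: "v \<in> E" "v \<in> F" using assms by auto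
  have ex: "\<exists>f\<in>B. cyclic_pred A f \<noteq> v" if "\<not> within_arc A B" for A B
    using that unfolding within_arc_def by metis
  have bet: "\<exists>f\<in>B. f \<noteq> v \<and> (\<exists>e\<in>A. e \<noteq> v \<and> cyclic_between v e f)"
    if AB: "\<not> within_arc A B" "finite A" "v \<in> A" for A B
  proof -
    obtain f where f: "f \<in> B" "cyclic_pred A f \<noteq> v" using ex[OF AB(1)] by blast
    then have "f \<noteq> v" using cyclic_pred_self[OF AB(2,3)] by blast
    moreover obtain e where e: "e \<in> A" "cyclic_between v e f"
      using f(2) AB cyclic_pred_iff[OF AB(2), of f v] by auto
    moreover have "e \<noteq> v" using e(2) unfolding cyclic_between_def by linarith
    ultimately show ?thesis using f by blast
  qed
  obtain f e where fe: "f \<in> F" "f \<noteq> v" "e \<in> E" "e \<noteq> v" "cyclic_between v e f"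
    using bet[OF n(1) assms(1) v(1)] by blast
  obtain e' f' where fe': "e' \<in> E" "e' \<noteq> v" "f' \<in> F" "f' \<noteq> v" "cyclic_between v f' e'"
    using bet[OF n(2) assms(2) v(2)] by blast
  have d: "a \<noteq> b" if "a \<in> E" "b \<in> F" "a \<noteq> v" for a b using assms(3) that by blast
  have ne: "e \<noteq> f" "e \<noteq> f'" "e' \<noteq> f" "e' \<noteq> f'" using d fe fe' by auto
  have nc: "\<not> (i < j \<and> j < k \<and> k < l)" if "i \<in> E \<and> k \<in> E \<and> j \<in> F \<and> l \<in> F \<or> i \<in> F \<and> k \<in> F \<and> j \<in> E \<and> l \<in> E" for i j k l
    using assms(4,5) that unfolding crosses_def by blast
  have cyc: False if "i \<in> E" "j \<in> F" "k \<in> E" "l \<in> F"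
    "i < j \<and> j < k \<and> k < l \<or> j < k \<and> k < l \<and> l < i \<or> k < l \<and> l < i \<and> i < j \<or> l < i \<and> i < j \<and> j < k" for i j k l
    using that nc by blast
  show False
  proof (cases "cyclic_between v f e'")
    case True
    show False
      by (rule cyc[OF fe(3,1) fe'(1) v(2) cyclic_between_trans[OF fe(5) True]]) (use ne fe fe' in auto)
  next
    case False
    have *: "cyclic_between v e' f" using False ne(3) fe(2) fe'(2) by (metis cyclic_between_total)
    show False
      by (rule cyc[OF fe'(1) fe(1) v(1) fe'(3) cyclic_between_rotate[OF cyclic_between_trans[OF fe'(5) *]]]) (use ne fe fe' in auto)
  qed
qed

section \<open>Factorization of the intervals of noncrossing partitions\<close>

section \<open>Products of posets\<close>

definition PiE_order :: "'i set \<Rightarrow> ('i \<Rightarrow> 'a rel) \<Rightarrow> ('i \<Rightarrow> 'a) rel" where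
  "PiE_order I R = {(f, g). f \<in> PiE I (\<lambda>i. Field (R i)) \<and> g \<in> PiE I (\<lambda>i. Field (R i)) \<and> (\<forall>i\<in>I. (f i, g i) \<in> R i)}"

lemma Field_PiE_order:
  assumes "\<And>i. i \<in> I \<Longrightarrow> bounded_poset (R i)"
  shows "Field (PiE_order I R) = PiE I (\<lambda>i. Field (R i))"
proof
  show "Field (PiE_order I R) \<subseteq> PiE I (\<lambda>i. Field (R i))" by (auto simp: Field_def PiE_order_def)
  show "PiE I (\<lambda>i. Field (R i)) \<subseteq> Field (PiE_order I R)"
  proof
    fix f assume f: "f \<in> PiE I (\<lambda>i. Field (R i))"
    then have "(f, f) \<in> PiE_order I R"
      using bounded_poset_refl[OF assms] by (auto simp: PiE_order_def PiE_mem)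
    then show "f \<in> Field (PiE_order I R)" by (rule FieldI1)
  qed
qed

lemma iso_class_PiE_order:
  assumes "finite I" "\<And>i. i \<in> I \<Longrightarrow> bounded_poset (R i)"
  shows "bounded_poset (PiE_order I R) \<and> iso_class (PiE_order I R) = (\<Sum>i\<in>I. iso_class (R i))"
  using assms
proof (induction I rule: finite_induct)
  case empty
  have e: "PiE_order {} R = {(\<lambda>_. undefined, \<lambda>_. undefined)}" by (auto simp: PiE_order_def)
  have b: "bounded_poset (PiE_order {} R)" unfolding e by (rule bounded_poset_single)
  have "poset_iso (PiE_order {} R) {((), ())}"
    unfolding e poset_iso_def by (rule exI[of _ "\<lambda>_. ()"]) (auto simp: bij_betw_def Field_def)
  then have "iso_class (PiE_order {} R) = 0"
    unfolding zero_bposet_def by (simp add: iso_class_eq_iff[OF b bounded_poset_single])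
  with b show ?case by simp
next
  case (insert i I)
  have Ri: "bounded_poset (R i)" and RI: "\<And>j. j \<in> I \<Longrightarrow> bounded_poset (R j)"
    and IH: "bounded_poset (PiE_order I R)" "iso_class (PiE_order I R) = (\<Sum>i\<in>I. iso_class (R i))"
    using insert by auto
  have PO: "Partial_order (R i)" "Partial_order (PiE_order I R)" using Ri IH by (auto simp: bounded_poset_def)
  let ?g = "\<lambda>(x, f). f(i := x)"
  have F: "Field (prod_poset (R i) (PiE_order I R)) = Field (R i) \<times> PiE I (\<lambda>i. Field (R i))"
    by (simp add: Field_prod_poset[OF PO] Field_PiE_order[OF RI])
  have F': "Field (PiE_order (insert i I) R) = PiE (insert i I) (\<lambda>i. Field (R i))"
    by (rule Field_PiE_order) (use insert in auto)
  have "bij_betw ?g (Field (prod_poset (R i) (PiE_order I R))) (Field (PiE_order (insert i I) R))"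
    unfolding F F' bij_betw_def
  proof
    show "inj_on ?g (Field (R i) \<times> PiE I (\<lambda>i. Field (R i)))"
      by (rule inj_combinator[OF insert(2)])
    show "?g ` (Field (R i) \<times> PiE I (\<lambda>i. Field (R i))) = PiE (insert i I) (\<lambda>i. Field (R i))"
      by (simp add: PiE_insert_eq split_def image_def)
  qed
  moreover have "(x, y) \<in> prod_poset (R i) (PiE_order I R) \<longleftrightarrow> (?g x, ?g y) \<in> PiE_order (insert i I) R"
    if "x \<in> Field (prod_poset (R i) (PiE_order I R))" "y \<in> Field (prod_poset (R i) (PiE_order I R))" for x y
  proof -
    obtain a f b h where xy: "x = (a, f)" "y = (b, h)" by force
    have m: "a \<in> Field (R i)" "b \<in> Field (R i)" "f \<in> PiE I (\<lambda>i. Field (R i))" "h \<in> PiE I (\<lambda>i. Field (R i))"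
      using that unfolding xy F by auto
    then have m': "f(i := a) \<in> PiE (insert i I) (\<lambda>i. Field (R i))" "h(i := b) \<in> PiE (insert i I) (\<lambda>i. Field (R i))"
      by (auto intro!: PiE_fun_upd)
    have "j \<noteq> i" if "j \<in> I" for j using that insert(2) by blast
    then show ?thesis using m m' unfolding xy PiE_order_def by auto
  qed
  ultimately have iso: "poset_iso (prod_poset (R i) (PiE_order I R)) (PiE_order (insert i I) R)"
    unfolding poset_iso_def by blast
  have b: "bounded_poset (PiE_order (insert i I) R)"
    by (rule bounded_poset_iso[OF iso bounded_poset_prod[OF Ri IH(1)]])
  have "iso_class (PiE_order (insert i I) R) = iso_class (R i) + iso_class (PiE_order I R)"
    using iso iso_class_eq_iff[OF bounded_poset_prod[OF Ri IH(1)] b] plus_iso_class[OF Ri IH(1)] by simp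
  with b insert(1,2) IH(2) show ?case by simp
qed

section \<open>Families ordered by refinement\<close>

definition fam_le :: "'a set set \<Rightarrow> 'a set set \<Rightarrow> bool" where
  "fam_le M N \<longleftrightarrow> (\<forall>E\<in>M. \<exists>F\<in>N. E \<subseteq> F)"

definition fam_order :: "'a set set set \<Rightarrow> 'a set set rel" where
  "fam_order S = {(M, N). M \<in> S \<and> N \<in> S \<and> fam_le M N}"

lemma fam_le_refl [simp]: "fam_le M M"
  by (auto simp: fam_le_def)

lemma fam_le_trans: "fam_le L M \<Longrightarrow> fam_le M N \<Longrightarrow> fam_le L N"
  unfolding fam_le_def by (meson order_trans)

lemma fam_le_empty [simp]: "fam_le {} M"
  by (auto simp: fam_le_def)

lemma Field_fam_order [simp]: "Field (fam_order S) = S"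
  unfolding Field_def fam_order_def by (auto intro: fam_le_refl)

lemma fam_le_antisym:
  assumes "fam_le M N" "fam_le N M" "disjoint M" "{} \<notin> M" "disjoint N" "{} \<notin> N"
  shows "M = N"
proof -
  have sub: "M \<subseteq> N" if MN: "fam_le M N" "fam_le N M" "disjoint M" "{} \<notin> M" for M N :: "'a set set"
  proof
    fix E assume E: "E \<in> M"
    obtain F where F: "F \<in> N" "E \<subseteq> F" using MN(1) E unfolding fam_le_def by blast
    obtain G where G: "G \<in> M" "F \<subseteq> G" using MN(2) F unfolding fam_le_def by blast
    have "E = G" using MN(3,4) E G F unfolding disjoint_def by (metis inf.orderE order_trans inf_commute)
    then show "E \<in> N" using F G by auto
  qed
  show ?thesis using sub[of M N] sub[of N M] assms by blast
qed

lemma interval_fam_order: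
  assumes "M \<in> S" "N \<in> S"
  shows "interval (fam_order S) M N = fam_order {K \<in> S. fam_le M K \<and> fam_le K N}"
  using assms fam_le_trans unfolding interval_def fam_order_def by blast

text \<open>For \<open>g\<close> only its image and the comparison of the orders have to be
  supplied; injectivity follows from antisymmetry of the product order.\<close>

lemma iso_class_fam_order_product:
  assumes "finite I" "\<And>i. i \<in> I \<Longrightarrow> bounded_poset (fam_order (S i))"
    and "g ` PiE I S = S'"
    and "\<And>f h. f \<in> PiE I S \<Longrightarrow> h \<in> PiE I S \<Longrightarrow> fam_le (g f) (g h) \<longleftrightarrow> (\<forall>i\<in>I. fam_le (f i) (h i))"
  shows "iso_class (fam_order S') = (\<Sum>i\<in>I. iso_class (fam_order (S i)))"
proof -
  let ?R = "\<lambda>i. fam_order (S i)"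
  have b: "bounded_poset (PiE_order I ?R)" "iso_class (PiE_order I ?R) = (\<Sum>i\<in>I. iso_class (?R i))"
    using iso_class_PiE_order[OF assms(1,2)] by auto
  have F: "Field (PiE_order I ?R) = PiE I S"
    using Field_PiE_order[of I ?R] assms(2) by simp
  have iff: "(x, y) \<in> PiE_order I ?R \<longleftrightarrow> (g x, g y) \<in> fam_order S'" if "x \<in> PiE I S" "y \<in> PiE I S" for x y
  proof -
    have "g x \<in> S'" "g y \<in> S'" using assms(3) that by blast+
    then have "(g x, g y) \<in> fam_order S' \<longleftrightarrow> (\<forall>i\<in>I. fam_le (x i) (y i))"
      using assms(4)[OF that] by (simp add: fam_order_def)
    moreover have "(x, y) \<in> PiE_order I ?R \<longleftrightarrow> (\<forall>i\<in>I. fam_le (x i) (y i))"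
      using that unfolding PiE_order_def Field_fam_order by (auto simp: fam_order_def PiE_mem)
    ultimately show ?thesis by blast
  qed
  have "inj_on g (PiE I S)"
  proof (rule inj_onI)
    fix x y assume *: "x \<in> PiE I S" "y \<in> PiE I S" "g x = g y"
    then have "(x, y) \<in> PiE_order I ?R" "(y, x) \<in> PiE_order I ?R"
      using iff[of x y] iff[of y x] assms(3) by (auto simp: fam_order_def)
    then show "x = y" by (rule bounded_poset_antisym[OF b(1)])
  qed
  then have "poset_iso (PiE_order I ?R) (fam_order S')"
    unfolding poset_iso_def F using assms(3) iff by (intro exI[of _ g]) (auto simp: bij_betw_def)
  then show ?thesis
    using b bounded_poset_iso[OF _ b(1)] iso_class_eq_iff[OF b(1)] by metis
qed

section \<open>Arcs\<close>

text \<open>For \<open>v\<close> in \<open>B\<close> this is the stretch of \<open>V\<close> that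
  starts at \<open>v\<close> and ends just before the next element of \<open>B\<close> on the
  circle.\<close>

definition arc :: "nat set \<Rightarrow> nat set \<Rightarrow> nat \<Rightarrow> nat set" where
  "arc V B v = {x \<in> V. cyclic_pred B x = v}"

lemma arc_subset: "arc V B v \<subseteq> V"
  by (auto simp: arc_def)

lemma finite_arc: "finite V \<Longrightarrow> finite (arc V B v)"
  by (rule finite_subset[OF arc_subset])

lemma arc_disjoint: "v \<noteq> w \<Longrightarrow> arc V B v \<inter> arc V B w = {}"
  by (auto simp: arc_def)

lemma UN_arc:
  assumes "finite V" "B \<subseteq> V" "B \<noteq> {}"
  shows "(\<Union>v\<in>B. arc V B v) = V"
  using cyclic_pred_mem[OF finite_subset[OF assms(2,1)] assms(3)] by (auto simp: arc_def)

lemma Int_arc: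
  assumes "finite V" "B \<subseteq> V" "v \<in> B"
  shows "B \<inter> arc V B v = {v}"
  using cyclic_pred_self[OF finite_subset[OF assms(2,1)]] assms by (auto simp: arc_def)

lemma mem_arc: "finite V \<Longrightarrow> B \<subseteq> V \<Longrightarrow> v \<in> B \<Longrightarrow> v \<in> arc V B v"
  using Int_arc by blast

lemma not_subset_arc:
  assumes "finite V" "B \<subseteq> X" "B \<subseteq> V" "card B \<ge> 2" "v \<in> B"
  shows "\<not> X \<subseteq> arc V B v"
proof
  assume "X \<subseteq> arc V B v"
  then have "B = {v}" using Int_arc[OF assms(1,3,5)] assms(2) by blast
  then show False using assms(4) by simp
qed

lemma card_UN_arc:
  assumes "finite V" "B \<subseteq> V" "A \<subseteq> B"
  shows "card (\<Union>v\<in>A. arc V B v) = (\<Sum>v\<in>A. card (arc V B v))"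
proof (rule card_UN_disjoint)
  show "finite A" by (meson assms finite_subset)
qed (simp_all add: finite_arc arc_disjoint assms)

lemma card_eq_sum_arc:
  assumes "finite V" "B \<subseteq> V" "B \<noteq> {}"
  shows "card V = (\<Sum>v\<in>B. card (arc V B v))"
  using card_UN_arc[OF assms(1,2) order_refl] UN_arc[OF assms] by simp

lemma card_arc_less:
  assumes "finite V" "B \<subseteq> V" "card B \<ge> 2" "v \<in> B"
  shows "card (arc V B v) < card V"
proof (rule psubset_card_mono[OF assms(1)])
  have "\<not> V \<subseteq> arc V B v" by (rule not_subset_arc) (use assms in auto)
  then show "arc V B v \<subset> V" using arc_subset by blast
qed

lemma within_arc_iff:
  assumes "finite V" "B \<subseteq> V" "B \<noteq> {}" "F \<subseteq> V" "F \<noteq> {}"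
  shows "within_arc B F \<longleftrightarrow> (\<exists>v\<in>B. F \<subseteq> arc V B v)"
proof
  assume w: "within_arc B F"
  obtain x where x: "x \<in> F" using assms(5) by blast
  have "F \<subseteq> arc V B (cyclic_pred B x)"
    using within_arcD[OF w _ x] assms(4) by (auto simp: arc_def)
  moreover have "cyclic_pred B x \<in> B" by (rule cyclic_pred_mem[OF finite_subset[OF assms(2,1)] assms(3)])
  ultimately show "\<exists>v\<in>B. F \<subseteq> arc V B v" by blast
next
  assume "\<exists>v\<in>B. F \<subseteq> arc V B v"
  then obtain v where "F \<subseteq> arc V B v" by blast
  then have "cyclic_pred B x = v" if "x \<in> F" for x using that by (auto simp: arc_def)
  then show "within_arc B F" by (simp add: within_arc_def)
qed

text \<open>Enlarging the ambient set from the arc of \<open>E\<close> to \<open>V\<close> adds all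
  new points to a single arc of \<open>B\<close>, the one that contains \<open>v\<close>.\<close>

lemma arc_within_arc:
  assumes "finite V" "E \<subseteq> V" "v \<in> E" "B \<subseteq> arc V E v" "v \<notin> B" "B \<noteq> {}"
  shows "x \<in> V - arc V E v \<Longrightarrow> cyclic_pred B x = cyclic_pred B v"
    "arc V B b = (if b = cyclic_pred B v then arc (arc V E v) B b \<union> (V - arc V E v) else arc (arc V E v) B b)"
proof -
  have fin: "finite E" "finite B" using assms(1,2,4) arc_subset finite_subset by metis+
  have *: "cyclic_pred B x = cyclic_pred B v" if "x \<in> V - arc V E v" for x
    by (rule cyclic_pred_outside[OF fin(1) assms(3) fin(2) assms(6,5)]) (use assms(4) that in \<open>auto simp: arc_def\<close>)
  then show "x \<in> V - arc V E v \<Longrightarrow> cyclic_pred B x = cyclic_pred B v" .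
  show "arc V B b = (if b = cyclic_pred B v then arc (arc V E v) B b \<union> (V - arc V E v) else arc (arc V E v) B b)"
    using * arc_subset[of V E v] unfolding arc_def[of _ B] by auto
qed

text \<open>As the arcs of \<open>X\<close> refine those of \<open>E\<close>, each can be computed
  inside the arc of \<open>E\<close> that contains its starting point.\<close>

lemma arc_superset:
  assumes "finite V" "E \<subseteq> X" "X \<subseteq> V" "v \<in> E" "x \<in> X \<inter> arc V E v"
  shows "arc V X x = arc (arc V E v) (X \<inter> arc V E v) x"
proof -
  have fin: "finite X" and ne: "E \<noteq> {}" using assms finite_subset by blast+
  let ?W = "arc V E v"
  have E: "cyclic_pred E (cyclic_pred X y) = cyclic_pred E y" for y
    by (rule cyclic_pred_subset[OF fin assms(2) ne])
  have "cyclic_pred X y \<in> X \<inter> ?W" if "y \<in> ?W" for y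
    using E[of y] that cyclic_pred_mem[OF fin, of y] assms by (auto simp: arc_def)
  then have "cyclic_pred (X \<inter> ?W) y = cyclic_pred X y" if "y \<in> ?W" for y
    using that cyclic_pred_subset[OF fin, of "X \<inter> ?W" y] cyclic_pred_self[of "X \<inter> ?W" "cyclic_pred X y"] fin
    by (metis empty_iff finite_Int inf_le1)
  moreover have "y \<in> ?W" if "y \<in> V" "cyclic_pred X y = x" for y
    using E[of y] that assms(5) by (auto simp: arc_def)
  ultimately show ?thesis using arc_subset[of V E v] unfolding arc_def[of _ X] arc_def[of _ "X \<inter> ?W"] by auto
qed

lemma arc_subset_UN:
  assumes "finite E" "A \<subseteq> E" "A \<noteq> {}"
  shows "arc V A a = (\<Union>e\<in>arc E A a. arc V E e)"
  using cyclic_pred_subset[OF assms] cyclic_pred_mem[OF assms(1)] assms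
  unfolding arc_def by fastforce

text \<open>Once \<open>card V\<close> is 1 modulo \<open>d\<close>, a noncrossing partition is \<open>d\<close>-indivisible if and only if its blocks are
  good (\<open>nc_families_iff_card\<close>); unlike the condition on the Kreweras dual, this one is local to each block.\<close>

definition good :: "nat \<Rightarrow> nat set \<Rightarrow> nat set \<Rightarrow> bool" where
  "good d V B \<longleftrightarrow> (\<forall>v\<in>B. [card (arc V B v) = 1] (mod d))"

lemma good_card:
  assumes "finite V" "B \<subseteq> V" "B \<noteq> {}" "good d V B"
  shows "[card V = card B] (mod d)"
proof -
  have "[(\<Sum>v\<in>B. card (arc V B v)) = (\<Sum>v\<in>B. 1)] (mod d)"
    by (rule cong_sum) (use assms in \<open>auto simp: good_def\<close>)
  then show ?thesis using card_eq_sum_arc[OF assms(1-3)] by simp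
qed

lemma good_self: "finite V \<Longrightarrow> good d V V"
proof -
  assume "finite V"
  then have "arc V V v = {v}" if "v \<in> V" for v using Int_arc[of V V v] that arc_subset[of V V v] by blast
  then show ?thesis by (simp add: good_def)
qed

lemma arc_singleton [simp]: "arc V {b} b = V"
  by (auto simp: arc_def)

text \<open>The arcs of \<open>A\<close> in \<open>V\<close> are disjoint unions of arcs of
  \<open>E\<close>, each of size 1 modulo \<open>d\<close>; so modulo \<open>d\<close> their sizes
  count elements of \<open>E\<close>.\<close>

lemma good_trans:
  assumes "finite V" "E \<subseteq> V" "A \<subseteq> E" "good d V E"
  shows "good d V A \<longleftrightarrow> good d E A"
proof -
  have fin: "finite E" using assms finite_subset by blast
  have "[card (arc V A a) = card (arc E A a)] (mod d)" if "a \<in> A" for a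
  proof -
    have "card (arc V A a) = (\<Sum>e\<in>arc E A a. card (arc V E e))"
      using arc_subset_UN[OF fin assms(3), of V a] card_UN_arc[OF assms(1,2) arc_subset[of E A a]] that by (metis empty_iff)
    moreover have "[(\<Sum>e\<in>arc E A a. card (arc V E e)) = (\<Sum>e\<in>arc E A a. 1)] (mod d)"
      by (rule cong_sum) (use assms arc_subset[of E A a] in \<open>auto simp: good_def\<close>)
    ultimately show ?thesis by simp
  qed
  then show ?thesis unfolding good_def by (meson cong_sym cong_trans)
qed

text \<open>The complement of the arc of \<open>E\<close> joins a single arc of \<open>B\<close>,
  and by the assumed congruence its size is 0 modulo \<open>d\<close>.\<close>

lemma good_arc:
  assumes "finite V" "E \<subseteq> V" "v \<in> E" "B \<subseteq> arc V E v" "v \<notin> B" "[card (arc V E v) = card V] (mod d)"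
  shows "good d V B \<longleftrightarrow> good d (arc V E v) B"
proof (cases "B = {}")
  case False
  let ?W = "arc V E v"
  have "[card (arc V B b) = card (arc ?W B b)] (mod d)" for b
  proof -
    have "card V = card ?W + card (V - ?W)"
      using card_Un_disjoint[of ?W "V - ?W"] finite_arc[OF assms(1)] assms(1) arc_subset[of V E v]
      by (metis Diff_disjoint Diff_partition finite_Diff)
    then have 0: "[0 = card (V - ?W)] (mod d)"
      using assms(6) by (metis add.right_neutral cong_add_lcancel_nat)
    have "card (arc ?W B b \<union> (V - ?W)) = card (arc ?W B b) + card (V - ?W)"
      by (rule card_Un_disjoint) (use assms(1) finite_arc arc_subset[of ?W B b] in auto)
    moreover have "[card (arc ?W B b) + card (V - ?W) = card (arc ?W B b) + 0] (mod d)"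
      by (rule cong_add[OF cong_refl cong_sym[OF 0]])
    ultimately show ?thesis
      using arc_within_arc(2)[OF assms(1-5) False, of b] by auto
  qed
  then show ?thesis unfolding good_def by (meson cong_sym cong_trans)
qed (simp add: good_def)

lemma good_superset:
  assumes "finite V" "E \<subseteq> X" "X \<subseteq> V" "E \<noteq> {}"
  shows "good d V X \<longleftrightarrow> (\<forall>v\<in>E. good d (arc V E v) (X \<inter> arc V E v))"
proof -
  have "E \<subseteq> V" using assms by blast
  then have "X = (\<Union>v\<in>E. X \<inter> arc V E v)" using UN_arc[OF assms(1) _ assms(4)] assms(3) by blast
  then have "good d V X \<longleftrightarrow> (\<forall>v\<in>E. \<forall>x\<in>X \<inter> arc V E v. [card (arc V X x) = 1] (mod d))"
    unfolding good_def by blast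
  also have "\<dots> \<longleftrightarrow> (\<forall>v\<in>E. good d (arc V E v) (X \<inter> arc V E v))"
    unfolding good_def using arc_superset[OF assms(1-3)] by auto
  finally show ?thesis .
qed

lemma mem_fam_order: "(M, N) \<in> fam_order S \<longleftrightarrow> M \<in> S \<and> N \<in> S \<and> fam_le M N"
  by (simp add: fam_order_def)

section \<open>Noncrossing families\<close>

text \<open>A noncrossing partition is represented by the family of its blocks with at least two elements.\<close>

definition nc_family :: "nat set \<Rightarrow> nat set set \<Rightarrow> bool" where
  "nc_family V M \<longleftrightarrow> (\<forall>B\<in>M. B \<subseteq> V \<and> 2 \<le> card B) \<and> disjoint M \<and> noncrossing M"

definition nc_families :: "nat \<Rightarrow> nat set \<Rightarrow> nat set set set" where
  "nc_families d V = {M. nc_family V M \<and> (\<forall>B\<in>M. good d V B)}"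

definition inside :: "'a set set \<Rightarrow> 'a set \<Rightarrow> 'a set set" where
  "inside M W = {B \<in> M. B \<subseteq> W}"

lemma nc_familyD:
  assumes "nc_family V M"
  shows "B \<in> M \<Longrightarrow> B \<subseteq> V" "B \<in> M \<Longrightarrow> 2 \<le> card B" "B \<in> M \<Longrightarrow> B \<noteq> {}"
    "B \<in> M \<Longrightarrow> C \<in> M \<Longrightarrow> B \<noteq> C \<Longrightarrow> B \<inter> C = {}" "B \<in> M \<Longrightarrow> C \<in> M \<Longrightarrow> B \<noteq> C \<Longrightarrow> \<not> crosses B C"
  using assms unfolding nc_family_def noncrossing_iff disjoint_def by auto

lemma nc_familyI:
  assumes "\<And>B. B \<in> M \<Longrightarrow> B \<subseteq> V" "\<And>B. B \<in> M \<Longrightarrow> 2 \<le> card B"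
    "\<And>B C. B \<in> M \<Longrightarrow> C \<in> M \<Longrightarrow> B \<noteq> C \<Longrightarrow> B \<inter> C = {}" "\<And>B C. B \<in> M \<Longrightarrow> C \<in> M \<Longrightarrow> B \<noteq> C \<Longrightarrow> \<not> crosses B C"
  shows "nc_family V M"
  using assms unfolding nc_family_def noncrossing_iff disjoint_def by auto

lemma nc_familiesD:
  assumes "M \<in> nc_families d V"
  shows "nc_family V M" "B \<in> M \<Longrightarrow> good d V B"
  using assms by (auto simp: nc_families_def)

lemma finite_nc_families: "finite V \<Longrightarrow> finite (nc_families d V)"
  by (rule finite_subset[of _ "Pow (Pow V)"]) (auto simp: nc_families_def dest: nc_familyD)

lemma finite_nc_family: "finite V \<Longrightarrow> nc_family V M \<Longrightarrow> finite M"
  by (rule finite_subset[of _ "Pow V"]) (auto dest: nc_familyD)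

lemma nc_family_within_arc:
  assumes "finite V" "nc_family V M" "B \<in> M" "C \<in> M" "B \<noteq> C"
  shows "within_arc B C"
proof -
  note M = nc_familyD[OF assms(2)]
  show ?thesis
    by (rule disjoint_within_arc[OF finite_subset[OF M(1)[OF assms(3)] assms(1)] M(3)[OF assms(3)] M(4)[OF assms(3-5)]
          M(5)[OF assms(3-5)] M(5)[OF assms(4,3)]]) (use assms(5) in blast)
qed

lemma nc_family_arc:
  assumes "finite V" "nc_family V M" "E \<in> M" "B \<in> M" "B \<noteq> E"
  obtains v where "v \<in> E" "B \<subseteq> arc V E v" "v \<notin> B"
proof -
  note M = nc_familyD[OF assms(2)]
  have "\<exists>v\<in>E. B \<subseteq> arc V E v"
    using within_arc_iff[of V E B] nc_family_within_arc[OF assms(1-4)] M assms by metis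
  then show ?thesis using that M(4)[OF assms(3,4)] assms(5) by blast
qed

lemma nc_family_decompose:
  assumes "finite V" "nc_family V M" "E \<in> M"
  shows "M = insert E (\<Union>v\<in>E. inside M (arc V E v))"
proof -
  have "B \<in> (\<Union>v\<in>E. inside M (arc V E v))" if B: "B \<in> M" "B \<noteq> E" for B
  proof -
    obtain v where "v \<in> E" "B \<subseteq> arc V E v" using nc_family_arc[OF assms B] by metis
    then show ?thesis using B by (auto simp: inside_def)
  qed
  then show ?thesis using assms(3) by (auto simp: inside_def)
qed

lemma vertex_not_in_inside_arc:
  assumes "finite V" "nc_family V M" "E \<in> M" "v \<in> E" "B \<in> inside M (arc V E v)"
  shows "v \<notin> B"
proof
  assume v: "v \<in> B"
  have B: "B \<in> M" "B \<subseteq> arc V E v" using assms(5) by (auto simp: inside_def)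
  have "B \<noteq> E"
    using not_subset_arc[OF assms(1) order_refl nc_familyD(1)[OF assms(2,3)] nc_familyD(2)[OF assms(2,3)] assms(4)] B by blast
  then show False using nc_familyD(4)[OF assms(2) B(1) assms(3)] v assms(4) by blast
qed

lemma nc_family_inside: "nc_family V M \<Longrightarrow> nc_family W (inside M W)"
  by (rule nc_familyI) (auto simp: inside_def dest: nc_familyD)

lemma nc_families_inside_arc:
  assumes "finite V" "M \<in> nc_families d V" "[card V = 1] (mod d)" "E \<in> M" "v \<in> E"
  shows "inside M (arc V E v) \<in> nc_families d (arc V E v)"
proof -
  note M = nc_familiesD[OF assms(2)]
  have E: "E \<subseteq> V" using M(1) assms(4) by (rule nc_familyD(1))
  have c: "[card (arc V E v) = card V] (mod d)"
    using M(2)[OF assms(4)] assms(3,5) cong_trans cong_sym unfolding good_def by blast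
  have "good d (arc V E v) B" if "B \<in> inside M (arc V E v)" for B
    using good_arc[OF assms(1) E assms(5) _ vertex_not_in_inside_arc[OF assms(1) M(1) assms(4,5) that] c] M(2)[of B] that
    by (auto simp: inside_def)
  then show ?thesis using nc_family_inside[OF M(1)] by (simp add: nc_families_def)
qed

text \<open>If \<open>V\<close> has at most one element, its one-block partition has no block with
  two elements, and bottom and top coincide.\<close>

definition top_family :: "'a set \<Rightarrow> 'a set set" where
  "top_family V = (if 2 \<le> card V then {V} else {})"

lemma top_family_nc: "finite V \<Longrightarrow> top_family V \<in> nc_families d V"
  by (auto simp: top_family_def nc_families_def good_self intro!: nc_familyI)

lemma empty_nc: "{} \<in> nc_families d V"
  by (auto simp: nc_families_def intro!: nc_familyI)

lemma fam_le_top: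
  assumes "finite V" "M \<in> nc_families d V"
  shows "fam_le M (top_family V)"
proof -
  note M = nc_familyD[OF nc_familiesD(1)[OF assms(2)]]
  have "2 \<le> card V" if "B \<in> M" for B using card_mono[OF assms(1) M(1)[OF that]] M(2)[OF that] by simp
  then show ?thesis using M(1) by (auto simp: fam_le_def top_family_def)
qed

lemma Partial_order_nc_families: "Partial_order (fam_order (nc_families d V))"
  unfolding Partial_order_iff unfolding Field_fam_order
proof (intro conjI ballI impI)
  fix x y assume "x \<in> nc_families d V" "y \<in> nc_families d V" "(x, y) \<in> fam_order (nc_families d V)" "(y, x) \<in> fam_order (nc_families d V)"
  then show "x = y"
    by (intro fam_le_antisym) (auto simp: mem_fam_order nc_families_def nc_family_def)
qed (auto simp: mem_fam_order intro: fam_le_trans)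

lemma bounded_poset_nc_families:
  assumes "finite V"
  shows "bounded_poset (fam_order (nc_families d V))"
    "poset_bot (fam_order (nc_families d V)) = {}" "poset_top (fam_order (nc_families d V)) = top_family V"
proof -
  note top = top_family_nc[OF assms, of d]
  show b: "bounded_poset (fam_order (nc_families d V))"
    unfolding bounded_poset_def Field_fam_order
  proof (intro conjI)
    show "\<exists>b\<in>nc_families d V. \<forall>a\<in>nc_families d V. (b, a) \<in> fam_order (nc_families d V)"
      by (rule bexI[OF _ empty_nc]) (auto simp: mem_fam_order empty_nc)
    show "\<exists>t\<in>nc_families d V. \<forall>a\<in>nc_families d V. (a, t) \<in> fam_order (nc_families d V)"
      by (rule bexI[OF _ top]) (auto simp: mem_fam_order top fam_le_top[OF assms])
  qed (rule finite_nc_families[OF assms] Partial_order_nc_families[unfolded Field_fam_order])+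
  show "poset_bot (fam_order (nc_families d V)) = {}"
    by (rule bounded_poset_bot_eqI[OF b]) (auto simp: mem_fam_order empty_nc)
  show "poset_top (fam_order (nc_families d V)) = top_family V"
    by (rule bounded_poset_top_eqI[OF b]) (auto simp: mem_fam_order top fam_le_top[OF assms])
qed

definition upper_families :: "nat \<Rightarrow> nat set \<Rightarrow> nat set set \<Rightarrow> nat set set set" where
  "upper_families d V M = {K \<in> nc_families d V. fam_le M K}"

lemma interval_nc_families:
  assumes "finite V" "M \<in> nc_families d V"
  shows "interval (fam_order (nc_families d V)) {} M = fam_order {K \<in> nc_families d V. fam_le K M}"
    "interval (fam_order (nc_families d V)) M (top_family V) = fam_order (upper_families d V M)"
proof -
  show "interval (fam_order (nc_families d V)) {} M = fam_order {K \<in> nc_families d V. fam_le K M}"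
    using interval_fam_order[OF empty_nc assms(2)] by simp
  have "{K \<in> nc_families d V. fam_le M K \<and> fam_le K (top_family V)} = upper_families d V M"
    using fam_le_top[OF assms(1)] unfolding upper_families_def by blast
  then show "interval (fam_order (nc_families d V)) M (top_family V) = fam_order (upper_families d V M)"
    using interval_fam_order[OF assms(2) top_family_nc[OF assms(1)]] by simp
qed

lemma bounded_poset_upper_families:
  assumes "finite V" "M \<in> nc_families d V"
  shows "bounded_poset (fam_order (upper_families d V M))"
  unfolding interval_nc_families(2)[OF assms, symmetric]
  by (rule bounded_poset_interval[OF bounded_poset_nc_families(1)[OF assms(1)]])
    (simp add: mem_fam_order assms top_family_nc fam_le_top[OF assms])

section \<open>Lower intervals\<close>

text \<open>A refinement of \<open>M\<close> is an independent choice of a family on each block. By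
  \<open>good_trans\<close> the conditions in \<open>V\<close> and in a block \<open>E\<close> are
  equivalent, since \<open>E\<close> is good.\<close>

lemma iso_class_lower_interval:
  assumes "finite V" "M \<in> nc_families d V"
  shows "iso_class (fam_order {K \<in> nc_families d V. fam_le K M}) = (\<Sum>E\<in>M. iso_class (fam_order (nc_families d E)))"
proof (rule iso_class_fam_order_product[where g = "\<lambda>f. \<Union>E\<in>M. f E"])
  note M = nc_familyD[OF nc_familiesD(1)[OF assms(2)]]
  note gM = nc_familiesD(2)[OF assms(2)]
  show "finite M" using finite_nc_family[OF assms(1) nc_familiesD(1)[OF assms(2)]] .
  show "bounded_poset (fam_order (nc_families d E))" if "E \<in> M" for E
    using bounded_poset_nc_families(1) finite_subset[OF M(1)[OF that] assms(1)] .
  have same: "E = F" if "B \<subseteq> E" "B \<subseteq> F" "B \<noteq> {}" "E \<in> M" "F \<in> M" for B E F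
    using M(4)[OF that(4,5)] that by blast
  have fD: "nc_family E (f E)" "\<And>B. B \<in> f E \<Longrightarrow> good d E B" if "f \<in> PiE M (nc_families d)" "E \<in> M" for f E
    using that nc_familiesD by (auto dest!: PiE_mem)
  show "fam_le (\<Union>E\<in>M. f E) (\<Union>E\<in>M. h E) \<longleftrightarrow> (\<forall>E\<in>M. fam_le (f E) (h E))"
    if f: "f \<in> PiE M (nc_families d)" and h: "h \<in> PiE M (nc_families d)" for f h
  proof
    assume L: "fam_le (\<Union>E\<in>M. f E) (\<Union>E\<in>M. h E)"
    show "\<forall>E\<in>M. fam_le (f E) (h E)"
      unfolding fam_le_def
    proof (intro ballI)
      fix E B assume EB: "E \<in> M" "B \<in> f E"
      then obtain F C where FC: "F \<in> M" "C \<in> h F" "B \<subseteq> C" using L unfolding fam_le_def by blast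
      have "B \<subseteq> E" "B \<noteq> {}" "C \<subseteq> F" using nc_familyD[OF fD(1)[OF f EB(1)]] nc_familyD[OF fD(1)[OF h FC(1)]] EB FC by auto
      then have "E = F" using same[of B E F] EB FC by auto
      then show "\<exists>C\<in>h E. B \<subseteq> C" using FC by blast
    qed
  next
    assume R: "\<forall>E\<in>M. fam_le (f E) (h E)"
    show "fam_le (\<Union>E\<in>M. f E) (\<Union>E\<in>M. h E)"
      unfolding fam_le_def
    proof
      fix B assume "B \<in> (\<Union>E\<in>M. f E)"
      then obtain E where "E \<in> M" "B \<in> f E" by blast
      moreover from this obtain C where "C \<in> h E" "B \<subseteq> C" using R unfolding fam_le_def by blast
      ultimately show "\<exists>C\<in>\<Union>E\<in>M. h E. B \<subseteq> C" by blast
    qed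
  qed
  show "(\<lambda>f. \<Union>E\<in>M. f E) ` PiE M (nc_families d) = {K \<in> nc_families d V. fam_le K M}"
  proof (intro equalityI subsetI)
    fix K assume "K \<in> (\<lambda>f. \<Union>E\<in>M. f E) ` PiE M (nc_families d)"
    then obtain f where f: "f \<in> PiE M (nc_families d)" and K: "K = (\<Union>E\<in>M. f E)" by blast
    note f' = fD[OF f]
    have sub: "B \<subseteq> E" if "E \<in> M" "B \<in> f E" for E B using nc_familyD(1)[OF f'(1)] that by blast
    have "nc_family V K"
    proof (rule nc_familyI)
      show "B \<subseteq> V" if "B \<in> K" for B using that sub M(1) unfolding K by blast
      show "2 \<le> card B" if "B \<in> K" for B using that nc_familyD(2)[OF f'(1)] unfolding K by blast
      fix B C assume BC: "B \<in> K" "C \<in> K" "B \<noteq> C"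
      then obtain E F where EF: "E \<in> M" "F \<in> M" "B \<in> f E" "C \<in> f F" unfolding K by blast
      show "B \<inter> C = {}"
      proof (cases "E = F")
        case True
        then show ?thesis using nc_familyD(4)[OF f'(1)[OF EF(1)], of B C] EF BC by blast
      next
        case False
        then show ?thesis using M(4)[OF EF(1,2)] sub[OF EF(1,3)] sub[OF EF(2,4)] by blast
      qed
      show "\<not> crosses B C"
      proof (cases "E = F")
        case True
        then show ?thesis using nc_familyD(5)[OF f'(1)[OF EF(1)], of B C] EF BC by blast
      next
        case False
        then show ?thesis using M(5)[OF EF(1,2)] crosses_mono[OF _ sub[OF EF(1,3)] sub[OF EF(2,4)]] by blast
      qed
    qed
    moreover have "good d V B" if B: "B \<in> K" for B
    proof -
      obtain E where E: "E \<in> M" "B \<in> f E" using B unfolding K by blast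
      show ?thesis using good_trans[OF assms(1) M(1)[OF E(1)] sub[OF E] gM[OF E(1)]] f'(2)[OF E] by blast
    qed
    moreover have "fam_le K M" unfolding fam_le_def K using sub by blast
    ultimately show "K \<in> {K \<in> nc_families d V. fam_le K M}" by (simp add: nc_families_def)
  next
    fix K assume "K \<in> {K \<in> nc_families d V. fam_le K M}"
    then have K: "nc_family V K" "\<And>B. B \<in> K \<Longrightarrow> good d V B" "fam_le K M" by (auto dest: nc_familiesD)
    let ?f = "restrict (inside K) M"
    have "?f \<in> PiE M (nc_families d)"
    proof (rule restrict_PiE_iff[THEN iffD2], intro ballI)
      fix E assume E: "E \<in> M"
      have "good d E B" if "B \<in> inside K E" for B
        using good_trans[OF assms(1) M(1)[OF E] _ gM[OF E], of B] K(2)[of B] that by (auto simp: inside_def)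
      then show "inside K E \<in> nc_families d E" using nc_family_inside[OF K(1)] by (simp add: nc_families_def)
    qed
    moreover have "K = (\<Union>E\<in>M. ?f E)" using K(3) by (auto simp: fam_le_def inside_def)
    ultimately show "K \<in> (\<lambda>f. \<Union>E\<in>M. f E) ` PiE M (nc_families d)" by blast
  qed
qed

section \<open>Upper intervals\<close>

text \<open>A noncrossing partition that has \<open>E\<close> within one block is determined by its restrictions to the
  arcs of \<open>E\<close>, which are arbitrary.\<close>

definition hub :: "'a set \<Rightarrow> ('a \<Rightarrow> 'a set set) \<Rightarrow> 'a set" where
  "hub E f = (\<Union>v\<in>E. insert v (\<Union>{B \<in> f v. v \<in> B}))"

text \<open>The blocks at the vertices of \<open>E\<close> merge into the hub, and blocks that avoid
  the vertex of their arc are kept. The hub inserts each \<open>v\<close> explicitly because a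
  singleton block \<open>{v}\<close> is not listed in \<open>f v\<close>.\<close>

definition glue :: "'a set \<Rightarrow> ('a \<Rightarrow> 'a set set) \<Rightarrow> 'a set set" where
  "glue E f = insert (hub E f) (\<Union>v\<in>E. {B \<in> f v. v \<notin> B})"

context
  fixes V E :: "nat set" and d :: nat
  assumes V: "finite V" "[card V = 1] (mod d)" and E: "E \<subseteq> V" "2 \<le> card E" "good d V E"
begin

private abbreviation W :: "nat \<Rightarrow> nat set" where "W \<equiv> arc V E"

private lemma W_eq: "x \<in> W v \<Longrightarrow> x \<in> W u \<Longrightarrow> u = v"
  using arc_disjoint[of u v V E] by blast

private lemma W_card: "v \<in> E \<Longrightarrow> [card (W v) = 1] (mod d)" "v \<in> E \<Longrightarrow> [card (W v) = card V] (mod d)"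
  using E(3) V(2) cong_trans cong_sym unfolding good_def by blast+

private lemma glueD:
  assumes "f \<in> PiE E (\<lambda>v. nc_families d (W v))" "v \<in> E"
  shows "nc_family (W v) (f v)" "B \<in> f v \<Longrightarrow> good d (W v) B" "B \<in> f v \<Longrightarrow> B \<subseteq> W v"
    "hub E f \<inter> W v = insert v (\<Union>{B \<in> f v. v \<in> B})"
    "hub E f \<inter> W v = {v} \<or> hub E f \<inter> W v \<in> f v" "E \<subseteq> hub E f" "hub E f \<subseteq> V"
proof -
  have F: "nc_family (W u) (f u)" "\<And>B. B \<in> f u \<Longrightarrow> good d (W u) B" "\<And>B. B \<in> f u \<Longrightarrow> B \<subseteq> W u" if "u \<in> E" for u
    using PiE_mem[OF assms(1) that] nc_familiesD nc_familyD(1) by blast+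
  show "nc_family (W v) (f v)" "B \<in> f v \<Longrightarrow> good d (W v) B" "B \<in> f v \<Longrightarrow> B \<subseteq> W v"
    using F[OF assms(2)] by auto
  have mem: "u \<in> W u" if "u \<in> E" for u using mem_arc[OF V(1) E(1) that] .
  show eq: "hub E f \<inter> W v = insert v (\<Union>{B \<in> f v. v \<in> B})"
  proof (intro equalityI subsetI)
    fix x assume x: "x \<in> hub E f \<inter> W v"
    then obtain u where u: "u \<in> E" "x \<in> insert u (\<Union>{B \<in> f u. u \<in> B})" unfolding hub_def by blast
    then have "x \<in> W u" using F(3)[OF u(1)] mem[OF u(1)] by blast
    then have "u = v" using x W_eq by blast
    with u show "x \<in> insert v (\<Union>{B \<in> f v. v \<in> B})" by blast
  next
    fix x assume "x \<in> insert v (\<Union>{B \<in> f v. v \<in> B})"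
    then show "x \<in> hub E f \<inter> W v" using assms(2) F(3)[OF assms(2)] mem[OF assms(2)] unfolding hub_def by blast
  qed
  show "hub E f \<inter> W v = {v} \<or> hub E f \<inter> W v \<in> f v"
  proof (cases "\<exists>B\<in>f v. v \<in> B")
    case True
    then obtain B where B: "B \<in> f v" "v \<in> B" by blast
    then have "{B \<in> f v. v \<in> B} = {B}" using nc_familyD(4)[OF F(1)[OF assms(2)] B(1)] by blast
    then have "hub E f \<inter> W v = B" unfolding eq using B by auto
    then show ?thesis using B by simp
  next
    case False
    then show ?thesis unfolding eq by blast
  qed
  show "E \<subseteq> hub E f" unfolding hub_def by blast
  show "hub E f \<subseteq> V" using F(3) E(1) arc_subset[of V E] unfolding hub_def by blast
qed

text \<open>This localizes refinement to a single arc. The bound on \<open>card B\<close> excludes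
  \<open>{v}\<close>, which lies in the hub even if \<open>f v\<close> has no block at
  \<open>v\<close>.\<close>

private lemma glue_above_iff:
  assumes "f \<in> PiE E (\<lambda>v. nc_families d (W v))" "v \<in> E" "B \<subseteq> W v" "2 \<le> card B"
  shows "(\<exists>C\<in>glue E f. B \<subseteq> C) \<longleftrightarrow> (\<exists>C\<in>f v. B \<subseteq> C)"
proof
  assume "\<exists>C\<in>glue E f. B \<subseteq> C"
  then obtain C where C: "C \<in> glue E f" "B \<subseteq> C" by blast
  show "\<exists>C\<in>f v. B \<subseteq> C"
  proof (cases "C = hub E f")
    case True
    then have sub: "B \<subseteq> hub E f \<inter> W v" using C assms by blast
    have "hub E f \<inter> W v \<noteq> {v}" using card_mono[OF _ sub] assms(4) by auto
    then show ?thesis using glueD(5)[OF assms(1,2)] sub by blast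
  next
    case False
    then obtain u where u: "u \<in> E" "C \<in> f u" using C unfolding glue_def by blast
    have "C \<subseteq> W u" using glueD(3)[OF assms(1) u] .
    moreover obtain x where "x \<in> B" using assms(4) by fastforce
    ultimately have "u = v" using W_eq C(2) assms(3) by blast
    then show ?thesis using u C by blast
  qed
next
  assume "\<exists>C\<in>f v. B \<subseteq> C"
  then obtain C where C: "C \<in> f v" "B \<subseteq> C" by blast
  show "\<exists>C\<in>glue E f. B \<subseteq> C"
  proof (cases "v \<in> C")
    case True
    then have "C \<subseteq> hub E f" using C assms(2) unfolding hub_def by blast
    then show ?thesis using C unfolding glue_def by blast
  qed (use C assms(2) in \<open>unfold glue_def, blast\<close>)
qed

private lemma glue_le_iff:
  assumes f: "f \<in> PiE E (\<lambda>v. nc_families d (W v))" and h: "h \<in> PiE E (\<lambda>v. nc_families d (W v))"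
  shows "fam_le (glue E f) (glue E h) \<longleftrightarrow> (\<forall>v\<in>E. fam_le (f v) (h v))"
proof
  assume L: "fam_le (glue E f) (glue E h)"
  show "\<forall>v\<in>E. fam_le (f v) (h v)"
    unfolding fam_le_def
  proof (intro ballI)
    fix v B assume v: "v \<in> E" and B: "B \<in> f v"
    have B': "B \<subseteq> W v" "2 \<le> card B" using nc_familyD[OF glueD(1)[OF f v]] B by auto
    have "\<exists>C\<in>glue E f. B \<subseteq> C" unfolding glue_above_iff[OF f v B'] using B by blast
    then have "\<exists>C\<in>glue E h. B \<subseteq> C" using L unfolding fam_le_def by (meson order_trans)
    then show "\<exists>C\<in>h v. B \<subseteq> C" unfolding glue_above_iff[OF h v B'] .
  qed
next
  assume R: "\<forall>v\<in>E. fam_le (f v) (h v)"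
  have "hub E f \<subseteq> hub E h"
  proof
    fix x assume "x \<in> hub E f"
    then obtain v where v: "v \<in> E" "x = v \<or> (\<exists>B\<in>f v. v \<in> B \<and> x \<in> B)" unfolding hub_def by blast
    then have "x = v \<or> (\<exists>B\<in>h v. v \<in> B \<and> x \<in> B)" using R unfolding fam_le_def by (meson subsetD)
    then show "x \<in> hub E h" using v unfolding hub_def by blast
  qed
  moreover have "\<exists>C\<in>glue E h. B \<subseteq> C" if v: "v \<in> E" and B: "B \<in> f v" for v B
  proof -
    have B': "B \<subseteq> W v" "2 \<le> card B" using nc_familyD[OF glueD(1)[OF f v]] B by auto
    show ?thesis unfolding glue_above_iff[OF h v B'] using R v B unfolding fam_le_def by blast
  qed
  moreover have "hub E h \<in> glue E h" by (simp add: glue_def)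
  ultimately show "fam_le (glue E f) (glue E h)" unfolding fam_le_def glue_def[of E f] by blast
qed

private lemma glue_mem:
  assumes f: "f \<in> PiE E (\<lambda>v. nc_families d (W v))"
  shows "glue E f \<in> nc_families d V"
proof -
  note F = glueD[OF f]
  let ?X = "hub E f"
  have ne: "E \<noteq> {}" using E(2) by auto
  then obtain v0 where v0: "v0 \<in> E" by blast
  have X: "E \<subseteq> ?X" "?X \<subseteq> V" using F(6,7)[OF v0] by auto
  have finX: "finite ?X" using X(2) V(1) finite_subset by blast
  have out: "cyclic_pred B x = cyclic_pred B v" if "v \<in> E" "B \<in> f v" "v \<notin> B" "x \<in> V" "x \<notin> W v" for B x v
    using arc_within_arc(1)[OF V(1) E(1) that(1) F(3)[OF that(1,2)] that(3) nc_familyD(3)[OF F(1)[OF that(1)] that(2)], of x] that by blast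
  \<comment> \<open>Within \<open>W v\<close> the hub is \<open>{v}\<close> or a block of
    \<open>f v\<close> other than \<open>B\<close>; the points outside \<open>W v\<close> lie in the
    same arc of \<open>B\<close> as \<open>v\<close>.\<close>
  have XB: "?X \<inter> B = {} \<and> within_arc B ?X" if v: "v \<in> E" and B: "B \<in> f v" "v \<notin> B" for v B
  proof -
    have BW: "B \<subseteq> W v" by (rule F(3)[OF v B(1)])
    have fin: "finite (W v)" by (rule finite_arc[OF V(1)])
    have d: "?X \<inter> W v \<inter> B = {} \<and> (\<forall>x\<in>?X \<inter> W v. cyclic_pred B x = cyclic_pred B v)"
    proof (cases "?X \<inter> W v = {v}")
      case True
      then show ?thesis using B by simp
    next
      case False
      then have H: "?X \<inter> W v \<in> f v" using F(5)[OF v] by blast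
      have vX: "v \<in> ?X \<inter> W v" using F(4)[OF v] by blast
      then have neq: "?X \<inter> W v \<noteq> B" using B by blast
      have "within_arc B (?X \<inter> W v)"
        by (rule nc_family_within_arc[OF fin F(1)[OF v] B(1) H]) (use neq in blast)
      then have "\<forall>x\<in>?X \<inter> W v. cyclic_pred B x = cyclic_pred B v" using vX within_arcD by blast
      then show ?thesis using nc_familyD(4)[OF F(1)[OF v] H B(1) neq] by blast
    qed
    have "cyclic_pred B x = cyclic_pred B v" if "x \<in> ?X" for x
      using d out[OF v B, of x] that X(2) by blast
    then show ?thesis using d BW by (auto simp: within_arc_def)
  qed
  have BC: "B \<inter> C = {} \<and> \<not> crosses B C"
    if uv: "u \<in> E" "v \<in> E" "B \<in> f u" "C \<in> f v" "u \<notin> B" "v \<notin> C" "B \<noteq> C" for u v B C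
  proof (cases "u = v")
    case True
    then show ?thesis using nc_familyD(4,5)[OF F(1)[OF uv(1)], of B C] uv True by blast
  next
    case False
    have sub: "B \<subseteq> W u" "C \<subseteq> W v" using F(3) uv by blast+
    have n: "x \<notin> W u" if "x \<in> C" for x using sub that W_eq False uv by blast
    then have "cyclic_pred B x = cyclic_pred B u" if "x \<in> C" for x
      using out[OF uv(1,3,5), of x] sub(2) arc_subset[of V E v] n[OF that] that by blast
    then have "within_arc B C" by (simp add: within_arc_def)
    then show ?thesis
      using within_arc_not_crosses[OF finite_subset[OF sub(1) finite_arc[OF V(1)]]] n sub by blast
  qed
  have mem: "B = ?X \<or> (\<exists>v\<in>E. B \<in> f v \<and> v \<notin> B)" if "B \<in> glue E f" for B
    using that unfolding glue_def by blast
  have "nc_family V (glue E f)"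
  proof (rule nc_familyI)
    fix B assume B: "B \<in> glue E f"
    show "B \<subseteq> V" using mem[OF B] X(2) F(3) arc_subset[of V E] by blast
    show "2 \<le> card B" using mem[OF B] card_mono[OF finX X(1)] E(2) nc_familyD(2)[OF F(1)] by (meson order_trans)
    fix C assume C: "C \<in> glue E f" "B \<noteq> C"
    have fin: "finite D" if "v \<in> E" "D \<in> f v" for D v using F(3)[OF that] finite_arc[OF V(1)] finite_subset by blast
    show "B \<inter> C = {}" using mem[OF B] mem[OF C(1)] C(2) BC XB by (metis inf_commute)
    show "\<not> crosses B C" using mem[OF B] mem[OF C(1)] C(2) BC XB within_arc_not_crosses fin by metis
  qed
  moreover have "good d V B" if B: "B \<in> glue E f" for B
  proof (cases "B = ?X")
    case True
    have "good d (W v) (?X \<inter> W v)" if v: "v \<in> E" for v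
    proof -
      have "good d (W v) {v}" using W_card(1)[OF v] by (simp add: good_def)
      then show ?thesis using F(5)[OF v] F(2)[OF v] by metis
    qed
    then show ?thesis unfolding True good_superset[OF V(1) X ne] by blast
  next
    case False
    then obtain v where v: "v \<in> E" "B \<in> f v" "v \<notin> B" using mem[OF B] by blast
    show ?thesis
      using good_arc[OF V(1) E(1) v(1) F(3)[OF v(1,2)] v(3) W_card(2)[OF v(1)]] F(2)[OF v(1,2)] by blast
  qed
  ultimately show ?thesis by (simp add: nc_families_def)
qed

text \<open>Only the block \<open>X\<close> that contains \<open>E\<close> can be cut by the arcs.
  Any other block lies in one arc of \<open>X\<close>, hence in one arc of \<open>E\<close>, and
  misses the vertex of that arc since it is disjoint from \<open>X\<close>.\<close>

private lemma glue_surj: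
  assumes K: "K \<in> nc_families d V" and X: "X \<in> K" "E \<subseteq> X"
  shows "K \<in> glue E ` PiE E (\<lambda>v. nc_families d (W v))"
proof -
  note K' = nc_familyD[OF nc_familiesD(1)[OF K]]
  have finE: "finite E" and ne: "E \<noteq> {}" using E(2) V(1) E(1) finite_subset by (auto intro: finite_subset)
  \<comment> \<open>Traces of the blocks on an arc; those with fewer than two elements are empty or
    singleton blocks, which families do not list.\<close>
  let ?t = "\<lambda>v. {C. \<exists>B\<in>K. C = B \<inter> W v \<and> 2 \<le> card C}"
  let ?f = "restrict ?t E"
  have arcE: "\<exists>v\<in>E. B \<subseteq> W v \<and> v \<notin> B" if B: "B \<in> K" "B \<noteq> X" for B
  proof -
    have wX: "within_arc X B" by (rule nc_family_within_arc[OF V(1) nc_familiesD(1)[OF K] X(1) B(1)]) (use B in blast)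
    have "cyclic_pred E x = cyclic_pred E (cyclic_pred X x)" for x
      by (rule cyclic_pred_subset[symmetric]) (use X(2) finite_subset[OF K'(1)[OF X(1)] V(1)] ne in auto)
    then have "within_arc E B" using wX unfolding within_arc_def by metis
    then obtain v where "v \<in> E" "B \<subseteq> W v" using within_arc_iff[OF V(1) E(1) ne K'(1)[OF B(1)] K'(3)[OF B(1)]] by blast
    then show ?thesis using K'(4)[OF B(1) X(1) B(2)] X(2) by blast
  qed
  have other: "B \<inter> W v = B \<and> v \<notin> B" if B: "B \<in> K" "B \<noteq> X" "v \<in> E" "2 \<le> card (B \<inter> W v)" for B v
  proof -
    obtain u where u: "u \<in> E" "B \<subseteq> W u" "u \<notin> B" using arcE[OF B(1,2)] by blast
    have "B \<inter> W v \<noteq> {}" using B(4) by auto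
    then obtain x where "x \<in> B \<inter> W v" by blast
    then have "u = v" using u W_eq by blast
    then show ?thesis using u by blast
  qed
  have f: "?f \<in> PiE E (\<lambda>v. nc_families d (W v))"
  proof (rule restrict_PiE_iff[THEN iffD2], intro ballI)
    fix v assume v: "v \<in> E"
    have "nc_family (W v) (?t v)"
    proof (rule nc_familyI)
      fix C D assume C: "C \<in> ?t v" and D: "D \<in> ?t v" and CD: "C \<noteq> D"
      obtain B where B: "B \<in> K" "C = B \<inter> W v" using C by blast
      obtain B' where B': "B' \<in> K" "D = B' \<inter> W v" using D by blast
      have "B \<noteq> B'" using CD B B' by blast
      then show "C \<inter> D = {}" "\<not> crosses C D"
        using K'(4,5)[OF B(1) B'(1)] crosses_mono[of C D B B'] B B' by blast+
    qed blast+
    moreover have "good d (W v) C" if C: "C \<in> ?t v" for C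
    proof -
      obtain B where B: "B \<in> K" "C = B \<inter> W v" "2 \<le> card C" using C by blast
      show ?thesis
      proof (cases "B = X")
        case True
        then show ?thesis
          using good_superset[OF V(1) X(2) K'(1)[OF X(1)] ne, of d] nc_familiesD(2)[OF K X(1)] v B(2) by blast
      next
        case False
        have o: "B \<inter> W v = B \<and> v \<notin> B" by (rule other[OF B(1) False v]) (use B in blast)
        then have "C = B" "B \<subseteq> W v" "v \<notin> B" using B by blast+
        then show ?thesis using good_arc[OF V(1) E(1) v _ _ W_card(2)[OF v], of B] nc_familiesD(2)[OF K B(1)] by blast
      qed
    qed
    ultimately show "?t v \<in> nc_families d (W v)" by (simp add: nc_families_def)
  qed
  have XW: "X \<inter> W v = insert v (\<Union>{C \<in> ?t v. v \<in> C})" if v: "v \<in> E" for v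
  proof (intro equalityI subsetI)
    fix x assume x: "x \<in> X \<inter> W v"
    have vX: "v \<in> X \<inter> W v" using v X mem_arc[OF V(1) E(1) v] by blast
    show "x \<in> insert v (\<Union>{C \<in> ?t v. v \<in> C})"
    proof (cases "x = v")
      case False
      have "card {x, v} \<le> card (X \<inter> W v)" by (rule card_mono) (use x vX finite_arc[OF V(1)] in auto)
      then have "2 \<le> card (X \<inter> W v)" using False by simp
      then show ?thesis using X(1) x vX by blast
    qed simp
  next
    fix x assume x: "x \<in> insert v (\<Union>{C \<in> ?t v. v \<in> C})"
    have vX: "v \<in> X \<inter> W v" using v X mem_arc[OF V(1) E(1) v] by blast
    show "x \<in> X \<inter> W v"
    proof (cases "x = v")
      case False
      then obtain B where B: "B \<in> K" "x \<in> B \<inter> W v" "v \<in> B" using x by blast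
      then have "B = X" using K'(4)[OF B(1) X(1)] vX by blast
      then show ?thesis using B by blast
    qed (use vX in simp)
  qed
  have "hub E ?f = (\<Union>v\<in>E. X \<inter> W v)" unfolding hub_def using XW by simp
  also have "\<dots> = X" using UN_arc[OF V(1) E(1) ne] K'(1)[OF X(1)] by blast
  finally have hX: "hub E ?f = X" .
  have "(\<Union>v\<in>E. {B \<in> ?f v. v \<notin> B}) = K - {X}"
  proof (intro equalityI subsetI)
    fix C assume "C \<in> (\<Union>v\<in>E. {B \<in> ?f v. v \<notin> B})"
    then obtain v B where v: "v \<in> E" "v \<notin> C" "B \<in> K" "C = B \<inter> W v" "2 \<le> card C" by auto
    have "B \<noteq> X" using v X mem_arc[OF V(1) E(1) v(1)] by blast
    moreover have "C = B" using other[OF v(3) calculation v(1)] v by simp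
    ultimately show "C \<in> K - {X}" using v by blast
  next
    fix B assume B: "B \<in> K - {X}"
    then obtain v where v: "v \<in> E" "B \<subseteq> W v" "v \<notin> B" using arcE by blast
    then have "B \<in> ?t v" using B K'(2)[of B] by (auto simp: inf_absorb1)
    then show "B \<in> (\<Union>v\<in>E. {B \<in> ?f v. v \<notin> B})" using v by auto
  qed
  then have "glue E ?f = K" unfolding glue_def hX using X by blast
  then show ?thesis using f by blast
qed

text \<open>Since the hub contains \<open>E\<close>, lying above \<open>M\<close> is a condition on
  the other blocks of \<open>M\<close>, and each of them is inside one arc of
  \<open>E\<close>.\<close>

lemma iso_class_upper_interval_step:
  assumes "M \<in> nc_families d V" "E \<in> M"
  shows "iso_class (fam_order (upper_families d V M)) =
    (\<Sum>v\<in>E. iso_class (fam_order (upper_families d (arc V E v) (inside M (arc V E v)))))"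
proof (rule iso_class_fam_order_product[where g = "glue E"])
  note M = nc_familyD[OF nc_familiesD(1)[OF assms(1)]]
  let ?U = "\<lambda>v. upper_families d (W v) (inside M (W v))"
  show "finite E" using V(1) E(1) finite_subset by blast
  show "bounded_poset (fam_order (?U v))" if "v \<in> E" for v
    by (rule bounded_poset_upper_families[OF finite_arc[OF V(1)] nc_families_inside_arc[OF V(1) assms(1) V(2) assms(2) that]])
  have PiE: "f \<in> PiE E (\<lambda>v. nc_families d (W v))" if "f \<in> PiE E ?U" for f
    using that by (auto simp: PiE_iff upper_families_def)
  show "fam_le (glue E f) (glue E h) \<longleftrightarrow> (\<forall>v\<in>E. fam_le (f v) (h v))" if "f \<in> PiE E ?U" "h \<in> PiE E ?U" for f h
    by (rule glue_le_iff[OF PiE[OF that(1)] PiE[OF that(2)]])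
  have le: "fam_le M (glue E f) \<longleftrightarrow> (\<forall>v\<in>E. fam_le (inside M (W v)) (f v))"
    if f: "f \<in> PiE E (\<lambda>v. nc_families d (W v))" for f
  proof -
    have "\<exists>C\<in>glue E f. E \<subseteq> C" unfolding glue_def hub_def by blast
    then have "fam_le M (glue E f) \<longleftrightarrow> (\<forall>v\<in>E. \<forall>B\<in>inside M (W v). \<exists>C\<in>glue E f. B \<subseteq> C)"
      unfolding fam_le_def by (subst nc_family_decompose[OF V(1) nc_familiesD(1)[OF assms(1)] assms(2)]) blast
    also have "\<dots> \<longleftrightarrow> (\<forall>v\<in>E. \<forall>B\<in>inside M (W v). \<exists>C\<in>f v. B \<subseteq> C)"
      using glue_above_iff[OF f] M(2) by (auto simp: inside_def)
    finally show ?thesis unfolding fam_le_def .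
  qed
  show "glue E ` PiE E ?U = upper_families d V M"
  proof (intro equalityI subsetI)
    fix K assume "K \<in> glue E ` PiE E ?U"
    then obtain f where f: "f \<in> PiE E ?U" "K = glue E f" by blast
    then show "K \<in> upper_families d V M"
      using glue_mem[OF PiE[OF f(1)]] le[OF PiE[OF f(1)]] by (auto simp: upper_families_def PiE_iff)
  next
    fix K assume K: "K \<in> upper_families d V M"
    then obtain X where "X \<in> K" "E \<subseteq> X" using assms(2) unfolding upper_families_def fam_le_def by blast
    then obtain f where f: "f \<in> PiE E (\<lambda>v. nc_families d (W v))" "K = glue E f"
      using glue_surj[of K X] K unfolding upper_families_def by blast
    then have "f \<in> PiE E ?U" using le[OF f(1)] K by (auto simp: upper_families_def PiE_iff)
    then show "K \<in> glue E ` PiE E ?U" using f by blast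
  qed
qed

end

section \<open>Combinatorics of noncrossing hypertrees\<close>

section \<open>Connected hypergraphs and hypertrees\<close>

text \<open>Together with its converse \<open>hyper_connectedI\<close> this trades paths for closed
  vertex sets: no path leads out of a set that contains every edge it meets.\<close>

lemma hyper_connectedD:
  assumes "hyper_connected V T" "U \<subseteq> V" "U \<noteq> {}" "\<And>F. F \<in> T \<Longrightarrow> F \<inter> U \<noteq> {} \<Longrightarrow> F \<subseteq> U"
  shows "U = V"
proof -
  obtain u where u: "u \<in> U" using assms(3) by blast
  have path: "last Es \<subseteq> U" if "Es \<noteq> []" "set Es \<subseteq> T" "hd Es \<inter> U \<noteq> {}" "successively (\<lambda>E F. E \<inter> F \<noteq> {}) Es" for Es
    using that
  proof (induction Es)
    case (Cons E Es)
    then have E: "E \<subseteq> U" using assms(4)[of E] by auto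
    show ?case
    proof (cases "Es = []")
      case False
      then have "hd Es \<inter> U \<noteq> {}" using Cons.prems E by (auto simp: successively_Cons)
      then show ?thesis using Cons False by (auto simp: successively_Cons)
    qed (use E in simp)
  qed simp
  have "v \<in> U" if v: "v \<in> V" for v
  proof (cases "u = v")
    case False
    then obtain Es where "Es \<noteq> []" "set Es \<subseteq> T" "u \<in> hd Es" "v \<in> last Es" "successively (\<lambda>E F. E \<inter> F \<noteq> {}) Es"
      using assms(1,2) u v unfolding hyper_connected_def by blast
    then show ?thesis using path[of Es] u by blast
  qed (use u in simp)
  then show ?thesis using assms(2) by blast
qed

lemma hyper_connectedI:
  assumes "\<And>F. F \<in> T \<Longrightarrow> F \<subseteq> V"
    and cut: "\<And>U. U \<subseteq> V \<Longrightarrow> U \<noteq> {} \<Longrightarrow> (\<And>F. F \<in> T \<Longrightarrow> F \<inter> U \<noteq> {} \<Longrightarrow> F \<subseteq> U) \<Longrightarrow> U = V"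
  shows "hyper_connected V T"
  unfolding hyper_connected_def
proof (intro ballI impI)
  fix u v assume uv: "u \<in> V" "v \<in> V" "u \<noteq> v"
  define P where "P = (\<lambda>w. \<exists>Es. Es \<noteq> [] \<and> set Es \<subseteq> T \<and> u \<in> hd Es \<and> w \<in> last Es \<and> successively (\<lambda>E F. E \<inter> F \<noteq> {}) Es)"
  have "{w \<in> V. w = u \<or> P w} = V"
  proof (rule cut)
    fix F assume F: "F \<in> T" "F \<inter> {w \<in> V. w = u \<or> P w} \<noteq> {}"
    then obtain w where w: "w \<in> F" "w = u \<or> P w" by blast
    have "P x" if x: "x \<in> F" for x
    proof (cases "w = u")
      case True
      then show ?thesis unfolding P_def using F w x by (intro exI[of _ "[F]"]) auto
    next
      case False
      then obtain Es where Es: "Es \<noteq> []" "set Es \<subseteq> T" "u \<in> hd Es" "w \<in> last Es" "successively (\<lambda>E F. E \<inter> F \<noteq> {}) Es"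
        using w unfolding P_def by blast
      have "last Es \<inter> F \<noteq> {}" using Es w by blast
      then show ?thesis unfolding P_def using Es F x by (intro exI[of _ "Es @ [F]"]) (simp add: successively_append_iff)
    qed
    then show "F \<subseteq> {w \<in> V. w = u \<or> P w}" using assms(1)[OF F(1)] by blast
  qed (use uv in auto)
  then have "v \<in> {w \<in> V. w = u \<or> P w}" using uv(2) by (simp only:)
  then have "P v" using uv(3) by blast
  then show "\<exists>Es. Es \<noteq> [] \<and> set Es \<subseteq> T \<and> u \<in> hd Es \<and> v \<in> last Es \<and> successively (\<lambda>E F. E \<inter> F \<noteq> {}) Es"
    unfolding P_def .
qed

text \<open>Take a largest proper subfamily that is connected on its own vertices. By connectedness
  of the whole some other edge \<open>F\<close> meets it; adding \<open>F\<close> keeps it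
  connected, so by maximality only \<open>F\<close> was missing.\<close>

lemma connected_remove_edge:
  assumes "finite T" "T \<noteq> {}" "hyper_connected V T" "\<And>F. F \<in> T \<Longrightarrow> F \<subseteq> V \<and> F \<noteq> {}"
  obtains F where "F \<in> T" "T = {F} \<or> hyper_connected (\<Union>(T - {F})) (T - {F}) \<and> F \<inter> \<Union>(T - {F}) \<noteq> {}"
proof (cases "\<exists>F. T = {F}")
  case False
  define S where "S = {T'. T' \<subset> T \<and> T' \<noteq> {} \<and> hyper_connected (\<Union>T') T'}"
  obtain E where E: "E \<in> T" using assms(2) by blast
  have "hyper_connected E {E}" by (rule hyper_connectedI) auto
  then have "{E} \<in> S" using E False by (auto simp: S_def)
  moreover have fin: "finite S" by (rule finite_subset[of _ "Pow T"]) (use assms(1) in \<open>auto simp: S_def\<close>)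
  ultimately have "Max (card ` S) \<in> card ` S" by (intro Max_in) blast+
  then obtain T' where T': "T' \<in> S" "card T' = Max (card ` S)" by (metis (no_types, lifting) imageE)
  then have T'_props: "T' \<subset> T" "T' \<noteq> {}" "hyper_connected (\<Union>T') T'" by (simp_all add: S_def)
  have max: "card X \<le> card T'" if "X \<in> S" for X
    unfolding T'(2) by (rule Max_ge) (use fin that in blast)+
  have "\<exists>F\<in>T - T'. F \<inter> \<Union>T' \<noteq> {}"
  proof (rule ccontr)
    assume n: "\<not> ?thesis"
    have "\<Union>T' = V"
    proof (rule hyper_connectedD[OF assms(3)])
      show "\<Union>T' \<subseteq> V" using T'_props(1) assms(4) by blast
      obtain G where "G \<in> T'" using T'_props(2) by blast
      then show "\<Union>T' \<noteq> {}" using T'_props(1) assms(4)[of G] by blast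
      fix F assume F: "F \<in> T" "F \<inter> \<Union>T' \<noteq> {}"
      then have "F \<in> T'" using n by blast
      then show "F \<subseteq> \<Union>T'" by blast
    qed
    moreover obtain F where "F \<in> T - T'" using T'_props(1) by blast
    ultimately show False using n assms(4)[of F] by blast
  qed
  then obtain F where F: "F \<in> T" "F \<notin> T'" "F \<inter> \<Union>T' \<noteq> {}" by blast
  have con: "hyper_connected (\<Union>(insert F T')) (insert F T')"
  proof (rule hyper_connectedI)
    fix U assume U: "U \<subseteq> \<Union>(insert F T')" "U \<noteq> {}" "\<And>G. G \<in> insert F T' \<Longrightarrow> G \<inter> U \<noteq> {} \<Longrightarrow> G \<subseteq> U"
    have "U \<inter> \<Union>T' \<noteq> {}"
    proof
      assume e: "U \<inter> \<Union>T' = {}"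
      then have "F \<inter> U \<noteq> {}" using U(1,2) by blast
      then show False using U(3)[of F] e F(3) by blast
    qed
    have "U \<inter> \<Union>T' = \<Union>T'"
    proof (rule hyper_connectedD)
      show "hyper_connected (\<Union>T') T'" by (rule T'_props(3))
    qed (use U(3) \<open>U \<inter> \<Union>T' \<noteq> {}\<close> in blast)+
    then have "F \<subseteq> U" using U(3)[of F] F(3) by blast
    then show "U = \<Union>(insert F T')" using U(1) \<open>U \<inter> \<Union>T' = \<Union>T'\<close> by blast
  qed blast
  have "insert F T' = T"
  proof (rule ccontr)
    assume "insert F T' \<noteq> T"
    then have "insert F T' \<in> S" using F T'_props con unfolding S_def by blast
    moreover have "finite T'" using T'_props(1) assms(1) finite_subset by blast
    ultimately show False using max[of "insert F T'"] F(2) by simp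
  qed
  then have "T - {F} = T'" using F(2) by blast
  then show ?thesis using that[of F] F T'_props(3) by blast
qed (use that in blast)

text \<open>An edge removed as in \<open>connected_remove_edge\<close> meets the rest in at least
  one vertex and so accounts for at most \<open>card F - 1\<close> new ones. Hypertrees are the case
  of equality.\<close>

lemma connected_card:
  assumes "finite T" "finite V" "hyper_connected V T" "\<And>F. F \<in> T \<Longrightarrow> F \<subseteq> V \<and> F \<noteq> {}"
  shows "int (card V) - 1 \<le> (\<Sum>F\<in>T. int (card F) - 1)"
  using assms
proof (induction "card T" arbitrary: T V)
  case 0
  then have T: "T = {}" by simp
  show ?case
  proof (cases "V = {}")
    case False
    then obtain u where u: "u \<in> V" by blast
    have "{u} = V" by (rule hyper_connectedD[OF 0(4)]) (use u T in auto)
    then show ?thesis using T by auto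
  qed (use T in simp)
next
  case (Suc n)
  then have ne: "T \<noteq> {}" by auto
  have nonneg: "0 \<le> int (card F) - 1" if "F \<in> T" for F
    using Suc.prems(4)[OF that] finite_subset[OF _ Suc.prems(2)] card_gt_0_iff[of F] by (auto simp: int_one_le_iff_zero_less)
  have V: "V = \<Union>T"
  proof (rule sym, rule hyper_connectedD[OF Suc.prems(3)])
    show "\<Union>T \<noteq> {}" using ne Suc.prems(4) by blast
  qed (use Suc.prems(4) in blast)+
  obtain F where F: "F \<in> T" "T = {F} \<or> hyper_connected (\<Union>(T - {F})) (T - {F}) \<and> F \<inter> \<Union>(T - {F}) \<noteq> {}"
    using connected_remove_edge[OF Suc.prems(1) ne Suc.prems(3,4)] by metis
  show ?case
  proof (cases "T = {F}")
    case True
    then show ?thesis using V by simp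
  next
    case False
    let ?V' = "\<Union>(T - {F})"
    have F': "hyper_connected ?V' (T - {F})" "F \<inter> ?V' \<noteq> {}" using F(2) False by auto
    have sub: "?V' \<subseteq> V" and VF: "V = ?V' \<union> F" using V F(1) by blast+
    have "F \<subseteq> V" using Suc.prems(4)[OF F(1)] by blast
    then have fin: "finite ?V'" "finite F" using finite_subset[OF sub Suc.prems(2)] finite_subset[OF _ Suc.prems(2)] by simp_all
    have "int (card ?V') - 1 \<le> (\<Sum>G\<in>T - {F}. int (card G) - 1)"
      by (rule Suc.hyps(1)) (use Suc.hyps(2) Suc.prems F F' fin in auto)
    moreover have "card V + card (F \<inter> ?V') = card ?V' + card F"
      unfolding VF using card_Un_Int[OF fin] by (simp add: Int_commute)
    moreover have "card (F \<inter> ?V') \<ge> 1" using F'(2) fin by (simp add: Suc_le_eq card_gt_0_iff)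
    moreover have "(\<Sum>G\<in>T. int (card G) - 1) = (int (card F) - 1) + (\<Sum>G\<in>T - {F}. int (card G) - 1)"
      by (rule sum.remove[OF Suc.prems(1) F(1)])
    ultimately show ?thesis by linarith
  qed
qed

lemma hypertreeD:
  assumes "hypertree V T"
  shows "F \<in> T \<Longrightarrow> F \<subseteq> V" "F \<in> T \<Longrightarrow> 2 \<le> card F" "F \<in> T \<Longrightarrow> F \<noteq> {}" "hyper_connected V T"
    "(\<Sum>F\<in>T. int (card F) - 1) = int (card V) - 1"
  using assms unfolding hypertree_def hypergraph_def by auto

lemma finite_hypertree: "finite V \<Longrightarrow> hypertree V T \<Longrightarrow> finite T"
  by (rule finite_subset[of _ "Pow V"]) (auto dest: hypertreeD)

text \<open>Equality in \<open>connected_card\<close> leaves no slack when an edge is removed: the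
  rest attains equality too, and the edge meets it in exactly one vertex.\<close>

lemma hypertree_leaf:
  assumes "finite V" "hypertree V T" "T \<noteq> {}"
  obtains L where "T = {L}"
  | L v where "L \<in> T" "hypertree (\<Union>(T - {L})) (T - {L})" "L \<inter> \<Union>(T - {L}) = {v}"
proof -
  note T = hypertreeD[OF assms(2)]
  have finT: "finite T" by (rule finite_hypertree[OF assms(1,2)])
  have V: "V = \<Union>T"
  proof (rule sym, rule hyper_connectedD[OF T(4)])
    show "\<Union>T \<noteq> {}" using assms(3) T(3) by blast
  qed (use T(1) in blast)+
  obtain F where F: "F \<in> T" "T = {F} \<or> hyper_connected (\<Union>(T - {F})) (T - {F}) \<and> F \<inter> \<Union>(T - {F}) \<noteq> {}"
    using connected_remove_edge[OF finT assms(3) T(4)] T(1,3) by metis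
  show ?thesis
  proof (cases "T = {F}")
    case False
    let ?V' = "\<Union>(T - {F})"
    have F': "hyper_connected ?V' (T - {F})" "F \<inter> ?V' \<noteq> {}" using F(2) False by auto
    have sub: "?V' \<subseteq> V" and VF: "V = ?V' \<union> F" using V F(1) by blast+
    have fin: "finite ?V'" "finite F" using finite_subset[OF sub assms(1)] finite_subset[OF T(1)[OF F(1)] assms(1)] .
    have 1: "int (card ?V') - 1 \<le> (\<Sum>G\<in>T - {F}. int (card G) - 1)"
      by (rule connected_card) (use finT fin F' T(3) in auto)
    have 2: "card V + card (F \<inter> ?V') = card ?V' + card F"
      unfolding VF using card_Un_Int[OF fin] by (simp add: Int_commute)
    have 3: "card (F \<inter> ?V') \<ge> 1" using F'(2) fin by (simp add: Suc_le_eq card_gt_0_iff)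
    have 4: "(\<Sum>G\<in>T. int (card G) - 1) = (int (card F) - 1) + (\<Sum>G\<in>T - {F}. int (card G) - 1)"
      by (rule sum.remove[OF finT F(1)])
    have "card (F \<inter> ?V') = 1" using 1 2 3 4 T(5) by linarith
    then obtain v where "F \<inter> ?V' = {v}" by (rule card_1_singletonE)
    moreover have "hypertree ?V' (T - {F})"
      unfolding hypertree_def hypergraph_def using F'(1) T(2) 1 2 3 4 T(5) by auto
    ultimately show ?thesis using that(2) F(1) by blast
  qed (rule that(1))
qed

section \<open>Minimal edges\<close>

text \<open>At every vertex, the edges of a noncrossing hypertree are linearly ordered by the direction in
  which they leave it; an edge is minimal if it comes first at each of its vertices.\<close>

definition min_edges :: "nat set set \<Rightarrow> nat set set" where
  "min_edges T = {E \<in> T. \<forall>F\<in>T. F \<noteq> E \<longrightarrow> within_arc E F}"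

lemma noncrossingD: "noncrossing T \<Longrightarrow> E \<in> T \<Longrightarrow> F \<in> T \<Longrightarrow> E \<noteq> F \<Longrightarrow> \<not> crosses E F"
  by (simp add: noncrossing_iff)

lemma noncrossing_subset: "noncrossing T \<Longrightarrow> S \<subseteq> T \<Longrightarrow> noncrossing S"
  unfolding noncrossing_iff by blast

lemma two_le_card_other:
  assumes "2 \<le> card E"
  shows "\<exists>e\<in>E. e \<noteq> v"
proof (rule ccontr)
  assume "\<not> ?thesis"
  then have "E \<subseteq> {v}" by blast
  then show False using card_mono[of "{v}" E] assms by simp
qed

text \<open>Let the leaf \<open>L\<close> be attached at \<open>v\<close> and let \<open>G\<close>
  be minimal in the rest. Either \<open>L\<close> lies in one arc of \<open>G\<close>, and
  \<open>G\<close> stays minimal; or \<open>G\<close> contains \<open>v\<close> and \<open>L\<close>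
  comes first there. In that case \<open>L\<close> is minimal: other edges at \<open>v\<close> come
  after \<open>G\<close>, hence after \<open>L\<close>, and edges that avoid \<open>v\<close> are
  disjoint from \<open>L\<close>.\<close>

lemma min_edges_nonempty:
  assumes "finite V" "hypertree V T" "noncrossing T" "T \<noteq> {}"
  shows "min_edges T \<noteq> {}"
  using assms
proof (induction "card T" arbitrary: T V rule: less_induct)
  case less
  note T = hypertreeD[OF less.prems(2)]
  have finT: "finite T" by (rule finite_hypertree[OF less.prems(1,2)])
  have fin: "finite F" if "F \<in> T" for F using T(1)[OF that] less.prems(1) finite_subset by blast
  from less.prems(1,2,4) show ?case
  proof (cases rule: hypertree_leaf)
    case (1 L)
    then have "L \<in> min_edges T" by (auto simp: min_edges_def)
    then show ?thesis by blast
  next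
    case (2 L v)
    let ?T = "T - {L}"
    have ne: "?T \<noteq> {}" using 2(3) by blast
    have "min_edges ?T \<noteq> {}"
    proof (rule less.hyps)
      show "card ?T < card T" using finT 2(1) by (meson card_Diff1_less)
      show "finite (\<Union>?T)" using finT fin by blast
    qed (use 2 ne noncrossing_subset[OF less.prems(3)] in auto)
    then obtain G where G: "G \<in> ?T" "\<And>F. F \<in> ?T \<Longrightarrow> F \<noteq> G \<Longrightarrow> within_arc G F"
      unfolding min_edges_def by blast
    have GL: "G \<in> T" "G \<noteq> L" using G(1) by auto
    have nc: "\<not> crosses F L" "\<not> crosses L F" if "F \<in> ?T" for F
      using noncrossingD[OF less.prems(3)] that 2(1) by blast+
    show ?thesis
    proof (cases "within_arc G L")
      case True
      then have "G \<in> min_edges T" using G GL unfolding min_edges_def by blast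
      then show ?thesis by blast
    next
      case False
      have "L \<inter> G \<noteq> {}"
        using disjoint_within_arc[OF fin[OF GL(1)] T(3)[OF GL(1)] _ nc[OF G(1)]] False by blast
      moreover have "L \<inter> G \<subseteq> L \<inter> \<Union>?T" using G(1) by blast
      ultimately have LG: "L \<inter> G = {v}" unfolding 2(3) by blast
      then have GL': "G \<inter> L = {v}" by (simp add: Int_commute)
      have w: "within_arc L G"
        using within_arc_common_vertex[OF fin[OF GL(1)] fin[OF 2(1)] GL' nc[OF G(1)]] False by blast
      obtain g where g: "g \<in> G" "g \<noteq> v" using two_le_card_other[OF T(2)[OF GL(1)]] by metis
      have v: "v \<in> L" "v \<in> G" using LG by blast+
      have "within_arc L F" if F: "F \<in> T" "F \<noteq> L" for F
      proof (cases "v \<in> F")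
        case False
        have "L \<inter> F \<subseteq> L \<inter> \<Union>?T" using F by blast
        then have "L \<inter> F = {}" unfolding 2(3) using False by blast
        then show ?thesis
          using disjoint_within_arc[OF fin[OF 2(1)] T(3)[OF 2(1)]] nc[of F] F by blast
      next
        case True
        show ?thesis
        proof (cases "F = G")
          case False
          then have GF: "within_arc G F" using G(2) F by blast
          have "cyclic_pred L x = v" if "x \<in> F" for x
          proof (rule within_arc_trans[OF fin[OF 2(1)] fin[OF GL(1)] w v g])
            show "cyclic_pred G x = v"
              using within_arcD[OF GF that True] cyclic_pred_self[OF fin[OF GL(1)] v(2)] by simp
          qed
          then show ?thesis by (simp add: within_arc_def)
        qed (use w in simp)
      qed
      then have "L \<in> min_edges T" using 2(1) by (auto simp: min_edges_def)
      then show ?thesis by blast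
    qed
  qed
qed

text \<open>Two edges with a common vertex \<open>v\<close> cannot each come first there: of two
  further vertices, one on each edge, one is met no later than the other on the way from
  \<open>v\<close>.\<close>

lemma min_edges_disjoint:
  assumes "finite E" "finite F" "2 \<le> card E" "2 \<le> card F" "within_arc E F" "within_arc F E"
  shows "E \<inter> F = {}"
proof (rule ccontr)
  assume "E \<inter> F \<noteq> {}"
  then obtain v where v: "v \<in> E" "v \<in> F" by blast
  obtain e f where ef: "e \<in> E" "e \<noteq> v" "f \<in> F" "f \<noteq> v"
    using two_le_card_other[OF assms(3)] two_le_card_other[OF assms(4)] by metis
  have "cyclic_pred E f = v" "cyclic_pred F e = v"
    using within_arcD[OF assms(5) ef(3) v(2)] within_arcD[OF assms(6) ef(1) v(1)]
      cyclic_pred_self[OF assms(1) v(1)] cyclic_pred_self[OF assms(2) v(2)] by simp_all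
  then have "\<not> cyclic_between v e f" "\<not> cyclic_between v f e"
    using cyclic_pred_not_between[OF assms(1) ef(1), of f] cyclic_pred_not_between[OF assms(2) ef(3), of e] by simp_all
  then show False using cyclic_between_total ef by blast
qed

lemma arcs_not_crosses:
  assumes "finite E" "u \<in> E" "v \<in> E" "u \<noteq> v"
  shows "\<not> crosses (arc V E u) (arc V E v)"
proof
  assume "crosses (arc V E u) (arc V E v)"
  then obtain i j k l where o: "i < j" "j < k" "k < l"
    and p: "cyclic_pred E i = u" "cyclic_pred E k = u" "cyclic_pred E j = v" "cyclic_pred E l = v"
    unfolding crosses_def arc_def by blast
  note n = cyclic_pred_not_between[OF assms(1)]
  have "\<not> cyclic_between u v i" "\<not> cyclic_between u v k" "\<not> cyclic_between v u j" "\<not> cyclic_between v u l"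
    using n[OF assms(3), of i] n[OF assms(3), of k] n[OF assms(2), of j] n[OF assms(2), of l] p by simp_all
  then show False using o assms(4) unfolding cyclic_between_def
    by (cases "u < v"; cases "u \<le> i"; cases "v \<le> j") auto
qed

section \<open>Splitting a hypertree at a minimal edge\<close>

lemma inside_subset: "inside T W \<subseteq> T"
  by (auto simp: inside_def)

context
  fixes V E :: "nat set"
  assumes V: "finite V" and E: "E \<subseteq> V" "2 \<le> card E"
begin

private lemma finE: "finite E"
  by (rule finite_subset[OF E(1) V])

private lemma neE: "E \<noteq> {}"
  using E(2) by auto

lemma sum_card_arc: "(\<Sum>v\<in>E. int (card (arc V E v)) - 1) = int (card V) - int (card E)"
proof -
  have "int (card V) = (\<Sum>v\<in>E. int (card (arc V E v)))"
    using card_eq_sum_arc[OF V E(1) neE] by simp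
  then show ?thesis by (simp add: sum_subtractf)
qed

lemma min_edge_decompose:
  assumes "\<And>F. F \<in> T \<Longrightarrow> F \<subseteq> V \<and> F \<noteq> {}" "E \<in> min_edges T"
  shows "T = insert E (\<Union>v\<in>E. inside T (arc V E v))"
proof -
  have "F \<in> (\<Union>v\<in>E. inside T (arc V E v))" if F: "F \<in> T" "F \<noteq> E" for F
    using within_arc_iff[OF V E(1) neE, of F] assms F by (auto simp: inside_def min_edges_def)
  then show ?thesis using assms(2) by (auto simp: inside_def min_edges_def)
qed

lemma sum_over_arcs:
  fixes g :: "nat set \<Rightarrow> 'a::comm_monoid_add"
  assumes "\<And>v F. v \<in> E \<Longrightarrow> F \<in> f v \<Longrightarrow> F \<subseteq> arc V E v \<and> F \<noteq> {}"
  shows "sum g (insert E (\<Union>v\<in>E. f v)) = g E + (\<Sum>v\<in>E. sum g (f v))"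
proof -
  have fin: "finite (f v)" if "v \<in> E" for v
    by (rule finite_subset[of _ "Pow (arc V E v)"]) (use assms[OF that] finite_arc[OF V] in auto)
  have "E \<notin> (\<Union>v\<in>E. f v)"
    using assms not_subset_arc[OF V order_refl E] by blast
  moreover have "sum g (\<Union>v\<in>E. f v) = (\<Sum>v\<in>E. sum g (f v))"
  proof (rule sum.UNION_disjoint)
    show "\<forall>u\<in>E. \<forall>v\<in>E. u \<noteq> v \<longrightarrow> f u \<inter> f v = {}"
      using assms arc_disjoint[of _ _ V E] by blast
  qed (use finE fin in auto)
  ultimately show ?thesis using finE fin by simp
qed

text \<open>Connectedness gives the inequality of \<open>connected_card\<close> on every arc. Summed
  over all arcs both sides agree, because \<open>T\<close> is a hypertree, so each inequality is an
  equality.\<close>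

lemma hypertree_inside_arc:
  assumes "hypertree V T" "E \<in> min_edges T" "v \<in> E"
  shows "hypertree (arc V E v) (inside T (arc V E v))"
proof -
  note T = hypertreeD[OF assms(1)]
  let ?W = "arc V E" and ?T = "\<lambda>v. inside T (arc V E v)"
  have dec: "T = insert E (\<Union>v\<in>E. ?T v)"
    by (rule min_edge_decompose) (use T assms in auto)
  have mem: "u \<in> ?W u" if "u \<in> E" for u by (rule mem_arc[OF V E(1) that])
  have con: "hyper_connected (?W u) (?T u)" if u: "u \<in> E" for u
  proof (rule hyper_connectedI)
    fix U assume U: "U \<subseteq> ?W u" "U \<noteq> {}" and cl: "\<And>F. F \<in> ?T u \<Longrightarrow> F \<inter> U \<noteq> {} \<Longrightarrow> F \<subseteq> U"
    show "U = ?W u"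
    \<comment> \<open>If \<open>U\<close> misses \<open>u\<close>, it is closed in all of
      \<open>V\<close>, which is impossible because \<open>u\<close> would lie in it. If
      \<open>U\<close> contains \<open>u\<close>, it becomes closed in \<open>V\<close> once
      everything outside the arc is added.\<close>
    proof (cases "u \<in> U")
      case False
      have "U = V"
      proof (rule hyper_connectedD[OF T(4) _ U(2)])
        show "U \<subseteq> V" using U(1) arc_subset by blast
        fix F assume F: "F \<in> T" "F \<inter> U \<noteq> {}"
        have "E \<inter> U \<subseteq> E \<inter> ?W u" using U(1) by blast
        then have "E \<inter> U = {}" unfolding Int_arc[OF V E(1) u] using False by blast
        then have "F \<noteq> E" using F(2) by blast
        then obtain w where w: "w \<in> E" "F \<in> ?T w" using dec F by blast
        then have "w = u" using F(2) U(1) arc_disjoint[of w u V E] unfolding inside_def by blast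
        then show "F \<subseteq> U" using cl w F by blast
      qed
      then show ?thesis using False u E(1) by blast
    next
      case True
      have "U \<union> (V - ?W u) = V"
      proof (rule hyper_connectedD[OF T(4)])
        show "U \<union> (V - ?W u) \<subseteq> V" using U(1) arc_subset by blast
        fix F assume F: "F \<in> T" "F \<inter> (U \<union> (V - ?W u)) \<noteq> {}"
        show "F \<subseteq> U \<union> (V - ?W u)"
        proof (cases "F = E")
          case True
          have "E \<inter> ?W u \<subseteq> U" unfolding Int_arc[OF V E(1) u] using \<open>u \<in> U\<close> by blast
          then show ?thesis unfolding True using E(1) by blast
        next
          case False
          then obtain w where w: "w \<in> E" "F \<in> ?T w" using dec F by blast
          show ?thesis
          proof (cases "w = u")
            case True
            then have Fu: "F \<in> ?T u" "F \<subseteq> ?W u" using w(2) by (simp_all add: inside_def)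
            then have "F \<inter> U \<noteq> {}" using F(2) by blast
            then show ?thesis using cl[OF Fu(1)] by blast
          next
            case False
            then have "?W w \<subseteq> V - ?W u" using arc_disjoint[of w u V E] arc_subset[of V E w] by blast
            then show ?thesis using w(2) unfolding inside_def by blast
          qed
        qed
      qed (use U(2) in blast)
      then show ?thesis using U(1) arc_subset[of V E u] by blast
    qed
  qed (simp add: inside_def)
  have finT: "finite T" by (rule finite_hypertree[OF V assms(1)])
  have le: "int (card (?W u)) - 1 \<le> (\<Sum>F\<in>?T u. int (card F) - 1)" if u: "u \<in> E" for u
    by (rule connected_card[OF finite_subset[OF inside_subset finT] finite_arc[OF V] con[OF u]])
      (use T(3) in \<open>auto simp: inside_def\<close>)
  have "(\<Sum>F\<in>T. int (card F) - 1) = int (card E) - 1 + (\<Sum>u\<in>E. \<Sum>F\<in>?T u. int (card F) - 1)"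
    by (subst dec, rule sum_over_arcs) (use T(3) in \<open>auto simp: inside_def\<close>)
  then have "(\<Sum>u\<in>E. \<Sum>F\<in>?T u. int (card F) - 1) = (\<Sum>u\<in>E. int (card (?W u)) - 1)"
    using T(5) sum_card_arc by simp
  then have "(\<Sum>F\<in>?T v. int (card F) - 1) = int (card (?W v)) - 1"
    using sum_mono_inv[of "\<lambda>u. int (card (?W u)) - 1" E "\<lambda>u. \<Sum>F\<in>?T u. int (card F) - 1" v] le assms(3) finE by simp
  then show ?thesis
    unfolding hypertree_def hypergraph_def using con[OF assms(3)] T(2) by (auto simp: inside_def)
qed

text \<open>A nonempty closed vertex set contains some arc, so a vertex of \<open>E\<close>, so
  \<open>E\<close>, so every arc. The edge counts add up by \<open>sum_card_arc\<close>.\<close>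

lemma hypertree_glue:
  assumes "\<And>v. v \<in> E \<Longrightarrow> hypertree (arc V E v) (f v)"
  shows "hypertree V (insert E (\<Union>v\<in>E. f v))" "v \<in> E \<Longrightarrow> inside (insert E (\<Union>v\<in>E. f v)) (arc V E v) = f v"
    "E \<in> min_edges (insert E (\<Union>v\<in>E. f v))"
proof -
  let ?T = "insert E (\<Union>v\<in>E. f v)"
  let ?W = "arc V E"
  note F = hypertreeD[OF assms]
  have mem: "u \<in> ?W u" if "u \<in> E" for u by (rule mem_arc[OF V E(1) that])
  have "hyper_connected V ?T"
  proof (rule hyper_connectedI)
    show "G \<subseteq> V" if "G \<in> ?T" for G using that F(1) arc_subset[of V E] E(1) by blast
    fix U assume U: "U \<subseteq> V" "U \<noteq> {}" and cl: "\<And>F. F \<in> ?T \<Longrightarrow> F \<inter> U \<noteq> {} \<Longrightarrow> F \<subseteq> U"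
    have arc: "?W u \<subseteq> U" if u: "u \<in> E" "U \<inter> ?W u \<noteq> {}" for u
    proof -
      have "U \<inter> ?W u = ?W u"
        by (rule hyper_connectedD[OF F(4)[OF u(1)]]) (use u cl F(1)[OF u(1)] in blast)+
      then show ?thesis by blast
    qed
    obtain u where u: "u \<in> E" "U \<inter> ?W u \<noteq> {}" using U UN_arc[OF V E(1) neE] by blast
    then have "u \<in> U" using arc mem by blast
    then have "E \<subseteq> U" using cl[of E] u(1) by blast
    then have "?W w \<subseteq> U" if "w \<in> E" for w using arc[OF that] mem[OF that] that by blast
    then show "U = V" using U UN_arc[OF V E(1) neE] by blast
  qed
  moreover have "(\<Sum>G\<in>?T. int (card G) - 1) = int (card V) - 1"
  proof -
    have "(\<Sum>G\<in>?T. int (card G) - 1) = int (card E) - 1 + (\<Sum>u\<in>E. \<Sum>G\<in>f u. int (card G) - 1)"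
      by (rule sum_over_arcs) (use F(1,3) in auto)
    also have "(\<Sum>u\<in>E. \<Sum>G\<in>f u. int (card G) - 1) = (\<Sum>u\<in>E. int (card (?W u)) - 1)"
      by (rule sum.cong) (use F(5) in auto)
    finally show ?thesis using sum_card_arc by simp
  qed
  moreover have "hypergraph V ?T"
    unfolding hypergraph_def using F(1,2) arc_subset[of V E] E by blast
  ultimately show "hypertree V ?T" by (simp add: hypertree_def)
  show "inside ?T (?W v) = f v" if v: "v \<in> E" for v
  proof (intro equalityI subsetI)
    fix G assume G: "G \<in> inside ?T (?W v)"
    then have "G \<noteq> E" using not_subset_arc[OF V order_refl E v] by (auto simp: inside_def)
    then obtain u where u: "u \<in> E" "G \<in> f u" using G by (auto simp: inside_def)
    then have "G \<subseteq> ?W u" "G \<noteq> {}" "G \<subseteq> ?W v" using F(1,3) G by (auto simp: inside_def)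
    then have "u = v" using arc_disjoint[of u v V E] by blast
    then show "G \<in> f v" using u by blast
  next
    fix G assume "G \<in> f v"
    then show "G \<in> inside ?T (?W v)" using v F(1) by (auto simp: inside_def)
  qed
  have "within_arc E G" if G: "G \<in> ?T" "G \<noteq> E" for G
  proof -
    obtain u where "u \<in> E" "G \<in> f u" using G by blast
    then show ?thesis using F(1,3)[of u] arc_subset[of V E u] within_arc_iff[OF V E(1) neE, of G] by blast
  qed
  then show "E \<in> min_edges ?T" unfolding min_edges_def by blast
qed

end

section \<open>The signed hypertree sum and its two recursions\<close>

section \<open>Signed sums over noncrossing hypertrees\<close>

definition nc_hypertrees :: "nat \<Rightarrow> nat set \<Rightarrow> nat set set set" where
  "nc_hypertrees d V = {T. hypertree V T \<and> noncrossing T \<and> (\<forall>E\<in>T. [card E = 1] (mod d))}"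

text \<open>The elements of \<open>M\<close> are left out of the product: they account for the lower interval of \<open>M\<close>.\<close>

definition hypertree_sum :: "(nat \<Rightarrow> 'a::comm_ring_1) \<Rightarrow> nat \<Rightarrow> nat set \<Rightarrow> nat set set \<Rightarrow> 'a" where
  "hypertree_sum N d V M = (\<Sum>T | T \<in> nc_hypertrees d V \<and> M \<subseteq> min_edges T. \<Prod>E\<in>T - M. - N (card E))"

lemma finite_nc_hypertrees: "finite V \<Longrightarrow> finite (nc_hypertrees d V)"
  by (rule finite_subset[of _ "Pow (Pow V)"]) (auto simp: nc_hypertrees_def dest: hypertreeD)

text \<open>Every term \<open>card E - 1\<close> of the hypertree equation is 0 modulo
  \<open>d\<close>. Applied to the arcs of a minimal edge, this shows that the edge is good.\<close>

lemma nc_hypertrees_card: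
  assumes "T \<in> nc_hypertrees d V"
  shows "[card V = 1] (mod d)"
proof -
  have T: "hypertree V T" "\<And>E. E \<in> T \<Longrightarrow> [card E = 1] (mod d)" using assms by (auto simp: nc_hypertrees_def)
  have "[(\<Sum>E\<in>T. int (card E) - 1) = (\<Sum>E\<in>T. 0)] (mod int d)"
  proof (rule cong_sum)
    fix E assume "E \<in> T"
    then have "[int (card E) = int 1] (mod int d)" using T(2) cong_int_iff by blast
    then show "[int (card E) - 1 = 0] (mod int d)" by (simp add: cong_diff_iff_cong_0)
  qed
  then have "[int (card V) = int 1] (mod int d)"
    using hypertreeD(5)[OF T(1)] by (simp add: cong_diff_iff_cong_0)
  then show ?thesis using cong_int_iff by blast
qed

lemma min_edgesD:
  assumes "E \<in> min_edges T"
  shows "E \<in> T" "F \<in> T \<Longrightarrow> F \<noteq> E \<Longrightarrow> within_arc E F"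
  using assms unfolding min_edges_def by blast+

lemma nc_hypertrees_inside_arc:
  assumes "finite V" "T \<in> nc_hypertrees d V" "E \<in> min_edges T" "v \<in> E"
  shows "inside T (arc V E v) \<in> nc_hypertrees d (arc V E v)"
proof -
  have T: "hypertree V T" "noncrossing T" "\<And>E. E \<in> T \<Longrightarrow> [card E = 1] (mod d)"
    using assms(2) by (auto simp: nc_hypertrees_def)
  note E = hypertreeD(1,2)[OF T(1) min_edgesD(1)[OF assms(3)]]
  have "hypertree (arc V E v) (inside T (arc V E v))" by (rule hypertree_inside_arc[OF assms(1) E T(1) assms(3,4)])
  then show ?thesis
    unfolding nc_hypertrees_def using noncrossing_subset[OF T(2) inside_subset] T(3) inside_subset[of T] by blast
qed

text \<open>This ensures that for a fixed hypertree the sum over all families includes every subset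
  of its minimal edges.\<close>

lemma min_edges_nc_families:
  assumes "finite V" "T \<in> nc_hypertrees d V" "M \<subseteq> min_edges T"
  shows "M \<in> nc_families d V"
proof -
  have T: "hypertree V T" "noncrossing T" using assms(2) by (auto simp: nc_hypertrees_def)
  note T' = hypertreeD[OF T(1)]
  have M: "B \<in> T" "B \<in> min_edges T" if "B \<in> M" for B using assms(3) that min_edgesD(1) by blast+
  have fin: "finite B" if "B \<in> T" for B by (rule finite_subset[OF T'(1)[OF that] assms(1)])
  have "nc_family V M"
  proof (rule nc_familyI)
    fix B C assume BC: "B \<in> M" "C \<in> M" "B \<noteq> C"
    note BT = M(1)[OF BC(1)] and CT = M(1)[OF BC(2)]
    have w: "within_arc B C" "within_arc C B"
      using min_edgesD(2)[OF M(2)[OF BC(1)] CT] min_edgesD(2)[OF M(2)[OF BC(2)] BT] BC(3) by blast+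
    show "B \<inter> C = {}"
      by (rule min_edges_disjoint[OF fin[OF BT] fin[OF CT] T'(2)[OF BT] T'(2)[OF CT] w])
    show "\<not> crosses B C" by (rule noncrossingD[OF T(2) BT CT BC(3)])
  qed (use M(1) T' in blast)+
  moreover have "good d V B" if "B \<in> M" for B
    unfolding good_def using nc_hypertrees_card[OF nc_hypertrees_inside_arc[OF assms(1,2) M(2)[OF that]]] by blast
  ultimately show ?thesis by (simp add: nc_families_def)
qed

text \<open>Splitting and gluing at \<open>E\<close> are inverse to each other and respect
  minimality of the blocks of \<open>M\<close>. The weights multiply without an extra factor because
  \<open>E\<close> belongs to \<open>M\<close> and is left out of the product.\<close>

lemma hypertree_sum_step:
  assumes V: "finite V" "[card V = 1] (mod d)" and M: "M \<in> nc_families d V" "E \<in> M"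
  shows "hypertree_sum N d V M = (\<Prod>v\<in>E. hypertree_sum N d (arc V E v) (inside M (arc V E v)))"
proof -
  let ?W = "arc V E"
  let ?A = "\<lambda>v. {T. T \<in> nc_hypertrees d (?W v) \<and> inside M (?W v) \<subseteq> min_edges T}"
  let ?B = "{T. T \<in> nc_hypertrees d V \<and> M \<subseteq> min_edges T}"
  let ?g = "\<lambda>f. insert E (\<Union>v\<in>E. f v)"
  let ?p = "\<lambda>T M. \<Prod>E\<in>T - M. - N (card E)"
  have ncM: "nc_family V M" by (rule nc_familiesD(1)[OF M(1)])
  note M' = nc_familyD[OF ncM]
  have E: "E \<subseteq> V" "2 \<le> card E" "E \<noteq> {}" using M'(1,2,3) M(2) by blast+
  have finE: "finite E" by (rule finite_subset[OF E(1) V(1)])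
  have cardE: "[card E = 1] (mod d)"
    using good_card[OF V(1) E(1,3) nc_familiesD(2)[OF M]] V(2) cong_trans cong_sym by blast
  have A: "hypertree (?W v) (f v)" "noncrossing (f v)" "\<And>F. F \<in> f v \<Longrightarrow> [card F = 1] (mod d)" "inside M (?W v) \<subseteq> min_edges (f v)"
    if "f \<in> PiE E ?A" "v \<in> E" for f v
    using PiE_mem[OF that] by (auto simp: nc_hypertrees_def)
  have sub: "F \<subseteq> ?W v" "F \<noteq> {}" if "f \<in> PiE E ?A" "v \<in> E" "F \<in> f v" for f v F
    using hypertreeD(1,3)[OF A(1)[OF that(1,2)] that(3)] .
  have g_mem: "?g f \<in> ?B" if f: "f \<in> PiE E ?A" for f
  proof -
    have h: "hypertree V (?g f)" by (rule hypertree_glue(1)[OF V(1) E(1,2) A(1)[OF f]])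
    have Emin: "E \<in> min_edges (?g f)" by (rule hypertree_glue(3)[OF V(1) E(1,2) A(1)[OF f]])
    have cr: "\<not> crosses F G" if FG: "F \<in> ?g f" "G \<in> ?g f" "F \<noteq> G" for F G
    proof (cases "F = E \<or> G = E")
      case True
      then show ?thesis
        using within_arc_not_crosses[OF finE] min_edgesD(2)[OF Emin FG(1)] min_edgesD(2)[OF Emin FG(2)] FG(3) by metis
    next
      case False
      then obtain u v where uv: "u \<in> E" "F \<in> f u" "v \<in> E" "G \<in> f v" using FG by blast
      show ?thesis
      proof (cases "u = v")
        case True
        then show ?thesis using noncrossingD[OF A(2)[OF f uv(1)] uv(2)] uv(4) FG(3) by blast
      next
        case False
        then show ?thesis
          using arcs_not_crosses[OF finE uv(1,3)] crosses_mono[OF _ sub(1)[OF f uv(1,2)] sub(1)[OF f uv(3,4)]] by blast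
      qed
    qed
    have "B \<in> min_edges (?g f)" if B: "B \<in> M" for B
    proof (cases "B = E")
      case False
      obtain v where v: "v \<in> E" "B \<subseteq> ?W v" "v \<notin> B" using nc_family_arc[OF V(1) ncM M(2) B False] by metis
      then have Bm: "B \<in> min_edges (f v)" using A(4)[OF f v(1)] B by (auto simp: inside_def)
      have "within_arc B F" if F: "F \<in> ?g f" "F \<noteq> B" for F
      proof (cases "F = E")
        case True
        then show ?thesis using nc_family_within_arc[OF V(1) ncM B M(2) False] by simp
      next
        case False
        then obtain u where u: "u \<in> E" "F \<in> f u" using F by blast
        show ?thesis
        proof (cases "u = v")
          case True
          then show ?thesis using min_edgesD(2)[OF Bm, of F] u F(2) by blast
        next
          case False
          \<comment> \<open>An edge in another arc of \<open>E\<close> consists of points that all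
            look like \<open>v\<close> from \<open>B\<close>, so it cannot come before
            \<open>B\<close>.\<close>
          have "F \<subseteq> V - ?W v" using sub(1)[OF f u] arc_disjoint[OF False, of V E] arc_subset[of V E u] by blast
          then have "cyclic_pred B x = cyclic_pred B v" if "x \<in> F" for x
            using arc_within_arc(1)[OF V(1) E(1) v M'(3)[OF B], of x] that by blast
          then show ?thesis by (simp add: within_arc_def)
        qed
      qed
      moreover have "B \<in> ?g f" using min_edgesD(1)[OF Bm] v(1) by blast
      ultimately show ?thesis unfolding min_edges_def by blast
    qed (use Emin in simp)
    moreover have "?g f \<in> nc_hypertrees d V"
      unfolding nc_hypertrees_def noncrossing_iff using h cr cardE A(3)[OF f] by blast
    ultimately show ?thesis by blast
  qed
  have "hypertree_sum N d V M = (\<Sum>f\<in>PiE E ?A. ?p (?g f) M)"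
    unfolding hypertree_sum_def
  proof (rule sum.reindex_bij_witness[of _ ?g "\<lambda>T. restrict (\<lambda>v. inside T (?W v)) E"])
    fix f assume f: "f \<in> PiE E ?A"
    show "?g f \<in> ?B" by (rule g_mem[OF f])
    show "restrict (\<lambda>v. inside (?g f) (?W v)) E = f"
    proof
      fix v
      show "restrict (\<lambda>v. inside (?g f) (?W v)) E v = f v"
        using hypertree_glue(2)[OF V(1) E(1,2) A(1)[OF f]] PiE_arb[OF f, of v] by (cases "v \<in> E") simp_all
    qed
  next
    fix T assume T: "T \<in> ?B"
    have T': "hypertree V T" "E \<in> min_edges T" using T M(2) by (auto simp: nc_hypertrees_def)
    have dec: "T = insert E (\<Union>v\<in>E. inside T (?W v))"
      by (rule min_edge_decompose[OF V(1) E(1,2) _ T'(2)]) (use hypertreeD[OF T'(1)] in blast)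
    have "(\<Union>v\<in>E. restrict (\<lambda>v. inside T (?W v)) E v) = (\<Union>v\<in>E. inside T (?W v))" by auto
    then show "?g (restrict (\<lambda>v. inside T (?W v)) E) = T" using dec by simp
    then show "?p (?g (restrict (\<lambda>v. inside T (?W v)) E)) M = ?p T M" by (rule arg_cong)
    have "inside M (?W v) \<subseteq> min_edges (inside T (?W v))" if "v \<in> E" for v
      using T unfolding min_edges_def inside_def by blast
    moreover have "inside T (?W v) \<in> nc_hypertrees d (?W v)" if "v \<in> E" for v
      by (rule nc_hypertrees_inside_arc[OF V(1) _ T'(2) that]) (use T in blast)
    ultimately show "restrict (\<lambda>v. inside T (?W v)) E \<in> PiE E ?A" by simp
  qed
  also have "\<dots> = (\<Sum>f\<in>PiE E ?A. \<Prod>v\<in>E. ?p (f v) (inside M (?W v)))"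
  proof (rule sum.cong[OF refl])
    fix f assume f: "f \<in> PiE E ?A"
    have "?g f - M = (\<Union>v\<in>E. f v - inside M (?W v))"
      using sub(1)[OF f] M(2) inside_subset[of M] by (fastforce simp: inside_def)
    moreover have "?p (\<Union>v\<in>E. f v - inside M (?W v)) {} = (\<Prod>v\<in>E. prod (\<lambda>E. - N (card E)) (f v - inside M (?W v)))"
      unfolding Diff_empty
    proof (rule prod.UNION_disjoint[OF finE])
      show "\<forall>v\<in>E. finite (f v - inside M (?W v))"
        using finite_hypertree[OF finite_arc[OF V(1)] A(1)[OF f]] by blast
      show "\<forall>u\<in>E. \<forall>v\<in>E. u \<noteq> v \<longrightarrow> (f u - inside M (?W u)) \<inter> (f v - inside M (?W v)) = {}"
      proof (intro ballI impI)
        fix u v assume uv: "u \<in> E" "v \<in> E" "u \<noteq> v"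
        have "F \<notin> f v" if F: "F \<in> f u" for F
          using sub[OF f uv(1) F] sub(1)[OF f uv(2), of F] arc_disjoint[OF uv(3), of V E] by blast
        then show "(f u - inside M (?W u)) \<inter> (f v - inside M (?W v)) = {}" by blast
      qed
    qed
    ultimately show "?p (?g f) M = (\<Prod>v\<in>E. ?p (f v) (inside M (?W v)))" by simp
  qed
  also have "\<dots> = (\<Prod>v\<in>E. \<Sum>T\<in>?A v. ?p T (inside M (?W v)))"
    by (rule prod_sum_PiE[symmetric, OF finE]) (use finite_nc_hypertrees[OF finite_arc[OF V(1)]] in simp)
  finally show ?thesis unfolding hypertree_sum_def .
qed

text \<open>After the sums are exchanged, the sum over the subsets \<open>M\<close> of the minimal
  edges of a fixed hypertree is the expansion of a product of factors
  \<open>N (card E) + - N (card E)\<close>. The bound on \<open>card V\<close> forces an edge, so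
  this product is not empty.\<close>

lemma sum_nc_families_hypertree_sum:
  assumes V: "finite V" "2 \<le> card V"
  shows "(\<Sum>M\<in>nc_families d V. (\<Prod>E\<in>M. N (card E)) * hypertree_sum N d V M) = (0 :: 'a::comm_ring_1)"
proof -
  let ?H = "nc_hypertrees d V" and ?F = "nc_families d V"
  let ?t = "\<lambda>M T. (\<Prod>E\<in>M. N (card E)) * (\<Prod>E\<in>T - M. - N (card E))"
  have fin: "finite ?F" "finite ?H" using finite_nc_families[OF V(1)] finite_nc_hypertrees[OF V(1)] by auto
  have "(\<Sum>M\<in>?F. (\<Prod>E\<in>M. N (card E)) * hypertree_sum N d V M) = (\<Sum>M\<in>?F. \<Sum>T\<in>?H. if M \<subseteq> min_edges T then ?t M T else 0)"
    unfolding hypertree_sum_def sum_distrib_left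
    by (rule sum.cong[OF refl], rule sum.mono_neutral_cong_left) (use fin in auto)
  also have "\<dots> = (\<Sum>T\<in>?H. \<Sum>M\<in>?F. if M \<subseteq> min_edges T then ?t M T else 0)" by (rule sum.swap)
  also have "\<dots> = 0"
  proof (rule sum.neutral, rule ballI)
    fix T assume T: "T \<in> ?H"
    then have T': "hypertree V T" "noncrossing T" by (auto simp: nc_hypertrees_def)
    let ?X = "min_edges T"
    have finT: "finite T" by (rule finite_hypertree[OF V(1) T'(1)])
    have sub: "?X \<subseteq> T" by (auto simp: min_edges_def)
    have finX: "finite ?X" by (rule finite_subset[OF sub finT])
    have "T \<noteq> {}" using hypertreeD(5)[OF T'(1)] V(2) by auto
    then have ne: "?X \<noteq> {}" by (rule min_edges_nonempty[OF V(1) T'])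
    have "(\<Sum>M\<in>?F. if M \<subseteq> ?X then ?t M T else 0) = (\<Sum>M\<in>Pow ?X. ?t M T)"
      by (rule sum.mono_neutral_cong_right) (use fin min_edges_nc_families[OF V(1) T] in auto)
    also have "\<dots> = (\<Sum>M\<in>Pow ?X. (\<Prod>E\<in>M. N (card E)) * (\<Prod>E\<in>?X - M. - N (card E)) * (\<Prod>E\<in>T - ?X. - N (card E)))"
    proof (rule sum.cong[OF refl])
      fix M assume "M \<in> Pow ?X"
      then have "T - M = (?X - M) \<union> (T - ?X)" using sub by blast
      moreover have "prod (\<lambda>E. - N (card E)) ((?X - M) \<union> (T - ?X)) = (\<Prod>E\<in>?X - M. - N (card E)) * (\<Prod>E\<in>T - ?X. - N (card E))"
        by (rule prod.union_disjoint) (use finT finX in auto)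
      ultimately show "?t M T = (\<Prod>E\<in>M. N (card E)) * (\<Prod>E\<in>?X - M. - N (card E)) * (\<Prod>E\<in>T - ?X. - N (card E))"
        by (simp add: mult.assoc)
    qed
    also have "\<dots> = (\<Prod>E\<in>?X. N (card E) + - N (card E)) * (\<Prod>E\<in>T - ?X. - N (card E))"
      by (simp only: prod_add[OF finX] sum_distrib_right)
    also have "(\<Prod>E\<in>?X. N (card E) + - N (card E)) = 0"
      by (simp add: ne finX power_0_left)
    finally show "(\<Sum>M\<in>?F. if M \<subseteq> ?X then ?t M T else 0) = 0" by simp
  qed
  finally show ?thesis .
qed

section \<open>Identification with the posets of indivisible noncrossing partitions\<close>

section \<open>Relabeling\<close>

lemma crosses_image:
  assumes "\<And>x y. x \<in> V \<Longrightarrow> y \<in> V \<Longrightarrow> f x < f y \<longleftrightarrow> x < (y::nat)" "E \<subseteq> V" "F \<subseteq> V"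
  shows "crosses (f ` E) (f ` F) \<longleftrightarrow> crosses E F"
proof
  assume "crosses (f ` E) (f ` F)"
  then obtain i j k l where *: "f i < f j" "f j < f k" "f k < f l" "i \<in> E" "k \<in> E" "j \<in> F" "l \<in> F"
    unfolding crosses_def by blast
  then have "i < j" "j < k" "k < l" using assms by blast+
  then show "crosses E F" using * unfolding crosses_def by blast
next
  assume "crosses E F"
  then obtain i j k l where *: "i < j" "j < k" "k < l" "i \<in> E" "k \<in> E" "j \<in> F" "l \<in> F"
    unfolding crosses_def by blast
  then have "f i < f j" "f j < f k" "f k < f l" using assms by blast+
  then show "crosses (f ` E) (f ` F)" using * unfolding crosses_def by blast
qed

context
  fixes V :: "nat set" and f :: "nat \<Rightarrow> nat"
  assumes V: "finite V" and mono: "\<And>x y. x \<in> V \<Longrightarrow> y \<in> V \<Longrightarrow> f x < f y \<longleftrightarrow> x < y"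
begin

private lemma inj: "inj_on f V"
proof (rule inj_onI)
  fix x y assume "x \<in> V" "y \<in> V" "f x = f y"
  then show "x = y" using mono[of x y] mono[of y x] by (metis less_irrefl linorder_neqE_nat)
qed

private lemma mono_le: "x \<in> V \<Longrightarrow> y \<in> V \<Longrightarrow> f x \<le> f y \<longleftrightarrow> x \<le> y"
  using mono[of y x] by (simp add: not_less[symmetric])

private lemma cyclic_pred_image:
  assumes "B \<subseteq> V" "B \<noteq> {}" "x \<in> V"
  shows "cyclic_pred (f ` B) (f x) = f (cyclic_pred B x)"
proof -
  have fin: "finite B" by (rule finite_subset[OF assms(1) V])
  have p: "cyclic_pred B x \<in> B" by (rule cyclic_pred_mem[OF fin assms(2)])
  have "cyclic_between (f (cyclic_pred B x)) (f b) (f x) \<longleftrightarrow> cyclic_between (cyclic_pred B x) b x" if "b \<in> B" for b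
    using that p assms mono mono_le unfolding cyclic_between_def by (metis subsetD)
  then have "\<not> cyclic_between (f (cyclic_pred B x)) (f b) (f x)" if "b \<in> B" for b
    using cyclic_pred_not_between[OF fin that, of x] that by blast
  then show ?thesis using p fin assms(2) by (subst cyclic_pred_iff) auto
qed

private lemma arc_image:
  assumes "B \<subseteq> V" "v \<in> B"
  shows "arc (f ` V) (f ` B) (f v) = f ` arc V B v"
proof -
  have fin: "finite B" by (rule finite_subset[OF assms(1) V])
  have ne: "B \<noteq> {}" using assms(2) by blast
  have "cyclic_pred (f ` B) (f x) = f v \<longleftrightarrow> cyclic_pred B x = v" if "x \<in> V" for x
    unfolding cyclic_pred_image[OF assms(1) ne that]
    using inj_on_eq_iff[OF inj] cyclic_pred_mem[OF fin ne, of x] assms by (meson subsetD)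
  then show ?thesis unfolding arc_def by auto
qed

private lemma good_image:
  assumes "B \<subseteq> V"
  shows "good d (f ` V) (f ` B) \<longleftrightarrow> good d V B"
proof -
  have "card (arc (f ` V) (f ` B) (f v)) = card (arc V B v)" if "v \<in> B" for v
    unfolding arc_image[OF assms that] by (rule card_image) (rule inj_on_subset[OF inj arc_subset])
  then show ?thesis unfolding good_def by simp
qed

lemma nc_families_image:
  assumes "M \<in> nc_families d V"
  shows "(`) f ` M \<in> nc_families d (f ` V)"
proof -
  note M = nc_familyD[OF nc_familiesD(1)[OF assms]]
  have "nc_family (f ` V) ((`) f ` M)"
  proof (rule nc_familyI)
    fix B assume "B \<in> (`) f ` M"
    then obtain B' where B: "B' \<in> M" "B = f ` B'" by blast
    show "B \<subseteq> f ` V" using M(1)[OF B(1)] B(2) by blast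
    show "2 \<le> card B" unfolding B(2) using M(2)[OF B(1)] card_image[OF inj_on_subset[OF inj M(1)[OF B(1)]]] by simp
    fix C assume "C \<in> (`) f ` M" and BC: "B \<noteq> C"
    then obtain C' where C: "C' \<in> M" "C = f ` C'" by blast
    have "B' \<noteq> C'" using BC B C by blast
    note n = M(4,5)[OF B(1) C(1) this]
    show "B \<inter> C = {}"
      unfolding B(2) C(2) using inj_on_image_Int[OF inj M(1)[OF B(1)] M(1)[OF C(1)]] n(1) by simp
    show "\<not> crosses B C"
      unfolding B(2) C(2) using crosses_image[of V f, OF mono M(1)[OF B(1)] M(1)[OF C(1)]] n(2) by blast
  qed
  then show ?thesis
    using good_image M(1) nc_familiesD(2)[OF assms] by (auto simp: nc_families_def)
qed

lemma fam_le_image: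
  assumes "\<And>B. B \<in> M \<Longrightarrow> B \<subseteq> V" "\<And>B. B \<in> N \<Longrightarrow> B \<subseteq> V"
  shows "fam_le ((`) f ` M) ((`) f ` N) \<longleftrightarrow> fam_le M N"
proof -
  have "f ` B \<subseteq> f ` C \<longleftrightarrow> B \<subseteq> C" if "B \<in> M" "C \<in> N" for B C
  proof
    assume L: "f ` B \<subseteq> f ` C"
    show "B \<subseteq> C"
    proof
      fix x assume x: "x \<in> B"
      then obtain y where y: "y \<in> C" "f x = f y" using L by blast
      have "x \<in> V" "y \<in> V" using x y assms that by blast+
      then have "x = y" using inj_onD[OF inj y(2)] by blast
      then show "x \<in> C" using y(1) by simp
    qed
  qed blast
  then show ?thesis unfolding fam_le_def by simp
qed

end

lemma poset_iso_nc_families: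
  assumes "finite V"
  shows "poset_iso (fam_order (nc_families d V)) (fam_order (nc_families d {1..card V}))"
proof -
  \<comment> \<open>The rank in \<open>V\<close>, counted from 1. All notions involved depend on the
    linear order only, so this relabeling carries them to \<open>{1..card V}\<close>.\<close>
  define f where "f x = card {y \<in> V. y \<le> x}" for x
  let ?g = "inv_into V f"
  have less: "f x < f y" if "x \<in> V" "y \<in> V" "x < y" for x y
    unfolding f_def
  proof (rule psubset_card_mono)
    have "y \<notin> {z \<in> V. z \<le> x}" "y \<in> {z \<in> V. z \<le> y}" "{z \<in> V. z \<le> x} \<subseteq> {z \<in> V. z \<le> y}" using that by auto
    then show "{z \<in> V. z \<le> x} \<subset> {z \<in> V. z \<le> y}" by blast
  qed (use assms in simp)
  have mono: "f x < f y \<longleftrightarrow> x < y" if "x \<in> V" "y \<in> V" for x y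
    using less[OF that] less[OF that(2,1)] by (metis less_asym less_irrefl linorder_neqE_nat)
  have inj: "inj_on f V" by (rule inj_onI) (metis less less_irrefl linorder_neqE_nat)
  have im: "f ` V = {1..card V}"
  proof (rule card_subset_eq)
    have "1 \<le> f x \<and> f x \<le> card V" if "x \<in> V" for x
    proof
      have "card {x} \<le> f x" unfolding f_def by (rule card_mono) (use assms that in auto)
      then show "1 \<le> f x" by simp
      show "f x \<le> card V" unfolding f_def by (rule card_mono) (use assms in auto)
    qed
    then show "f ` V \<subseteq> {1..card V}" by auto
  qed (simp_all add: card_image[OF inj])
  have gf: "?g (f x) = x" if "x \<in> V" for x by (rule inv_into_f_f[OF inj that])
  have fg: "f (?g y) = y" if "y \<in> {1..card V}" for y using f_inv_into_f[of y f V] that im by simp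
  have gV: "?g y \<in> V" if "y \<in> {1..card V}" for y using inv_into_into[of y f V] that im by simp
  have gmono: "?g x < ?g y \<longleftrightarrow> x < y" if "x \<in> {1..card V}" "y \<in> {1..card V}" for x y
    using mono[OF gV[OF that(1)] gV[OF that(2)]] fg that by simp
  have gim: "?g ` {1..card V} = V" using im inv_into_image_cancel[OF inj, of V] by simp
  have id: "(`) f ` (`) ?g ` M = M" if "\<And>B. B \<in> M \<Longrightarrow> B \<subseteq> {1..card V}" for M
  proof -
    have "f ` ?g ` B = B" if "B \<in> M" for B using image_inv_into_cancel[OF im, of B] \<open>\<And>B. B \<in> M \<Longrightarrow> B \<subseteq> _\<close>[OF that] by simp
    then show ?thesis by (simp add: image_image)
  qed
  have id': "(`) ?g ` (`) f ` M = M" if "\<And>B. B \<in> M \<Longrightarrow> B \<subseteq> V" for M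
  proof -
    have "?g ` f ` B = B" if "B \<in> M" for B using inv_into_image_cancel[OF inj, of B] \<open>\<And>B. B \<in> M \<Longrightarrow> B \<subseteq> _\<close>[OF that] by simp
    then show ?thesis by (simp add: image_image)
  qed
  have sub: "B \<subseteq> W" if "M \<in> nc_families d W" "B \<in> M" for M B W
    using nc_familyD(1)[OF nc_familiesD(1)[OF that(1)] that(2)] .
  have "bij_betw (\<lambda>M. (`) f ` M) (nc_families d V) (nc_families d {1..card V})"
  proof (rule bij_betw_byWitness[where f' = "\<lambda>M. (`) ?g ` M"])
    show "(\<lambda>M. (`) f ` M) ` nc_families d V \<subseteq> nc_families d {1..card V}"
      using nc_families_image[OF assms mono] im by auto
    show "(\<lambda>M. (`) ?g ` M) ` nc_families d {1..card V} \<subseteq> nc_families d V"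
      using nc_families_image[of "{1..card V}" ?g, OF _ gmono] gim by auto
    show "\<forall>M\<in>nc_families d V. (`) ?g ` (`) f ` M = M" by (intro ballI id') (rule sub)
    show "\<forall>M\<in>nc_families d {1..card V}. (`) f ` (`) ?g ` M = M" by (intro ballI id) (rule sub)
  qed
  moreover have "(M, N) \<in> fam_order (nc_families d V) \<longleftrightarrow> ((`) f ` M, (`) f ` N) \<in> fam_order (nc_families d {1..card V})"
    if "M \<in> nc_families d V" "N \<in> nc_families d V" for M N
    using that nc_families_image[OF assms mono] im fam_le_image[OF assms mono sub[OF that(1)] sub[OF that(2)]]
    by (auto simp: mem_fam_order)
  ultimately show ?thesis unfolding poset_iso_def by auto
qed

section \<open>The Kreweras dual\<close>

text \<open>The blocks of the dual are the classes of vertices that no block of the partition separates.\<close>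

definition kclass :: "nat set \<Rightarrow> nat set set \<Rightarrow> nat \<Rightarrow> nat set" where
  "kclass V M x = {y \<in> V. \<forall>B\<in>M. cyclic_pred B y = cyclic_pred B x}"

lemma kclass_self: "x \<in> V \<Longrightarrow> x \<in> kclass V M x"
  by (simp add: kclass_def)

lemma kclass_subset: "kclass V M x \<subseteq> V"
  by (auto simp: kclass_def)

lemma kclass_eq: "y \<in> kclass V M x \<Longrightarrow> kclass V M y = kclass V M x"
  unfolding kclass_def by simp

lemma partition_on_kclass: "partition_on V (kclass V M ` V)"
proof (rule partition_onI)
  show "\<Union>(kclass V M ` V) = V" using kclass_self[of _ V M] kclass_subset[of V M] by blast
  show "disjnt C D" if "C \<in> kclass V M ` V" "D \<in> kclass V M ` V" "C \<noteq> D" for C D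
    using that kclass_eq[of _ V M] unfolding disjnt_def by blast
  show "{} \<notin> kclass V M ` V" using kclass_self[of _ V M] by blast
qed

lemma within_arc_kclass: "B \<in> M \<Longrightarrow> within_arc B (kclass V M x)"
  by (simp add: within_arc_def kclass_def)

text \<open>Blocks that are not inside the arc do not separate its points: \<open>E\<close> does not
  by definition of its arcs, and a block in another arc sees everything outside that arc as one
  vertex.\<close>

lemma kclass_arc:
  assumes "finite V" "nc_family V M" "E \<in> M" "v \<in> E" "x \<in> arc V E v"
  shows "kclass V M x = kclass (arc V E v) (inside M (arc V E v)) x"
proof -
  let ?W = "arc V E"
  note M = nc_familyD[OF assms(2)]
  have same: "cyclic_pred B y = cyclic_pred B x" if B: "B \<in> M" "B \<notin> inside M (?W v)" and y: "y \<in> ?W v" for B y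
  proof (cases "B = E")
    case True
    then show ?thesis using y assms(5) by (simp add: arc_def)
  next
    case False
    obtain u where u: "u \<in> E" "B \<subseteq> ?W u" "u \<notin> B" using nc_family_arc[OF assms(1-3) B(1) False] by metis
    then have uv: "v \<noteq> u" using B by (auto simp: inside_def)
    have "z \<in> V - ?W u" if "z \<in> ?W v" for z using arc_disjoint[OF uv, of V E] arc_subset[of V E v] that by blast
    then show ?thesis using arc_within_arc(1)[OF assms(1) M(1)[OF assms(3)] u M(3)[OF B(1)]] y assms(5) by metis
  qed
  have "y \<in> ?W v" if "y \<in> kclass V M x" for y
    using that assms(3,5) by (auto simp: kclass_def arc_def)
  moreover have "y \<in> V" if "y \<in> ?W v" for y using that arc_subset by blast
  ultimately show ?thesis using same inside_subset[of M "?W v"] unfolding kclass_def by blast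
qed

lemma kclass_arcs:
  assumes "finite V" "nc_family V M" "E \<in> M"
  shows "kclass V M ` V = (\<Union>v\<in>E. kclass (arc V E v) (inside M (arc V E v)) ` arc V E v)"
proof -
  note M = nc_familyD[OF assms(2)]
  have "kclass V M ` V = kclass V M ` (\<Union>v\<in>E. arc V E v)"
    using UN_arc[OF assms(1) M(1)[OF assms(3)] M(3)[OF assms(3)]] by simp
  also have "\<dots> = (\<Union>v\<in>E. kclass V M ` arc V E v)" by blast
  also have "\<dots> = (\<Union>v\<in>E. kclass (arc V E v) (inside M (arc V E v)) ` arc V E v)"
    using kclass_arc[OF assms] by simp
  finally show ?thesis .
qed

lemma kclass_empty: "x \<in> V \<Longrightarrow> kclass V {} ` V = {V}"
  unfolding kclass_def by auto

text \<open>The rank identity for the Kreweras dual: the ranks of a noncrossing partition and of its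
  dual add up to \<open>card V - 1\<close>. Singleton blocks contribute 0, so listing only the
  larger blocks loses nothing.\<close>

lemma sum_card_kclass:
  assumes "finite V" "V \<noteq> {}" "nc_family V M"
  shows "(\<Sum>C\<in>kclass V M ` V. int (card C) - 1) + (\<Sum>B\<in>M. int (card B) - 1) = int (card V) - 1"
  using assms
proof (induction "card V" arbitrary: V M rule: less_induct)
  case less
  show ?case
  proof (cases "M = {}")
    case True
    then show ?thesis using less.prems(2) kclass_empty by auto
  next
    case False
    then obtain E where E: "E \<in> M" by blast
    note M = nc_familyD[OF less.prems(3)]
    note EV = M(1,2,3)[OF E]
    have finE: "finite E" by (rule finite_subset[OF EV(1) less.prems(1)])
    let ?W = "arc V E" and ?M = "\<lambda>v. inside M (arc V E v)"
    let ?c = "\<lambda>C::nat set. int (card C) - 1"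
    have "sum ?c (kclass V M ` V) = (\<Sum>v\<in>E. sum ?c (kclass (?W v) (?M v) ` ?W v))"
      unfolding kclass_arcs[OF less.prems(1,3) E]
    proof (rule sum.UNION_disjoint[OF finE])
      show "\<forall>v\<in>E. finite (kclass (?W v) (?M v) ` ?W v)" using finite_arc[OF less.prems(1)] by blast
      show "\<forall>u\<in>E. \<forall>v\<in>E. u \<noteq> v \<longrightarrow> kclass (?W u) (?M u) ` ?W u \<inter> kclass (?W v) (?M v) ` ?W v = {}"
      proof (intro ballI impI)
        fix u v :: nat assume uv: "u \<noteq> v"
        have "C \<notin> kclass (?W v) (?M v) ` ?W v" if C: "C \<in> kclass (?W u) (?M u) ` ?W u" for C
        proof
          assume "C \<in> kclass (?W v) (?M v) ` ?W v"
          then have "C \<subseteq> ?W v" using kclass_subset by blast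
          moreover have "C \<subseteq> ?W u" "C \<noteq> {}" using C kclass_subset kclass_self[of _ "?W u" "?M u"] by blast+
          ultimately show False using arc_disjoint[OF uv, of V E] by blast
        qed
        then show "kclass (?W u) (?M u) ` ?W u \<inter> kclass (?W v) (?M v) ` ?W v = {}" by blast
      qed
    qed
    moreover have "sum ?c M = ?c E + (\<Sum>v\<in>E. sum ?c (?M v))"
      by (subst nc_family_decompose[OF less.prems(1,3) E], rule sum_over_arcs[OF less.prems(1) EV(1,2)])
        (use M(3) in \<open>auto simp: inside_def\<close>)
    moreover have "(\<Sum>v\<in>E. sum ?c (kclass (?W v) (?M v) ` ?W v)) + (\<Sum>v\<in>E. sum ?c (?M v)) = (\<Sum>v\<in>E. ?c (?W v))"
      unfolding sum.distrib[symmetric]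
    proof (rule sum.cong[OF refl])
      fix v assume v: "v \<in> E"
      show "sum ?c (kclass (?W v) (?M v) ` ?W v) + sum ?c (?M v) = ?c (?W v)"
        by (rule less.hyps[OF card_arc_less[OF less.prems(1) EV(1,2) v] finite_arc[OF less.prems(1)] _ nc_family_inside[OF less.prems(3)]])
          (use mem_arc[OF less.prems(1) EV(1) v] in blast)
    qed
    ultimately show ?thesis using sum_card_arc[OF less.prems(1) EV(1,2)] by simp
  qed
qed

text \<open>A class of the dual lies in one arc of \<open>E\<close>. After repeated splitting it is
  an entire arc without blocks, whose size is 1 modulo \<open>d\<close>.\<close>

lemma card_kclass_cong:
  assumes "finite V" "[card V = 1] (mod d)" "M \<in> nc_families d V" "C \<in> kclass V M ` V"
  shows "[card C = 1] (mod d)"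
  using assms
proof (induction "card V" arbitrary: V M rule: less_induct)
  case less
  show ?case
  proof (cases "M = {}")
    case True
    then show ?thesis using less.prems(2,4) by (auto simp: kclass_def)
  next
    case False
    then obtain E where E: "E \<in> M" by blast
    note M = nc_familiesD[OF less.prems(3)]
    note EV = nc_familyD(1,2)[OF M(1) E]
    obtain v where v: "v \<in> E" "C \<in> kclass (arc V E v) (inside M (arc V E v)) ` arc V E v"
      using less.prems(4) unfolding kclass_arcs[OF less.prems(1) M(1) E] by blast
    show ?thesis
    proof (rule less.hyps[OF card_arc_less[OF less.prems(1) EV v(1)] finite_arc[OF less.prems(1)] _ _ v(2)])
      show "[card (arc V E v) = 1] (mod d)" using M(2)[OF E] v(1) unfolding good_def by blast
      show "inside M (arc V E v) \<in> nc_families d (arc V E v)"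
        by (rule nc_families_inside_arc[OF less.prems(1,3,2) E v(1)])
    qed
  qed
qed

text \<open>For the converse, the rank identity \<open>sum_card_kclass\<close> inside an arc
  recovers its size modulo \<open>d\<close> from the blocks and dual classes that it
  contains.\<close>

lemma nc_families_iff_card:
  assumes "finite V" "[card V = 1] (mod d)" "nc_family V M"
  shows "M \<in> nc_families d V \<longleftrightarrow> (\<forall>B\<in>M. [card B = 1] (mod d)) \<and> (\<forall>C\<in>kclass V M ` V. [card C = 1] (mod d))"
proof
  assume M: "M \<in> nc_families d V"
  have "[card B = 1] (mod d)" if "B \<in> M" for B
    using good_card[OF assms(1) nc_familyD(1,3)[OF assms(3) that] nc_familiesD(2)[OF M that]] assms(2) cong_trans cong_sym by blast
  then show "(\<forall>B\<in>M. [card B = 1] (mod d)) \<and> (\<forall>C\<in>kclass V M ` V. [card C = 1] (mod d))"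
    using card_kclass_cong[OF assms(1,2) M] by blast
next
  assume R: "(\<forall>B\<in>M. [card B = 1] (mod d)) \<and> (\<forall>C\<in>kclass V M ` V. [card C = 1] (mod d))"
  have 0: "[(\<Sum>C\<in>X. int (card C) - 1) = 0] (mod int d)" if "\<And>C. C \<in> X \<Longrightarrow> [card C = 1] (mod d)" for X :: "nat set set"
  proof -
    have "[(\<Sum>C\<in>X. int (card C) - 1) = (\<Sum>C\<in>X. 0)] (mod int d)"
    proof (rule cong_sum)
      fix C assume "C \<in> X"
      then have "[int (card C) = int 1] (mod int d)" using that cong_int_iff by blast
      then show "[int (card C) - 1 = 0] (mod int d)" by (simp add: cong_diff_iff_cong_0)
    qed
    then show ?thesis by simp
  qed
  have "[card (arc V E v) = 1] (mod d)" if E: "E \<in> M" and v: "v \<in> E" for E v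
  proof -
    let ?W = "arc V E v" and ?M = "inside M (arc V E v)"
    have "[(\<Sum>C\<in>kclass ?W ?M ` ?W. int (card C) - 1) + (\<Sum>B\<in>?M. int (card B) - 1) = 0 + 0] (mod int d)"
    proof (rule cong_add; rule 0)
      show "[card C = 1] (mod d)" if "C \<in> kclass ?W ?M ` ?W" for C
        using R that v unfolding kclass_arcs[OF assms(1,3) E] by blast
      show "[card C = 1] (mod d)" if "C \<in> ?M" for C
        using R that inside_subset by blast
    qed
    moreover have "?W \<noteq> {}" using mem_arc[OF assms(1) nc_familyD(1)[OF assms(3) E] v] by blast
    ultimately have "[int (card ?W) - 1 = 0] (mod int d)"
      using sum_card_kclass[OF finite_arc[OF assms(1)] _ nc_family_inside[OF assms(3)], of E v] by simp
    then have "[int (card ?W) = int 1] (mod int d)" by (simp add: cong_diff_iff_cong_0)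
    then show ?thesis using cong_int_iff by blast
  qed
  then show "M \<in> nc_families d V" using assms(3) by (simp add: nc_families_def good_def)
qed

lemma cyclic_pred_double:
  assumes "finite B" "B \<noteq> {}"
  shows "cyclic_pred ((\<lambda>i. 2 * i) ` B) (2 * x + 1) = 2 * cyclic_pred B x"
proof -
  have "cyclic_between (2 * v) (2 * b) (2 * x + 1) \<longleftrightarrow> cyclic_between v b x" for v b
    unfolding cyclic_between_def by presburger
  then have "\<not> cyclic_between (2 * cyclic_pred B x) (2 * b) (2 * x + 1)" if "b \<in> B" for b
    using cyclic_pred_not_between[OF assms(1) that, of x] by simp
  then show ?thesis
    using assms cyclic_pred_mem[OF assms] by (subst cyclic_pred_iff) auto
qed

lemma noncrossing_Un:
  "noncrossing (S \<union> T) \<longleftrightarrow> noncrossing S \<and> noncrossing T \<and>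
     (\<forall>X\<in>S. \<forall>Y\<in>T. X \<noteq> Y \<longrightarrow> \<not> crosses X Y \<and> \<not> crosses Y X)"
proof
  assume L: "noncrossing (S \<union> T)"
  show "noncrossing S \<and> noncrossing T \<and> (\<forall>X\<in>S. \<forall>Y\<in>T. X \<noteq> Y \<longrightarrow> \<not> crosses X Y \<and> \<not> crosses Y X)"
  proof (intro conjI ballI impI)
    fix X Y assume "X \<in> S" "Y \<in> T" "X \<noteq> Y"
    then show "\<not> crosses X Y" "\<not> crosses Y X"
      using noncrossingD[OF L, of X Y] noncrossingD[OF L, of Y X] by simp_all
  qed (use noncrossing_subset[OF L] in simp_all)
next
  assume R: "noncrossing S \<and> noncrossing T \<and> (\<forall>X\<in>S. \<forall>Y\<in>T. X \<noteq> Y \<longrightarrow> \<not> crosses X Y \<and> \<not> crosses Y X)"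
  then have RS: "noncrossing S" and RT: "noncrossing T" by blast+
  show "noncrossing (S \<union> T)"
    unfolding noncrossing_iff
  proof (intro ballI impI)
    fix E F assume EF: "E \<in> S \<union> T" "F \<in> S \<union> T" "E \<noteq> F"
    then consider "E \<in> S" "F \<in> S" | "E \<in> T" "F \<in> T" | "E \<in> S" "F \<in> T" | "E \<in> T" "F \<in> S" by blast
    then show "\<not> crosses E F"
    proof cases
      case 1
      then show ?thesis using noncrossingD[OF RS] EF(3) by simp
    next
      case 2
      then show ?thesis using noncrossingD[OF RT] EF(3) by simp
    next
      case 3
      then show ?thesis using R EF(3) by simp
    next
      case 4
      then show ?thesis using R EF(3) by simp
    qed
  qed
qed

lemma partition_on_block:
  assumes "finite V" "partition_on V \<pi>" "B \<in> \<pi>"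
  shows "B \<subseteq> V" "finite B" "B \<noteq> {}"
proof -
  show "B \<subseteq> V" using assms(2,3) by (auto simp: partition_on_def)
  then show "finite B" by (rule finite_subset[OF _ assms(1)])
  show "B \<noteq> {}" using assms(2,3) by (auto simp: partition_on_def)
qed

text \<open>Doubled and primed blocks are disjoint, so noncrossing between the two kinds is
  \<open>within_arc\<close>, which \<open>cyclic_pred_double\<close> carries back to
  \<open>{1..n}\<close>.\<close>

lemma kreweras_candidate_iff:
  assumes "\<pi> \<in> NCP {1..n}" "partition_on {1..n} \<sigma>"
  shows "kreweras_candidate n \<pi> \<sigma> \<longleftrightarrow> noncrossing \<sigma> \<and> (\<forall>B\<in>\<pi>. \<forall>C\<in>\<sigma>. within_arc B C)"
proof -
  let ?e = "\<lambda>B. (\<lambda>i::nat. 2 * i) ` B" and ?o = "\<lambda>B. (\<lambda>i::nat. 2 * i + 1) ` B"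
  let ?U = "?e ` \<pi> \<union> ?o ` \<sigma>"
  have \<pi>: "partition_on {1..n} \<pi>" "noncrossing \<pi>" using assms(1) by (auto simp: NCP_def)
  have blk: "finite B" "B \<noteq> {}" "B \<subseteq> {1..n}" if "B \<in> \<pi> \<union> \<sigma>" for B
    using that partition_on_block[OF _ \<pi>(1)] partition_on_block[OF _ assms(2)] by blast+
  have ee: "crosses (?e B) (?e C) \<longleftrightarrow> crosses B C" for B C by (rule crosses_image[of UNIV]) auto
  have oo: "crosses (?o B) (?o C) \<longleftrightarrow> crosses B C" for B C by (rule crosses_image[of UNIV]) auto
  have dis: "?e B \<inter> ?o C = {}" for B C
  proof -
    have "2 * i \<noteq> 2 * j + 1" for i j :: nat by presburger
    then show ?thesis by blast
  qed
  have w: "within_arc (?e B) (?o C) \<longleftrightarrow> within_arc B C" if "B \<in> \<pi>" for B C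
    using cyclic_pred_double[of B] blk[of B] that by (simp add: within_arc_def)
  have eo: "\<not> crosses (?e B) (?o C) \<and> \<not> crosses (?o C) (?e B) \<longleftrightarrow> within_arc B C" if "B \<in> \<pi>" "C \<in> \<sigma>" for B C
    using within_arc_not_crosses[of "?e B" "?o C"] disjoint_within_arc[of "?e B" "?o C"] w[OF that(1), of C] dis blk[of B] that
    by (metis UnCI finite_imageI image_is_empty)
  have inj: "?e B = ?e C \<longleftrightarrow> B = C" "?o B = ?o C \<longleftrightarrow> B = C" for B C
    by (auto simp: inj_image_eq_iff inj_on_def)
  have "partition_on {2..2 * n + 1} ?U"
  proof (rule partition_onI)
    have "\<Union>?U = ?e (\<Union>\<pi>) \<union> ?o (\<Union>\<sigma>)" by blast
    also have "\<dots> = ?e {1..n} \<union> ?o {1..n}" using partition_onD1[OF \<pi>(1)] partition_onD1[OF assms(2)] by simp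
    also have "\<dots> = {2..2 * n + 1}"
    proof (intro equalityI subsetI)
      fix x assume x: "x \<in> {2..2 * n + 1}"
      then have "x div 2 \<in> {1..n}" by auto
      moreover have "x = 2 * (x div 2) \<or> x = 2 * (x div 2) + 1" by linarith
      ultimately show "x \<in> ?e {1..n} \<union> ?o {1..n}" by blast
    qed auto
    finally show "\<Union>?U = {2..2 * n + 1}" .
    show "disjnt X Y" if XY: "X \<in> ?U" "Y \<in> ?U" "X \<noteq> Y" for X Y
    proof -
      have d: "B = C \<or> B \<inter> C = {}" if "B \<in> \<pi> \<and> C \<in> \<pi> \<or> B \<in> \<sigma> \<and> C \<in> \<sigma>" for B C
        using that disjointD[OF partition_onD2[OF \<pi>(1)]] disjointD[OF partition_onD2[OF assms(2)]] by metis
      have int: "?e B \<inter> ?e C = ?e (B \<inter> C)" "?o B \<inter> ?o C = ?o (B \<inter> C)" for B C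
        by (rule image_Int[symmetric], simp add: inj_on_def)+
      have "(\<exists>B\<in>\<pi>. X = ?e B) \<or> (\<exists>B\<in>\<sigma>. X = ?o B)" "(\<exists>B\<in>\<pi>. Y = ?e B) \<or> (\<exists>B\<in>\<sigma>. Y = ?o B)"
        using XY(1,2) by (simp_all only: Un_iff image_iff)
      then show ?thesis
      proof (elim disjE bexE)
        fix B C assume *: "B \<in> \<pi>" "C \<in> \<pi>" "X = ?e B" "Y = ?e C"
        then have "B \<inter> C = {}" using d[of B C] XY(3) by metis
        then show ?thesis unfolding *(3,4) disjnt_def int by simp
      next
        fix B C assume *: "B \<in> \<sigma>" "C \<in> \<sigma>" "X = ?o B" "Y = ?o C"
        then have "B \<inter> C = {}" using d[of B C] XY(3) by metis
        then show ?thesis unfolding *(3,4) disjnt_def int by simp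
      next
        fix B C assume *: "X = ?e B" "Y = ?o C"
        show ?thesis unfolding * disjnt_def by (rule dis)
      next
        fix B C assume *: "X = ?o B" "Y = ?e C"
        show ?thesis unfolding * disjnt_def by (subst Int_commute) (rule dis)
      qed
    qed
    show "{} \<notin> ?U" using blk by auto
  qed
  then have "kreweras_candidate n \<pi> \<sigma> \<longleftrightarrow> noncrossing ?U"
    using assms(2) by (simp add: kreweras_candidate_def NCP_def)
  also have "\<dots> \<longleftrightarrow> noncrossing (?e ` \<pi>) \<and> noncrossing (?o ` \<sigma>) \<and>
      (\<forall>X\<in>?e ` \<pi>. \<forall>Y\<in>?o ` \<sigma>. X \<noteq> Y \<longrightarrow> \<not> crosses X Y \<and> \<not> crosses Y X)"
    by (rule noncrossing_Un)
  also have "noncrossing (?e ` \<pi>) \<longleftrightarrow> noncrossing \<pi>"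
    unfolding noncrossing_iff by (simp only: ball_simps ee inj)
  also have "noncrossing (?o ` \<sigma>) \<longleftrightarrow> noncrossing \<sigma>"
    unfolding noncrossing_iff by (simp only: ball_simps oo inj)
  also have "(\<forall>X\<in>?e ` \<pi>. \<forall>Y\<in>?o ` \<sigma>. X \<noteq> Y \<longrightarrow> \<not> crosses X Y \<and> \<not> crosses Y X) \<longleftrightarrow> (\<forall>B\<in>\<pi>. \<forall>C\<in>\<sigma>. within_arc B C)"
  proof -
    have "(?e B \<noteq> ?o C \<longrightarrow> \<not> crosses (?e B) (?o C) \<and> \<not> crosses (?o C) (?e B)) \<longleftrightarrow> within_arc B C" if "B \<in> \<pi>" "C \<in> \<sigma>" for B C
    proof -
      have "?e B \<noteq> ?o C" using dis[of B C] blk(2)[of B] that by auto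
      then show ?thesis using eo[OF that] by blast
    qed
    then show ?thesis by (simp only: ball_simps cong: ball_cong)
  qed
  also have "noncrossing \<pi> \<and> noncrossing \<sigma> \<and> (\<forall>B\<in>\<pi>. \<forall>C\<in>\<sigma>. within_arc B C) \<longleftrightarrow>
      noncrossing \<sigma> \<and> (\<forall>B\<in>\<pi>. \<forall>C\<in>\<sigma>. within_arc B C)"
    using \<pi>(2) by blast
  finally show ?thesis .
qed

text \<open>Each block of a candidate lies in one arc of every block of \<pi>, hence in one class,
  so no candidate is coarser than the classes. The classes are noncrossing because two different
  ones lie in different arcs of some block.\<close>

lemma kreweras_eq:
  assumes "\<pi> \<in> NCP {1..n}"
  shows "kreweras n \<pi> = kclass {1..n} \<pi> ` {1..n}"
proof -
  let ?K = "kclass {1..n} \<pi> ` {1..n}"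
  have \<pi>: "partition_on {1..n} \<pi>" using assms by (auto simp: NCP_def)
  have part: "partition_on {1..n} ?K" by (rule partition_on_kclass)
  have "noncrossing ?K"
    unfolding noncrossing_iff
  proof (intro ballI impI)
    fix C D assume C: "C \<in> ?K" and D: "D \<in> ?K" and CD: "C \<noteq> D"
    obtain x y where xy: "x \<in> {1..n}" "C = kclass {1..n} \<pi> x" "y \<in> {1..n}" "D = kclass {1..n} \<pi> y" using C D by blast
    have "y \<notin> kclass {1..n} \<pi> x" using kclass_eq CD xy by metis
    then obtain B where B: "B \<in> \<pi>" "cyclic_pred B y \<noteq> cyclic_pred B x" using xy(3) by (auto simp: kclass_def)
    have B': "finite B" "B \<noteq> {}"
      using partition_on_block[OF _ \<pi> B(1)] by blast+
    have "C \<subseteq> arc {1..n} B (cyclic_pred B x)" "D \<subseteq> arc {1..n} B (cyclic_pred B y)"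
      using xy B(1) by (auto simp: kclass_def arc_def)
    then show "\<not> crosses C D"
      using arcs_not_crosses[OF B'(1) cyclic_pred_mem[OF B'] cyclic_pred_mem[OF B']] B(2) crosses_mono by metis
  qed
  then have K: "kreweras_candidate n \<pi> ?K"
    using kreweras_candidate_iff[OF assms part] within_arc_kclass by blast
  have ref: "refines {1..n} \<tau> ?K" if "kreweras_candidate n \<pi> \<tau>" for \<tau>
  proof -
    have \<tau>: "partition_on {1..n} \<tau>" using that by (simp add: kreweras_candidate_def)
    have w: "within_arc B C" if "B \<in> \<pi>" "C \<in> \<tau>" for B C
      using kreweras_candidate_iff[OF assms \<tau>] \<open>kreweras_candidate n \<pi> \<tau>\<close> that by blast
    have "\<exists>D\<in>?K. C \<subseteq> D" if C: "C \<in> \<tau>" for C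
    proof -
      have "C \<subseteq> {1..n}" "C \<noteq> {}" using C partition_onD1[OF \<tau>] partition_onD3[OF \<tau>] by blast+
      moreover from this obtain x where x: "x \<in> C" by blast
      ultimately have "C \<subseteq> kclass {1..n} \<pi> x" using within_arcD[OF w[OF _ C] _ x] unfolding kclass_def by blast
      then show ?thesis using x \<open>C \<subseteq> {1..n}\<close> by blast
    qed
    then show ?thesis using \<tau> part by (simp add: refines_def)
  qed
  show ?thesis
    unfolding kreweras_def
  proof (rule the_equality)
    fix \<sigma> assume "kreweras_candidate n \<pi> \<sigma> \<and> (\<forall>\<tau>. kreweras_candidate n \<pi> \<tau> \<longrightarrow> refines {1..n} \<tau> \<sigma>)"
    then show "\<sigma> = ?K" using ref[of \<sigma>] K refines_asym by metis
  qed (use K ref in blast)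
qed

definition big_blocks :: "'a set set \<Rightarrow> 'a set set" where
  "big_blocks \<pi> = {B \<in> \<pi>. 2 \<le> card B}"

lemma card_one_or_two:
  assumes "finite V" "partition_on V \<pi>" "B \<in> \<pi>"
  shows "2 \<le> card B \<or> (\<exists>x. B = {x})"
proof -
  have "finite B" "B \<noteq> {}" using partition_on_block[OF assms] by simp_all
  then have "card B \<noteq> 0" by simp
  then consider "2 \<le> card B" | "card B = 1" by linarith
  then show ?thesis by cases (auto simp: card_1_singleton_iff)
qed

text \<open>A singleton separates no points, since its only arc is the whole circle.\<close>

lemma kclass_big_blocks:
  assumes "finite V" "partition_on V \<pi>"
  shows "kclass V (big_blocks \<pi>) x = kclass V \<pi> x"
proof -
  have "cyclic_pred B y = cyclic_pred B x" if "B \<in> \<pi>" "B \<notin> big_blocks \<pi>" for B y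
    using card_one_or_two[OF assms that(1)] that by (auto simp: big_blocks_def)
  then show ?thesis unfolding kclass_def big_blocks_def by blast
qed

lemma nc_family_big_blocks: "\<pi> \<in> NCP V \<Longrightarrow> nc_family V (big_blocks \<pi>)"
  by (rule nc_familyI) (auto simp: big_blocks_def NCP_def partition_on_def disjoint_def noncrossing_iff)

lemma NCd_iff:
  assumes "[n = 1] (mod d)"
  shows "\<pi> \<in> NCd d n \<longleftrightarrow> \<pi> \<in> NCP {1..n} \<and> big_blocks \<pi> \<in> nc_families d {1..n}"
proof (cases "\<pi> \<in> NCP {1..n}")
  case True
  then have part: "partition_on {1..n} \<pi>" by (simp add: NCP_def)
  have "(\<forall>B\<in>\<pi>. [card B = 1] (mod d)) \<longleftrightarrow> (\<forall>B\<in>big_blocks \<pi>. [card B = 1] (mod d))"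
    using card_one_or_two[OF _ part] by (fastforce simp: big_blocks_def)
  then have "\<pi> \<in> NCd d n \<longleftrightarrow> (\<forall>B\<in>big_blocks \<pi>. [card B = 1] (mod d)) \<and> (\<forall>C\<in>kclass {1..n} \<pi> ` {1..n}. [card C = 1] (mod d))"
    unfolding NCd_def using kreweras_eq[OF True] True by (simp only: mem_Collect_eq simp_thms)
  moreover have "kclass {1..n} (big_blocks \<pi>) = kclass {1..n} \<pi>"
    using kclass_big_blocks[OF _ part] by blast
  ultimately show ?thesis
    using True assms nc_families_iff_card[of "{1..n}" d, OF _ _ nc_family_big_blocks[OF True]] by simp
qed (simp add: NCd_def)

definition add_singletons :: "'a set \<Rightarrow> 'a set set \<Rightarrow> 'a set set" where
  "add_singletons V M = M \<union> (\<lambda>x. {x}) ` (V - \<Union>M)"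

lemma add_singletons_big_blocks:
  assumes "finite V" "partition_on V \<pi>"
  shows "add_singletons V (big_blocks \<pi>) = \<pi>"
proof (intro equalityI subsetI)
  fix B assume B: "B \<in> add_singletons V (big_blocks \<pi>)"
  show "B \<in> \<pi>"
  proof (cases "B \<in> big_blocks \<pi>")
    case False
    then obtain x where x: "x \<in> V" "x \<notin> \<Union>(big_blocks \<pi>)" "B = {x}" using B by (auto simp: add_singletons_def)
    obtain C where C: "C \<in> \<pi>" "x \<in> C" using x(1) partition_onD1[OF assms(2)] by blast
    then have "C = {x}" using card_one_or_two[OF assms C(1)] x(2) by (auto simp: big_blocks_def)
    then show ?thesis using C x by simp
  qed (simp add: big_blocks_def)
next
  fix B assume B: "B \<in> \<pi>"
  show "B \<in> add_singletons V (big_blocks \<pi>)"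
  proof (cases "2 \<le> card B")
    case False
    then obtain x where x: "B = {x}" using card_one_or_two[OF assms B] by blast
    have "x \<notin> C" if "C \<in> big_blocks \<pi>" for C
      using that B x partition_onD2[OF assms(2)] unfolding big_blocks_def disjoint_def by fastforce
    moreover have "x \<in> V" using B x partition_onD1[OF assms(2)] by blast
    ultimately show ?thesis using x by (auto simp: add_singletons_def)
  qed (use B in \<open>simp add: add_singletons_def big_blocks_def\<close>)
qed

lemma big_blocks_add_singletons:
  assumes "nc_family V M"
  shows "big_blocks (add_singletons V M) = M"
  using nc_familyD(2)[OF assms] by (auto simp: big_blocks_def add_singletons_def)

lemma not_crosses_singleton: "\<not> crosses {x} B" "\<not> crosses B {x}"
  unfolding crosses_def by auto

lemma add_singletons_NCP:
  assumes "nc_family V M"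
  shows "add_singletons V M \<in> NCP V"
proof -
  note M = nc_familyD[OF assms]
  have "partition_on V (add_singletons V M)"
  proof (rule partition_onI)
    show "\<Union>(add_singletons V M) = V" using M(1) by (auto simp: add_singletons_def)
    show "disjnt B C" if "B \<in> add_singletons V M" "C \<in> add_singletons V M" "B \<noteq> C" for B C
      using that M(4)[of B C] by (auto simp: add_singletons_def disjnt_def)
    show "{} \<notin> add_singletons V M" using M(3) by (auto simp: add_singletons_def)
  qed
  moreover have "noncrossing (add_singletons V M)"
    using M(5) not_crosses_singleton by (auto simp: noncrossing_iff add_singletons_def)
  ultimately show ?thesis by (simp add: NCP_def)
qed

lemma poset_iso_NCd_order:
  assumes "[n = 1] (mod d)"
  shows "poset_iso (NCd_order d n) (fam_order (nc_families d {1..n}))"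
proof -
  let ?V = "{1..n}"
  have part: "partition_on ?V \<pi>" if "\<pi> \<in> NCd d n" for \<pi> using that by (simp add: NCd_iff[OF assms] NCP_def)
  have "refines ?V \<pi> \<pi>" if "\<pi> \<in> NCd d n" for \<pi> by (rule refines_refl[OF part[OF that]])
  then have F: "Field (NCd_order d n) = NCd d n" unfolding Field_def NCd_order_def by auto
  have "bij_betw big_blocks (NCd d n) (nc_families d ?V)"
  proof (rule bij_betw_byWitness[where f' = "add_singletons ?V"])
    show "\<forall>\<pi>\<in>NCd d n. add_singletons ?V (big_blocks \<pi>) = \<pi>" using add_singletons_big_blocks part by blast
    show "\<forall>M\<in>nc_families d ?V. big_blocks (add_singletons ?V M) = M"
      using big_blocks_add_singletons nc_familiesD(1) by blast
    show "big_blocks ` NCd d n \<subseteq> nc_families d ?V" using NCd_iff[OF assms] by blast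
    show "add_singletons ?V ` nc_families d ?V \<subseteq> NCd d n"
      using NCd_iff[OF assms] add_singletons_NCP big_blocks_add_singletons nc_familiesD(1) by (metis image_subsetI)
  qed
  moreover have "(\<pi>, \<rho>) \<in> NCd_order d n \<longleftrightarrow> (big_blocks \<pi>, big_blocks \<rho>) \<in> fam_order (nc_families d ?V)"
    if mem: "\<pi> \<in> NCd d n" "\<rho> \<in> NCd d n" for \<pi> \<rho>
  proof -
    have fin: "finite B" if "B \<in> \<rho>" for B
      using partition_on_block(2)[OF _ part[OF mem(2)] that] by blast
    have "refines ?V \<pi> \<rho> \<longleftrightarrow> fam_le \<pi> \<rho>"
      using part mem by (auto simp: refines_def fam_le_def)
    also have "\<dots> \<longleftrightarrow> fam_le (big_blocks \<pi>) (big_blocks \<rho>)"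
    proof
      assume L: "fam_le \<pi> \<rho>"
      show "fam_le (big_blocks \<pi>) (big_blocks \<rho>)"
        unfolding fam_le_def
      proof
        fix B assume B: "B \<in> big_blocks \<pi>"
        then obtain C where C: "C \<in> \<rho>" "B \<subseteq> C" using L by (auto simp: fam_le_def big_blocks_def)
        then have "card B \<le> card C" using card_mono[OF fin] by blast
        then show "\<exists>C\<in>big_blocks \<rho>. B \<subseteq> C" using B C by (auto simp: big_blocks_def)
      qed
    next
      assume R: "fam_le (big_blocks \<pi>) (big_blocks \<rho>)"
      show "fam_le \<pi> \<rho>"
        unfolding fam_le_def
      proof
        fix B assume B: "B \<in> \<pi>"
        show "\<exists>C\<in>\<rho>. B \<subseteq> C"
        proof (cases "2 \<le> card B")
          case True
          then show ?thesis using R B by (auto simp: fam_le_def big_blocks_def)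
        next
          case False
          then obtain x where x: "B = {x}" using card_one_or_two[OF _ part[OF mem(1)] B] by auto
          then have "x \<in> \<Union>\<rho>" using B partition_onD1[OF part[OF mem(1)]] partition_onD1[OF part[OF mem(2)]] by blast
          then show ?thesis using x by blast
        qed
      qed
    qed
    finally show ?thesis using mem NCd_iff[OF assms] by (simp add: NCd_order_def mem_fam_order)
  qed
  ultimately show ?thesis unfolding poset_iso_def F by auto
qed

lemma iso_class_nc_families:
  assumes "finite V" "[card V = 1] (mod d)"
  shows "iso_class (fam_order (nc_families d V)) = iso_class (NCd_order d (card V))"
proof -
  note b = bounded_poset_nc_families(1)[OF assms(1), of d]
  have iso: "poset_iso (fam_order (nc_families d V)) (NCd_order d (card V))"
    by (rule poset_iso_trans[OF poset_iso_nc_families[OF assms(1)] poset_iso_sym[OF poset_iso_NCd_order[OF assms(2)]]])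
  show ?thesis using iso iso_class_eq_iff[OF b bounded_poset_iso[OF iso b]] by blast
qed

section \<open>The antipode by induction over all pairs of a vertex set and a family\<close>

section \<open>The antipode of the poset of indivisible noncrossing partitions\<close>

lemma upper_families_empty [simp]: "upper_families d V {} = nc_families d V"
  by (simp add: upper_families_def)

lemma hypertree_sum_point:
  assumes "finite V" "card V = 1"
  shows "hypertree_sum N d V {} = 1"
proof -
  have "T = {}" if T: "hypertree V T" for T
  proof (rule ccontr)
    assume "T \<noteq> {}"
    then obtain E where E: "E \<in> T" by blast
    show False using card_mono[OF assms(1) hypertreeD(1)[OF T E]] hypertreeD(2)[OF T E] assms(2) by simp
  qed
  moreover have "hypertree V {}"
  proof -
    obtain x where "V = {x}" using assms(2) by (rule card_1_singletonE)
    then show ?thesis by (simp add: hypertree_def hypergraph_def hyper_connected_def)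
  qed
  ultimately have "nc_hypertrees d V = {{}}" by (auto simp: nc_hypertrees_def noncrossing_iff)
  then show ?thesis by (simp add: hypertree_sum_def)
qed

text \<open>If \<open>M\<close> has a block, both sides factor over its arcs, which are smaller. No
  splitting is available for \<open>M = {}\<close>; there the nonempty case for the same
  \<open>V\<close> supplies all other summands of the recursion.\<close>

lemma antipode_upper_families:
  assumes "finite V" "V \<noteq> {}" "[card V = 1] (mod d)" "M \<in> nc_families d V"
  shows "antipode (basis (iso_class (fam_order (upper_families d V M)))) =
    hypertree_sum (NCd_elem d :: nat \<Rightarrow> bposet \<Rightarrow>\<^sub>0 'k::field) d V M"
  using assms
proof (induction "card V" arbitrary: V M rule: less_induct)
  case less
  note V = less.prems(1,2,3)
  let ?S = "\<lambda>V M. antipode (basis (iso_class (fam_order (upper_families d V M)))) :: bposet \<Rightarrow>\<^sub>0 'k"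
  let ?N = "NCd_elem d :: nat \<Rightarrow> bposet \<Rightarrow>\<^sub>0 'k"
  have nonempty: "?S V M = hypertree_sum ?N d V M" if M: "M \<in> nc_families d V" "M \<noteq> {}" for M
  proof -
    obtain E where E: "E \<in> M" using M(2) by blast
    note EV = nc_familyD(1,2)[OF nc_familiesD(1)[OF M(1)] E]
    have good: "good d V E" by (rule nc_familiesD(2)[OF M(1) E])
    have "?S V M = (\<Prod>v\<in>E. ?S (arc V E v) (inside M (arc V E v)))"
      unfolding iso_class_upper_interval_step[OF V(1,3) EV good M(1) E] by (rule antipode_sum)
    also have "\<dots> = (\<Prod>v\<in>E. hypertree_sum ?N d (arc V E v) (inside M (arc V E v)))"
    proof (rule prod.cong[OF refl])
      fix v assume v: "v \<in> E"
      show "?S (arc V E v) (inside M (arc V E v)) = hypertree_sum ?N d (arc V E v) (inside M (arc V E v))"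
      proof (rule less.hyps[OF card_arc_less[OF V(1) EV v] finite_arc[OF V(1)]])
        show "arc V E v \<noteq> {}" using mem_arc[OF V(1) EV(1) v] by blast
        show "[card (arc V E v) = 1] (mod d)" using good v unfolding good_def by blast
        show "inside M (arc V E v) \<in> nc_families d (arc V E v)" by (rule nc_families_inside_arc[OF V(1) M(1) V(3) E v])
      qed
    qed
    also have "\<dots> = hypertree_sum ?N d V M" by (rule hypertree_sum_step[OF V(1,3) M(1) E, symmetric])
    finally show ?thesis .
  qed
  have empty: "?S V {} = hypertree_sum ?N d V {}"
  proof (cases "2 \<le> card V")
    case False
    then have 1: "card V = 1" using V by (metis One_nat_def Suc_1 Suc_leI card_gt_0_iff le_neq_implies_less)
    have "top_family V = {}" using False by (simp add: top_family_def)
    then have "iso_class (fam_order (nc_families d V)) = 0"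
      using iso_class_eq_zero_iff[OF bounded_poset_nc_families(1)[OF V(1)]] bounded_poset_nc_families(2,3)[OF V(1)] by simp
    then show ?thesis using hypertree_sum_point[OF V(1) 1] by (simp add: basis_zero antipode_one)
  next
    case True
    let ?F = "nc_families d V"
    let ?r = "fam_order ?F"
    note b = bounded_poset_nc_families[OF V(1), of d]
    have fin: "finite ?F" by (rule finite_nc_families[OF V(1)])
    have low: "basis (iso_class (interval ?r {} M)) = (\<Prod>E\<in>M. ?N (card E))" if M: "M \<in> ?F" for M
    proof -
      have "iso_class (interval ?r {} M) = (\<Sum>E\<in>M. iso_class (fam_order (nc_families d E)))"
        unfolding interval_nc_families(1)[OF V(1) M] by (rule iso_class_lower_interval[OF V(1) M])
      also have "\<dots> = (\<Sum>E\<in>M. iso_class (NCd_order d (card E)))"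
      proof (rule sum.cong[OF refl])
        fix E assume E: "E \<in> M"
        note EV = nc_familyD(1,3)[OF nc_familiesD(1)[OF M] E]
        have "[card E = 1] (mod d)"
          using good_card[OF V(1) EV nc_familiesD(2)[OF M E]] V(3) cong_trans cong_sym by blast
        then show "iso_class (fam_order (nc_families d E)) = iso_class (NCd_order d (card E))"
          by (rule iso_class_nc_families[OF finite_subset[OF EV(1) V(1)]])
      qed
      finally show ?thesis by (simp add: basis_sum NCd_elem_def)
    qed
    have "top_family V \<noteq> {}" using True by (simp add: top_family_def)
    then have "(\<Sum>M\<in>?F. basis (iso_class (interval ?r {} M)) * antipode (basis (iso_class (interval ?r M (top_family V))))) =
        (0 :: bposet \<Rightarrow>\<^sub>0 'k)"
      using antipode_rec[OF b(1), where 'k = 'k] by (simp add: b(2,3))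
    moreover have "(\<Sum>M\<in>?F. basis (iso_class (interval ?r {} M)) * antipode (basis (iso_class (interval ?r M (top_family V))))) =
        (\<Sum>M\<in>?F. (\<Prod>E\<in>M. ?N (card E)) * ?S V M)"
      by (rule sum.cong[OF refl]) (simp only: low interval_nc_families(2)[OF V(1)])
    \<comment> \<open>Both weighted sums vanish. Cancelling the summands with nonempty
      \<open>M\<close> isolates \<open>M = {}\<close>, whose weight is the empty product 1.\<close>
    ultimately have "(\<Sum>M\<in>?F. (\<Prod>E\<in>M. ?N (card E)) * ?S V M) = (\<Sum>M\<in>?F. (\<Prod>E\<in>M. ?N (card E)) * hypertree_sum ?N d V M)"
      using sum_nc_families_hypertree_sum[OF V(1) True, of ?N d] by simp
    moreover have "(\<Sum>M\<in>?F - {{}}. (\<Prod>E\<in>M. ?N (card E)) * ?S V M) =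
        (\<Sum>M\<in>?F - {{}}. (\<Prod>E\<in>M. ?N (card E)) * hypertree_sum ?N d V M)"
      by (rule sum.cong[OF refl]) (simp add: nonempty)
    ultimately show ?thesis
      using sum.remove[OF fin empty_nc, of "\<lambda>M. (\<Prod>E\<in>M. ?N (card E)) * ?S V M"]
        sum.remove[OF fin empty_nc, of "\<lambda>M. (\<Prod>E\<in>M. ?N (card E)) * hypertree_sum ?N d V M"] by simp
  qed
  show ?case using nonempty[OF less.prems(4)] empty by (cases "M = {}") simp_all
qed

theorem theorem6p2:
  fixes n d :: nat
  assumes "n > 0" and "d > 0" and "[n = 1] (mod d)"
  shows "antipode (NCd_elem d n :: bposet \<Rightarrow>\<^sub>0 'k::field) =
    (\<Sum>T \<in> {T \<in> noncrossing_hypertrees n. \<forall>E\<in>T. [card E = 1] (mod d)}.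
       (-1) ^ card T * (\<Prod>E\<in>T. NCd_elem d (card E)))"
proof -
  have "antipode (NCd_elem d n :: bposet \<Rightarrow>\<^sub>0 'k) = hypertree_sum (NCd_elem d) d {1..n} {}"
    using antipode_upper_families[of "{1..n}" d "{}", where 'k = 'k] iso_class_nc_families[of "{1..n}" d] assms
    by (simp add: NCd_elem_def empty_nc)
  also have "\<dots> = (\<Sum>T\<in>nc_hypertrees d {1..n}. (-1) ^ card T * (\<Prod>E\<in>T. NCd_elem d (card E)))"
    \<comment> \<open>For \<open>M = {}\<close> every edge contributes a factor -1, and together
      these form the sign.\<close>
    unfolding hypertree_sum_def by (simp add: prod_uminus)
  also have "nc_hypertrees d {1..n} = {T \<in> noncrossing_hypertrees n. \<forall>E\<in>T. [card E = 1] (mod d)}"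
    by (auto simp: nc_hypertrees_def noncrossing_hypertrees_def)
  finally show ?thesis .
qed

end
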